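(* Let $n\ge 2$ and let $\Delta_n[y]=0$ be an $n$th order nonlinear ODE of maximal symmetry. Assume that it is obtained from the trivial equation $w^{(n)}=0$ by an invertible point transformation $\sigma$: $z=\zeta(x,y)$, $w=\phi(x,y)$, and denote by $\sigma_*$ the push-forward of $\sigma$. Let $\mathcal{S}_{div}$ be the divergence symmetry algebra of $\Delta_n[y]=0$ and, in case this equation is also Lagrangian, let $\mathcal{S}_{var}$ be its variational symmetry algebra. Then: (a) For $n$ odd, $\mathcal{S}_{div}$ is isomorphic under $\sigma_*$ to $\mathcal{A}_n\dotplus\mathbb{R}W_w$. (b) For $n$ even, $\mathcal{S}_{div}$ is isomorphic under $\sigma_*$ to $\mathcal{A}_n\dotplus\mathfrak{s}$. (c) If $\Delta_n[y]=0$ is a Lagrangian equation ($n$ even), then with respect to the Lagrangian $$\mathscr{L}_n(x,y^{(n/2)})=L_n(z,w^{(n/2)})\,D_x\zeta ,\qquad L_n=\tfrac{(-1)^{n/2}}{2}\big(w^{(n/2)}\big)^2 ,$$ $\mathcal{S}_{var}$ is isomorphic under $\sigma_*$ to $\langle V_0,\dots,V_{\frac{n-2}{2}}\rangle\dotplus\langle F_n,G_n\rangle$. (d) A fundamental set of $n$ linearly independent first integrals of the nonlinear equation $\Delta_n[y]=0$ is obtained, by a mere change of coordinates defined by $\sigma$, from the first integral $$\mathscr{F}=\sum_{k=0}^{n-1}a_k\,\mathscr{F}(V_k),\qquad \mathscr{F}(V_k)=\sum_{i=0}^{k}(-1)^i\frac{k!}{(k-i)!}\,z^{k-i}\,w^{(n-1-i)},$$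 of the trivial equation $w^{(n)}=0$, where $a_0,\dots,a_{n-1}$ are arbitrary constants.
   Context: An ODE of order $n$ has maximal symmetry if its Lie point symmetry algebra has the maximal dimension possible for ODEs of order $n$ (this is $8$ for $n=2$ and $n+4$ for $n\ge3$); by a result of Lie any such equation can be mapped to $w^{(n)}=0$ by a point transformation. Here $\sigma:\Omega\to\tilde\Omega$ is an invertible change of variables from an open subset $\Omega$ of the $(x,y)$-plane onto an open subset $\tilde\Omega$ of the $(z,w)$-plane. Derivatives of $w$ with respect to $z$ are expressed in terms of $x,y$ and derivatives of $y$ by $\frac{d}{dz}=\frac{1}{D_x\zeta}D_x$, where $D_x$ is the total derivative. Vector fields on $\tilde\Omega$ (point symmetries of $w^{(n)}=0$): $V_k=z^k\partial_w$ for $0\le k\le n-1$; $W_w=w\,\partial_w$; $F_n=\partial_z$; $G_n=2z\,\partial_z+(n-1)w\,\partial_w$; $H_n=-z^2\partial_z-(n-1)zw\,\partial_w$. $\langle X_1,\dots,X_r\rangle$ denotes the real Lie algebra generated by the listed vector fields; $\mathcal{A}_n=\langle V_0,\dots,V_{n-1}\rangle$; $\mathfrak{s}=\langle F_n,G_n,H_n\rangle\cong\mathfrak{sl}(2,\mathbb{R})$; $\dotplus$ denotes direct sum of vector spaces. "Isomorphic under $\sigma_*$" means that $\sigma_*$ restricts to a Lie algebra isomorphism of the first algebra onto the second. A differential equation is called Lagrangian if it is equivalent (has the same solution set) to an Euler–Lagrange equation $E(L)=0$ for some Lagrangian function $L$. For a vector field $\mathbf{v}=\xi(x,y)\partial_x+\psi(x,y)\partial_y$,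 its characteristic is $Q=\psi-\xi y_x$. Let $D_P$ denote the Fréchet derivative of a differential function $P$ and $D_P^*$ its formal adjoint. A Lie point symmetry $\mathbf{v}$ of $\Delta=0$ is a divergence symmetry if and only if $D_\Delta^*(Q)+D_Q^*(\Delta)=0$ identically. It is a variational symmetry with respect to a Lagrangian $L$ if and only if $\mathrm{pr}\,\mathbf{v}(L)+L\,D_x\xi=0$ identically, where $\mathrm{pr}\,\mathbf{v}$ is the prolongation of $\mathbf{v}$. $\mathcal{S}_{div}$ and $\mathcal{S}_{var}$ are the Lie algebras of all divergence, respectively variational, Lie point symmetries of $\Delta_n[y]=0$. A first integral of an $n$th order ODE is a differential function of order at most $n-1$ that is constant on every solution.
   Formalization: "Obtained from w^(n)=0 by σ" is taken to mean Δ_n = c·J·w^(n) with J the Jacobian determinant of σ and c a nonzero constant; for other left-hand sides, such as w^(n) itself, the divergence symmetry claim fails (n=2, z=x, w=e^y). *)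

theory Defs
  imports "HOL-Analysis.Analysis" "HOL-Library.Function_Algebras"
begin

section \<open>Smooth maps on open sets\<close>

fun diff_of_class :: "nat \<Rightarrow> 'a::real_normed_vector set \<Rightarrow> ('a \<Rightarrow> 'b::real_normed_vector) \<Rightarrow> bool"
  where
    "diff_of_class 0 S f \<longleftrightarrow> continuous_on S f"
  | "diff_of_class (Suc m) S f \<longleftrightarrow> (\<forall>p\<in>S. f differentiable at p) \<and>
       (\<forall>h. diff_of_class m S (\<lambda>p. frechet_derivative f (at p) h))"

text \<open>Used only for open \<open>S\<close>, where it says that \<open>f\<close> is infinitely differentiable on \<open>S\<close>.\<close>

definition smooth_on :: "'a::real_normed_vector set \<Rightarrow> ('a \<Rightarrow> 'b::real_normed_vector) \<Rightarrow> bool"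
  where "smooth_on S f \<longleftrightarrow> (\<forall>m. diff_of_class m S f)"


section \<open>Vector fields and their Lie algebras\<close>

text \<open>A vector field \<open>\<xi> \<partial>\<^sub>x + \<psi> \<partial>\<^sub>y\<close> on an open subset \<open>\<Omega>\<close> of the plane is the map \<open>p \<mapsto> (\<xi> p, \<psi> p)\<close>,
  extended by zero outside \<open>\<Omega>\<close>, so that fields that agree on \<open>\<Omega>\<close> are equal.\<close>

type_synonym vfield = "real \<times> real \<Rightarrow> real \<times> real"

definition restrict_vf :: "(real \<times> real) set \<Rightarrow> vfield \<Rightarrow> vfield"
  where "restrict_vf \<Omega> v = (\<lambda>p. if p \<in> \<Omega> then v p else 0)"

definition vfields :: "(real \<times> real) set \<Rightarrow> vfield set"
  where "vfields \<Omega> = {v. smooth_on \<Omega> v \<and> (\<forall>p. p \<notin> \<Omega> \<longrightarrow> v p = 0)}"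

definition scale_vf :: "real \<Rightarrow> vfield \<Rightarrow> vfield"
  where "scale_vf c v = (\<lambda>p. c *\<^sub>R v p)"

global_interpretation vf: vector_space scale_vf
  by unfold_locales (simp_all add: scale_vf_def fun_eq_iff scaleR_add_right scaleR_add_left)

definition lie_bracket :: "(real \<times> real) set \<Rightarrow> vfield \<Rightarrow> vfield \<Rightarrow> vfield"
  where "lie_bracket \<Omega> u v =
    restrict_vf \<Omega> (\<lambda>p. frechet_derivative v (at p) (u p) - frechet_derivative u (at p) (v p))"

definition lie_subalgebra :: "(real \<times> real) set \<Rightarrow> vfield set \<Rightarrow> bool"
  where "lie_subalgebra \<Omega> S \<longleftrightarrow> S \<subseteq> vfields \<Omega> \<and> vf.subspace S \<and>
    (\<forall>u\<in>S. \<forall>v\<in>S. lie_bracket \<Omega> u v \<in> S)"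

definition lie_generated :: "(real \<times> real) set \<Rightarrow> vfield set \<Rightarrow> vfield set"
  where "lie_generated \<Omega> X = (lie_subalgebra \<Omega>) hull X"

definition is_direct_sum :: "vfield set \<Rightarrow> vfield set \<Rightarrow> vfield set \<Rightarrow> bool"
  where "is_direct_sum C A B \<longleftrightarrow> vf.subspace A \<and> vf.subspace B \<and> A \<inter> B = {0} \<and>
    C = {u + v | u v. u \<in> A \<and> v \<in> B}"

definition pushforward :: "(real \<times> real) set \<Rightarrow> (real \<times> real) set \<Rightarrow> (real \<times> real \<Rightarrow> real \<times> real) \<Rightarrow>
    vfield \<Rightarrow> vfield"
  where "pushforward \<Omega> \<Omega>' \<sigma> v = restrict_vf \<Omega>'
    (\<lambda>q. let p = inv_into \<Omega> \<sigma> q in frechet_derivative \<sigma> (at p) (v p))"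

definition isomorphic_under_pushforward ::
    "(real \<times> real) set \<Rightarrow> (real \<times> real) set \<Rightarrow> (real \<times> real \<Rightarrow> real \<times> real) \<Rightarrow> vfield set \<Rightarrow> vfield set \<Rightarrow> bool"
  where "isomorphic_under_pushforward \<Omega> \<Omega>' \<sigma> S T \<longleftrightarrow>
    (let F = pushforward \<Omega> \<Omega>' \<sigma> in
      lie_subalgebra \<Omega> S \<and> lie_subalgebra \<Omega>' T \<and> bij_betw F S T \<and>
      (\<forall>u\<in>S. \<forall>v\<in>S. F (u + v) = F u + F v) \<and>
      (\<forall>c. \<forall>u\<in>S. F (scale_vf c u) = scale_vf c (F u)) \<and>
      (\<forall>u\<in>S. \<forall>v\<in>S. F (lie_bracket \<Omega> u v) = lie_bracket \<Omega>' (F u) (F v)))"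

definition point_transformation ::
    "(real \<times> real) set \<Rightarrow> (real \<times> real) set \<Rightarrow> (real \<times> real \<Rightarrow> real \<times> real) \<Rightarrow> bool"
  where "point_transformation \<Omega> \<Omega>' \<sigma> \<longleftrightarrow> open \<Omega> \<and> open \<Omega>' \<and> bij_betw \<sigma> \<Omega> \<Omega>' \<and>
    smooth_on \<Omega> \<sigma> \<and> smooth_on \<Omega>' (inv_into \<Omega> \<sigma>)"

text \<open>The point symmetries of \<open>w\<^bsup>(n)\<^esup> = 0\<close>, in the coordinates \<open>(z, w)\<close>.\<close>

definition V_field :: "nat \<Rightarrow> vfield"
  where "V_field k = (\<lambda>(z, w). (0, z ^ k))"

definition W_field :: vfield
  where "W_field = (\<lambda>(z, w). (0, w))"

definition F_field :: vfield
  where "F_field = (\<lambda>(z, w). (1, 0))"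

definition G_field :: "nat \<Rightarrow> vfield"
  where "G_field n = (\<lambda>(z, w). (2 * z, (real n - 1) * w))"

definition H_field :: "nat \<Rightarrow> vfield"
  where "H_field n = (\<lambda>(z, w). (- (z\<^sup>2), - ((real n - 1) * z * w)))"


section \<open>Differential functions\<close>

text \<open>A jet is a pair \<open>(x, u)\<close> where \<open>u k\<close> is the coordinate \<open>y\<^bsup>(k)\<^esup>\<close>. The infinite sums over \<open>k\<close> below
  have only finitely many nonzero terms for functions that depend on finitely many coordinates.\<close>

type_synonym dfun = "real \<Rightarrow> (nat \<Rightarrow> real) \<Rightarrow> real"

definition pd_x :: "dfun \<Rightarrow> dfun"
  where "pd_x P = (\<lambda>x u. deriv (\<lambda>t. P t u) x)"

definition pd_u :: "nat \<Rightarrow> dfun \<Rightarrow> dfun"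
  where "pd_u k P = (\<lambda>x u. deriv (\<lambda>t. P x (u(k := t))) (u k))"

text \<open>On the open cylinder sets \<open>U\<close> of jets considered here, and for a function of finitely many
  coordinates, continuity in the product topology is continuity in these coordinates.\<close>

fun dfun_of_class :: "nat \<Rightarrow> (real \<times> (nat \<Rightarrow> real)) set \<Rightarrow> dfun \<Rightarrow> bool"
  where
    "dfun_of_class 0 U P \<longleftrightarrow> continuous_on U (\<lambda>(x, u). P x u)"
  | "dfun_of_class (Suc m) U P \<longleftrightarrow>
       (\<forall>(x, u)\<in>U. (\<lambda>t. P t u) differentiable at x \<and>
          (\<forall>k. (\<lambda>t. P x (u(k := t))) differentiable at (u k))) \<and>
       dfun_of_class 0 U P \<and> dfun_of_class m U (pd_x P) \<and> (\<forall>k. dfun_of_class m U (pd_u k P))"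

text \<open>A smooth differential function on \<open>U\<close> of order at most \<open>m\<close>.\<close>

definition diff_function :: "nat \<Rightarrow> (real \<times> (nat \<Rightarrow> real)) set \<Rightarrow> dfun \<Rightarrow> bool"
  where "diff_function m U P \<longleftrightarrow> (\<forall>r. dfun_of_class r U P) \<and>
    (\<forall>x u u'. (x, u) \<in> U \<and> (x, u') \<in> U \<and> (\<forall>k\<le>m. u k = u' k) \<longrightarrow> P x u = P x u')"

definition Dx :: "dfun \<Rightarrow> dfun"
  where "Dx P = (\<lambda>x u. pd_x P x u + (\<Sum>k. u (Suc k) * pd_u k P x u))"

text \<open>The formal adjoint \<open>D\<^sub>P\<^sup>*(R) = \<Sum>\<^sub>k (-D\<^sub>x)\<^sup>k (\<partial>P/\<partial>y\<^bsup>(k)\<^esup> R)\<close> of the Frechet derivative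
  \<open>D\<^sub>P = \<Sum>\<^sub>k \<partial>P/\<partial>y\<^bsup>(k)\<^esup> D\<^sub>x\<^sup>k\<close>.\<close>

definition frechet_adjoint :: "dfun \<Rightarrow> dfun \<Rightarrow> dfun"
  where "frechet_adjoint P R =
    (\<lambda>x u. \<Sum>k. (-1) ^ k * (Dx ^^ k) (\<lambda>x u. pd_u k P x u * R x u) x u)"

definition euler :: "dfun \<Rightarrow> dfun"
  where "euler L = (\<lambda>x u. \<Sum>k. (-1) ^ k * (Dx ^^ k) (pd_u k L) x u)"

definition lift :: "(real \<times> real \<Rightarrow> real) \<Rightarrow> dfun"
  where "lift g = (\<lambda>x u. g (x, u 0))"

definition characteristic :: "vfield \<Rightarrow> dfun"
  where "characteristic v = (\<lambda>x u. snd (v (x, u 0)) - fst (v (x, u 0)) * u 1)"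

text \<open>\<open>pr v = \<xi> \<partial>\<^sub>x + \<Sum>\<^sub>k (D\<^sub>x\<^sup>k Q + \<xi> y\<^bsup>(k+1)\<^esup>) \<partial>/\<partial>y\<^bsup>(k)\<^esup>\<close>, with \<open>Q\<close> the characteristic of \<open>v\<close>.\<close>

definition prolong :: "vfield \<Rightarrow> dfun \<Rightarrow> dfun"
  where "prolong v P = (\<lambda>x u. fst (v (x, u 0)) * pd_x P x u +
    (\<Sum>k. ((Dx ^^ k) (characteristic v) x u + fst (v (x, u 0)) * u (Suc k)) * pd_u k P x u))"


section \<open>Change of variables \<open>z = \<zeta>(x, y)\<close>, \<open>w = \<phi>(x, y)\<close> in differential functions\<close>

definition jets_over :: "(real \<times> real) set \<Rightarrow> (real \<times> (nat \<Rightarrow> real)) set"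
  where "jets_over \<Omega> = {(x, u). (x, u 0) \<in> \<Omega>}"

text \<open>The jets at which the derivatives of \<open>w\<close> with respect to \<open>z\<close> are defined.\<close>

definition regular_jets :: "(real \<times> real) set \<Rightarrow> (real \<times> real \<Rightarrow> real) \<Rightarrow> (real \<times> (nat \<Rightarrow> real)) set"
  where "regular_jets \<Omega> \<zeta> = {(x, u) \<in> jets_over \<Omega>. Dx (lift \<zeta>) x u \<noteq> 0}"

text \<open>\<open>w_deriv \<zeta> \<phi> k\<close> is \<open>w\<^bsup>(k)\<^esup>\<close> as a function of \<open>x, y, \<dots>, y\<^bsup>(k)\<^esup>\<close>.\<close>

primrec w_deriv :: "(real \<times> real \<Rightarrow> real) \<Rightarrow> (real \<times> real \<Rightarrow> real) \<Rightarrow> nat \<Rightarrow> dfun"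
  where
    "w_deriv \<zeta> \<phi> 0 = lift \<phi>"
  | "w_deriv \<zeta> \<phi> (Suc k) = (\<lambda>x u. Dx (w_deriv \<zeta> \<phi> k) x u / Dx (lift \<zeta>) x u)"

definition change_vars :: "(real \<times> real \<Rightarrow> real) \<Rightarrow> (real \<times> real \<Rightarrow> real) \<Rightarrow> dfun \<Rightarrow> dfun"
  where "change_vars \<zeta> \<phi> P = (\<lambda>x u. P (\<zeta> (x, u 0)) (\<lambda>k. w_deriv \<zeta> \<phi> k x u))"

definition jacobian :: "(real \<times> real \<Rightarrow> real) \<Rightarrow> (real \<times> real \<Rightarrow> real) \<Rightarrow> dfun"
  where "jacobian \<zeta> \<phi> = (\<lambda>x u. pd_x (lift \<zeta>) x u * pd_u 0 (lift \<phi>) x u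
    - pd_u 0 (lift \<zeta>) x u * pd_x (lift \<phi>) x u)"

definition trivial_eq :: "nat \<Rightarrow> dfun"
  where "trivial_eq n = (\<lambda>z w. w n)"

text \<open>Being a divergence symmetry depends on the left-hand side \<open>\<Delta>\<close> of the equation and not only
  on its solution set. A left-hand side transforms like an Euler-Lagrange expression:
  \<open>E(L(z, w, \<dots>) D\<^sub>x\<zeta>) = J E(L)(z, w, \<dots>)\<close>, with \<open>J\<close> the Jacobian determinant of \<open>(\<zeta>, \<phi>)\<close>; it may
  moreover be rescaled by a nonzero constant.\<close>

definition obtained_from_trivial ::
    "nat \<Rightarrow> (real \<times> real) set \<Rightarrow> (real \<times> real \<Rightarrow> real) \<Rightarrow> (real \<times> real \<Rightarrow> real) \<Rightarrow> dfun \<Rightarrow> bool"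
  where "obtained_from_trivial n \<Omega> \<zeta> \<phi> \<Delta> \<longleftrightarrow> (\<exists>c. c \<noteq> 0 \<and>
    (\<forall>(x, u) \<in> regular_jets \<Omega> \<zeta>. \<Delta> x u = c * jacobian \<zeta> \<phi> x u * change_vars \<zeta> \<phi> (trivial_eq n) x u))"


section \<open>Equations, symmetries, Lagrangians and first integrals\<close>

definition jet_of :: "(real \<Rightarrow> real) \<Rightarrow> real \<Rightarrow> nat \<Rightarrow> real"
  where "jet_of f x = (\<lambda>k. (deriv ^^ k) f x)"

definition is_solution :: "(real \<times> (nat \<Rightarrow> real)) set \<Rightarrow> dfun \<Rightarrow> real set \<Rightarrow> (real \<Rightarrow> real) \<Rightarrow> bool"
  where "is_solution U \<Delta> I f \<longleftrightarrow> open I \<and> is_interval I \<and> smooth_on I f \<and>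
    (\<forall>x\<in>I. (x, jet_of f x) \<in> U \<and> \<Delta> x (jet_of f x) = 0)"

definition linear_ode :: "nat \<Rightarrow> (real \<times> (nat \<Rightarrow> real)) set \<Rightarrow> dfun \<Rightarrow> bool"
  where "linear_ode n U \<Delta> \<longleftrightarrow> (\<exists>(a :: nat \<Rightarrow> real \<Rightarrow> real) b. \<forall>(x, u) \<in> U.
    \<Delta> x u = 0 \<longleftrightarrow> u n = (\<Sum>k<n. a k x * u k) + b x)"

definition lie_symmetries ::
    "(real \<times> real) set \<Rightarrow> (real \<times> (nat \<Rightarrow> real)) set \<Rightarrow> dfun \<Rightarrow> vfield set"
  where "lie_symmetries \<Omega> U \<Delta> =
    {v \<in> vfields \<Omega>. \<forall>(x, u) \<in> U. \<Delta> x u = 0 \<longrightarrow> prolong v \<Delta> x u = 0}"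

definition maximal_symmetry ::
    "nat \<Rightarrow> (real \<times> real) set \<Rightarrow> (real \<times> (nat \<Rightarrow> real)) set \<Rightarrow> dfun \<Rightarrow> bool"
  where "maximal_symmetry n \<Omega> U \<Delta> \<longleftrightarrow>
    vf.dim (lie_symmetries \<Omega> U \<Delta>) = (if n = 2 then 8 else n + 4)"

definition S_div ::
    "(real \<times> real) set \<Rightarrow> (real \<times> (nat \<Rightarrow> real)) set \<Rightarrow> dfun \<Rightarrow> vfield set"
  where "S_div \<Omega> U \<Delta> = {v \<in> lie_symmetries \<Omega> U \<Delta>. \<forall>(x, u) \<in> U.
    frechet_adjoint \<Delta> (characteristic v) x u + frechet_adjoint (characteristic v) \<Delta> x u = 0}"

definition S_var ::
    "(real \<times> real) set \<Rightarrow> (real \<times> (nat \<Rightarrow> real)) set \<Rightarrow> dfun \<Rightarrow> dfun \<Rightarrow> vfield set"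
  where "S_var \<Omega> U \<Delta> L = {v \<in> lie_symmetries \<Omega> U \<Delta>. \<forall>(x, u) \<in> U.
    prolong v L x u + L x u * Dx (lift (\<lambda>p. fst (v p))) x u = 0}"

definition lagrangian_of :: "nat \<Rightarrow> (real \<times> (nat \<Rightarrow> real)) set \<Rightarrow> dfun \<Rightarrow> dfun \<Rightarrow> bool"
  where "lagrangian_of m U \<Delta> L \<longleftrightarrow> diff_function m U L \<and>
    (\<forall>I f. is_solution U \<Delta> I f \<longleftrightarrow> is_solution U (euler L) I f)"

definition lagrangian_ode :: "(real \<times> (nat \<Rightarrow> real)) set \<Rightarrow> dfun \<Rightarrow> bool"
  where "lagrangian_ode U \<Delta> \<longleftrightarrow> (\<exists>m L. lagrangian_of m U \<Delta> L)"

definition trivial_lagrangian :: "nat \<Rightarrow> dfun"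
  where "trivial_lagrangian n = (\<lambda>z w. (-1) ^ (n div 2) / 2 * (w (n div 2))\<^sup>2)"

definition transformed_lagrangian ::
    "nat \<Rightarrow> (real \<times> real \<Rightarrow> real) \<Rightarrow> (real \<times> real \<Rightarrow> real) \<Rightarrow> dfun"
  where "transformed_lagrangian n \<zeta> \<phi> =
    (\<lambda>x u. change_vars \<zeta> \<phi> (trivial_lagrangian n) x u * Dx (lift \<zeta>) x u)"

definition first_integral ::
    "nat \<Rightarrow> (real \<times> (nat \<Rightarrow> real)) set \<Rightarrow> dfun \<Rightarrow> dfun \<Rightarrow> bool"
  where "first_integral n U \<Delta> P \<longleftrightarrow> diff_function (n - 1) U P \<and>
    (\<forall>I f. is_solution U \<Delta> I f \<longrightarrow> (\<forall>x\<in>I. \<forall>x'\<in>I. P x (jet_of f x) = P x' (jet_of f x')))"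

definition linearly_independent :: "nat \<Rightarrow> (real \<times> (nat \<Rightarrow> real)) set \<Rightarrow> (nat \<Rightarrow> dfun) \<Rightarrow> bool"
  where "linearly_independent n U P \<longleftrightarrow>
    (\<forall>c. (\<forall>(x, u) \<in> U. (\<Sum>k<n. c k * P k x u) = 0) \<longrightarrow> (\<forall>k<n. c k = (0::real)))"

text \<open>The differentials of the functions are linearly independent at every point of \<open>U\<close>.\<close>

definition functionally_independent :: "nat \<Rightarrow> (real \<times> (nat \<Rightarrow> real)) set \<Rightarrow> (nat \<Rightarrow> dfun) \<Rightarrow> bool"
  where "functionally_independent n U P \<longleftrightarrow> (\<forall>(x, u) \<in> U. \<forall>c.
    (\<Sum>k<n. c k * pd_x (P k) x u) = 0 \<and> (\<forall>j. (\<Sum>k<n. c k * pd_u j (P k) x u) = 0) \<longrightarrow>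
    (\<forall>k<n. c k = (0::real)))"

definition fundamental_first_integrals ::
    "nat \<Rightarrow> (real \<times> (nat \<Rightarrow> real)) set \<Rightarrow> dfun \<Rightarrow> (nat \<Rightarrow> dfun) \<Rightarrow> bool"
  where "fundamental_first_integrals n U \<Delta> P \<longleftrightarrow> (\<forall>k<n. first_integral n U \<Delta> (P k)) \<and>
    linearly_independent n U P \<and> functionally_independent n U P"

definition V_integral :: "nat \<Rightarrow> nat \<Rightarrow> dfun"
  where "V_integral n k =
    (\<lambda>z w. \<Sum>i\<le>k. (-1) ^ i * (fact k / fact (k - i)) * z ^ (k - i) * w (n - 1 - i))"

end

theory Submission
  imports Defs
begin

text \<open>
  All functions on jets are treated as elements of a ring with the derivation \<open>D\<^sub>x\<close>. Integration by parts
  shows that a function \<open>P\<close> has the first variation \<open>R E(P)\<close> up to total derivatives, and this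
  characterizes \<open>E(P)\<close>. Adding a multiple of \<open>D\<^sub>x\<close> to an evolutionary derivation gives a derivation that fixes
  \<open>z = \<zeta>(x, y)\<close> and commutes with \<open>d/dz\<close>; hence Euler expressions transform by the Jacobian \<open>J\<close>. If \<open>Q\<close> is the
  characteristic of \<open>v\<close> and \<open>Q'\<close> that of its push-forward, then \<open>Q \<Delta> = c Q' w\<^bsup>(n)\<^esup> D\<^sub>x \<zeta>\<close>, so \<open>v\<close> is a divergence symmetry
  if and only if the Euler expression of \<open>Q' w\<^bsup>(n)\<^esup>\<close> vanishes, which is computed explicitly.
  The symmetries need not be found from determining equations: the pull-backs of the known
  point symmetries of \<open>w\<^bsup>(n)\<^esup> = 0\<close> are independent and as many as the assumed dimension of the symmetry algebra.
\<close>

section \<open>Mixed partial derivatives\<close>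

text \<open>The divergence condition is a single Euler expression because E(P Q) = D_P^*(Q) +
  D_Q^*(P), applied to Delta and the characteristic Q. Parity enters through the sign of (-d/dz)^n:
  the coefficient of w^(n+1) in the resulting expression is (1 - (-1)^n) xi, which is absent for
  even n and forces xi = 0 for odd n.

  The functions w^(k) are not the coordinates of the jet space in use, so an identity that is
  polynomial in w, w', ..., w^(n+1) cannot be split into coefficients directly. Derivations that act
  at a given jet like the partial derivatives with respect to w^(j) do this splitting. What remains
  are polynomials in z, and these have zero coefficients because z takes infinitely many values on
  the domain.

  For n = 2 there are two more symmetries than the general pattern gives. All orders are treated
  together by coefficient vectors of length n + 6, whose last two entries are zero unless n = 2.
  Division by D_x zeta is unavoidable in d/dz, hence the computations take place on the open set of
  regular jets.\<close>

lemma mixed_difference_quotient_tendsto: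
  fixes f fx fxy :: "real \<Rightarrow> real \<Rightarrow> real"
  assumes A: "open A" "(a, b) \<in> A"
    and fx: "\<And>s t. (s, t) \<in> A \<Longrightarrow> ((\<lambda>s. f s t) has_field_derivative fx s t) (at s)"
    and fxy: "\<And>s t. (s, t) \<in> A \<Longrightarrow> ((\<lambda>t. fx s t) has_field_derivative fxy s t) (at t)"
    and cont: "continuous_on A (\<lambda>(s, t). fxy s t)"
  shows "((\<lambda>h. (f (a + h) (b + h) - f (a + h) b - f a (b + h) + f a b) / (h * h)) \<longlongrightarrow> fxy a b) (at_right 0)"
proof (rule tendstoI)
  fix e :: real assume e: "e > 0"
  have "isCont (\<lambda>(s, t). fxy s t) (a, b)"
    using cont A by (simp add: continuous_on_eq_continuous_at)
  then obtain d1 where d1: "d1 > 0" "\<And>q. dist q (a, b) < d1 \<Longrightarrow> dist (case q of (s, t) \<Rightarrow> fxy s t) (fxy a b) < e"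
    unfolding continuous_at_eps_delta using e by (metis (no_types, lifting) split_conv)
  obtain d2 where d2: "d2 > 0" "ball (a, b) d2 \<subseteq> A"
    using A openE by blast
  \<comment> \<open>The distance is bounded by the sum of the two coordinate offsets, each of which
    stays below half the radius.\<close>
  define d where "d = min d1 d2 / 2"
  have d: "d > 0" using d1 d2 by (simp add: d_def)
  have close: "dist (s, t) (a, b) < min d1 d2" if "a \<le> s" "s < a + d" "b \<le> t" "t < b + d" for s t
  proof -
    have "dist (s, t) (a, b) \<le> \<bar>s - a\<bar> + \<bar>t - b\<bar>"
      using sqrt_sum_squares_le_sum_abs[of "s - a" "t - b"] by (simp add: dist_Pair_Pair dist_real_def)
    also have "\<dots> < min d1 d2" using that unfolding d_def by linarith
    finally show ?thesis .
  qed
  have box: "(s, t) \<in> A" if "a \<le> s" "s < a + d" "b \<le> t" "t < b + d" for s t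
    using close[OF that] d2 by (auto simp: dist_commute subset_iff)
  have "dist ((f (a + h) (b + h) - f (a + h) b - f a (b + h) + f a b) / (h * h)) (fxy a b) < e"
    if h: "0 < h" "h < d" for h
  proof -
    \<comment> \<open>Mean value theorem in the first variable for
      \<open>f s (b + h) - f s b\<close>; a second application, in the other variable, turns the
      difference of \<open>fx\<close> into \<open>fxy\<close> at an interior point.\<close>
    have "\<exists>s. a < s \<and> s < a + h \<and> (f (a + h) (b + h) - f (a + h) b) - (f a (b + h) - f a b)
        = (a + h - a) * (fx s (b + h) - fx s b)"
      by (rule MVT2[of a "a + h" "\<lambda>s. f s (b + h) - f s b"])
        (use h in \<open>auto intro!: DERIV_diff fx box\<close>)
    then obtain s where s: "a < s" "s < a + h"
      "(f (a + h) (b + h) - f (a + h) b) - (f a (b + h) - f a b) = h * (fx s (b + h) - fx s b)"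
      by auto
    have "\<exists>t. b < t \<and> t < b + h \<and> fx s (b + h) - fx s b = (b + h - b) * fxy s t"
      by (rule MVT2) (use h s in \<open>auto intro!: fxy box\<close>)
    then obtain t where t: "b < t" "t < b + h" "fx s (b + h) - fx s b = h * fxy s t"
      by auto
    have "(f (a + h) (b + h) - f (a + h) b - f a (b + h) + f a b) / (h * h) = fxy s t"
      using s(3) t(3) h by (simp add: algebra_simps)
    moreover have "dist (fxy s t) (fxy a b) < e"
      using d1(2)[of "(s, t)"] close[of s t] s t h by auto
    ultimately show ?thesis by simp
  qed
  then show "\<forall>\<^sub>F h in at_right 0. dist ((f (a + h) (b + h) - f (a + h) b - f a (b + h) + f a b) / (h * h)) (fxy a b) < e"
    unfolding eventually_at_right_field using d by (intro exI[of _ d]) auto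
qed

text \<open>The second difference over a square is symmetric in the two variables, so both iterated
  derivatives are limits of the same quotient.\<close>

lemma mixed_partials_eq:
  fixes f fx fy fxy fyx :: "real \<Rightarrow> real \<Rightarrow> real"
  assumes A: "open A" "(a, b) \<in> A"
    and fx: "\<And>s t. (s, t) \<in> A \<Longrightarrow> ((\<lambda>s. f s t) has_field_derivative fx s t) (at s)"
    and fy: "\<And>s t. (s, t) \<in> A \<Longrightarrow> ((\<lambda>t. f s t) has_field_derivative fy s t) (at t)"
    and fxy: "\<And>s t. (s, t) \<in> A \<Longrightarrow> ((\<lambda>t. fx s t) has_field_derivative fxy s t) (at t)"
    and fyx: "\<And>s t. (s, t) \<in> A \<Longrightarrow> ((\<lambda>s. fy s t) has_field_derivative fyx s t) (at s)"
    and cont: "continuous_on A (\<lambda>(s, t). fxy s t)" "continuous_on A (\<lambda>(s, t). fyx s t)"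
  shows "fxy a b = fyx a b"
proof -
  let ?A = "prod.swap -` A"
  have "open ?A" using A(1) continuous_on_swap by (rule open_vimage)
  moreover have "continuous_on ?A (\<lambda>(t, s). fyx s t)"
    using continuous_on_compose2[OF cont(2) continuous_on_swap, of ?A] by (simp add: case_prod_unfold image_subset_iff)
  ultimately have "((\<lambda>h. (f (a + h) (b + h) - f a (b + h) - f (a + h) b + f a b) / (h * h)) \<longlongrightarrow> fyx a b) (at_right 0)"
    using mixed_difference_quotient_tendsto[of ?A b a "\<lambda>t s. f s t" "\<lambda>t s. fy s t" "\<lambda>t s. fyx s t"] A fy fyx
    by simp
  moreover have "((\<lambda>h. (f (a + h) (b + h) - f (a + h) b - f a (b + h) + f a b) / (h * h)) \<longlongrightarrow> fxy a b) (at_right 0)"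
    by (rule mixed_difference_quotient_tendsto[OF A fx fxy cont(1)])
  moreover have "(\<lambda>h. (f (a + h) (b + h) - f (a + h) b - f a (b + h) + f a b) / (h * h)) =
     (\<lambda>h. (f (a + h) (b + h) - f a (b + h) - f (a + h) b + f a b) / (h * h))"
    by (simp add: algebra_simps)
  ultimately show ?thesis
    using tendsto_unique[OF trivial_limit_at_right_real] by simp
qed

section \<open>Smooth functions on open subsets of the plane\<close>

abbreviation d1 :: "(real \<times> real \<Rightarrow> real) \<Rightarrow> real \<times> real \<Rightarrow> real"
  where "d1 g p \<equiv> frechet_derivative g (at p) (1, 0)"

abbreviation d2 :: "(real \<times> real \<Rightarrow> real) \<Rightarrow> real \<times> real \<Rightarrow> real"
  where "d2 g p \<equiv> frechet_derivative g (at p) (0, 1)"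

lemma frechet_derivative_cong_open:
  assumes "open S" "p \<in> S" "\<And>q. q \<in> S \<Longrightarrow> f q = g q"
  shows "frechet_derivative f (at p) = frechet_derivative g (at p)"
    and "f differentiable at p \<longleftrightarrow> g differentiable at p"
proof -
  have "(f has_derivative D) (at p) \<longleftrightarrow> (g has_derivative D) (at p)" for D
    using has_derivative_transform_within_open[OF _ assms(1,2), of f D UNIV g]
      has_derivative_transform_within_open[OF _ assms(1,2), of g D UNIV f] assms(3) by auto
  then show "frechet_derivative f (at p) = frechet_derivative g (at p)"
    and "f differentiable at p \<longleftrightarrow> g differentiable at p"
    unfolding frechet_derivative_def differentiable_def by auto
qed

lemma diff_of_class_cong:
  assumes "open S" "\<And>q. q \<in> S \<Longrightarrow> f q = g q"
  shows "diff_of_class m S f \<longleftrightarrow> diff_of_class m S g"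
  using assms(2)
proof (induction m arbitrary: f g)
  case 0
  then show ?case by (simp cong: continuous_on_cong)
next
  case (Suc m)
  have "diff_of_class m S (\<lambda>p. frechet_derivative f (at p) h) \<longleftrightarrow>
      diff_of_class m S (\<lambda>p. frechet_derivative g (at p) h)" for h
    by (rule Suc.IH) (use frechet_derivative_cong_open(1)[OF assms(1) _ Suc.prems] in auto)
  then show ?case using frechet_derivative_cong_open(2)[OF assms(1) _ Suc.prems] by auto
qed

lemma smooth_on_cong:
  assumes "open S" "\<And>q. q \<in> S \<Longrightarrow> f q = g q"
  shows "smooth_on S f \<longleftrightarrow> smooth_on S g"
  using diff_of_class_cong[OF assms] by (simp add: smooth_on_def)

lemma diff_of_class_Suc_imp: "diff_of_class (Suc m) S f \<Longrightarrow> diff_of_class m S f"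
proof (induction m arbitrary: f)
  case 0
  then have "f differentiable_on S"
    by (auto simp: differentiable_on_def intro: differentiable_at_withinI)
  then show ?case by (simp add: differentiable_imp_continuous_on)
next
  case (Suc m)
  then show ?case by auto
qed

lemma smooth_on_differentiable: "smooth_on S f \<Longrightarrow> p \<in> S \<Longrightarrow> f differentiable at p"
  unfolding smooth_on_def by (metis diff_of_class.simps(2))

lemma smooth_on_frechet_derivative: "smooth_on S f \<Longrightarrow> smooth_on S (\<lambda>p. frechet_derivative f (at p) h)"
  unfolding smooth_on_def by (metis diff_of_class.simps(2))

lemma smooth_on_continuous_on: "smooth_on S f \<Longrightarrow> continuous_on S f"
  unfolding smooth_on_def by (metis diff_of_class.simps(1))

lemma frechet_derivative_eqI: "(f has_derivative D) (at p) \<Longrightarrow> frechet_derivative f (at p) = D"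
  by (metis frechet_derivative_at)

lemma smooth_on_const [simp, intro]: "smooth_on S (\<lambda>p. c)"
proof -
  have "diff_of_class m S (\<lambda>p. c)" for m
    by (induction m arbitrary: c) (simp_all add: frechet_derivative_const)
  then show ?thesis by (simp add: smooth_on_def)
qed

lemma diff_of_class_add:
  assumes S: "open S"
  shows "diff_of_class m S f \<Longrightarrow> diff_of_class m S g \<Longrightarrow> diff_of_class m S (\<lambda>p. f p + g p)"
proof (induction m arbitrary: f g)
  case 0
  then show ?case by (auto intro: continuous_intros)
next
  case (Suc m)
  have *: "((\<lambda>p. f p + g p) has_derivative (\<lambda>h. frechet_derivative f (at p) h + frechet_derivative g (at p) h)) (at p)"
    if "p \<in> S" for p
    using Suc.prems that by (intro has_derivative_add) (simp_all add: frechet_derivative_works)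
  have "diff_of_class m S (\<lambda>p. frechet_derivative f (at p) h + frechet_derivative g (at p) h)" for h
    using Suc by simp
  then have "diff_of_class m S (\<lambda>p. frechet_derivative (\<lambda>p. f p + g p) (at p) h)" for h
    using diff_of_class_cong[OF S, of "\<lambda>p. frechet_derivative (\<lambda>p. f p + g p) (at p) h"
        "\<lambda>p. frechet_derivative f (at p) h + frechet_derivative g (at p) h" m]
      frechet_derivative_eqI[OF *] by presburger
  then show ?case using * unfolding diff_of_class.simps differentiable_def by blast
qed

lemma diff_of_class_mult:
  fixes f g :: "'a::real_normed_vector \<Rightarrow> real"
  assumes S: "open S"
  shows "diff_of_class m S f \<Longrightarrow> diff_of_class m S g \<Longrightarrow> diff_of_class m S (\<lambda>p. f p * g p)"
proof (induction m arbitrary: f g)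
  case 0
  then show ?case by (auto intro: continuous_intros)
next
  case (Suc m)
  have *: "((\<lambda>p. f p * g p) has_derivative (\<lambda>h. f p * frechet_derivative g (at p) h + frechet_derivative f (at p) h * g p)) (at p)"
    if "p \<in> S" for p
    using Suc.prems that by (intro has_derivative_mult) (simp_all add: frechet_derivative_works)
  have "diff_of_class m S f" "diff_of_class m S g"
    using Suc.prems diff_of_class_Suc_imp by blast+
  then have "diff_of_class m S (\<lambda>p. f p * frechet_derivative g (at p) h + frechet_derivative f (at p) h * g p)" for h
    using Suc.prems by (intro diff_of_class_add[OF S] Suc.IH) simp_all
  then have "diff_of_class m S (\<lambda>p. frechet_derivative (\<lambda>p. f p * g p) (at p) h)" for h
    using diff_of_class_cong[OF S, of "\<lambda>p. frechet_derivative (\<lambda>p. f p * g p) (at p) h"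
        "\<lambda>p. f p * frechet_derivative g (at p) h + frechet_derivative f (at p) h * g p" m]
      frechet_derivative_eqI[OF *] by presburger
  then show ?case using * unfolding diff_of_class.simps differentiable_def by blast
qed

text \<open>The derivative is a product of the inverse itself, twice, and a derivative of
  \<open>f\<close>; so the induction hypothesis for the inverse closes the next class.\<close>

lemma diff_of_class_inverse:
  fixes f :: "'a::real_normed_vector \<Rightarrow> real"
  assumes S: "open S" and nz: "\<And>p. p \<in> S \<Longrightarrow> f p \<noteq> 0"
  shows "diff_of_class m S f \<Longrightarrow> diff_of_class m S (\<lambda>p. inverse (f p))"
proof (induction m)
  case 0
  then show ?case using nz by (auto intro: continuous_intros)
next
  case (Suc m)
  have *: "((\<lambda>p. inverse (f p)) has_derivative (\<lambda>h. - (inverse (f p) * frechet_derivative f (at p) h * inverse (f p)))) (at p)"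
    if "p \<in> S" for p
    using Suc.prems that nz by (intro Deriv.has_derivative_inverse) (simp_all add: frechet_derivative_works)
  have "diff_of_class m S (\<lambda>p. inverse (f p))"
    using Suc diff_of_class_Suc_imp by blast
  then have "diff_of_class m S (\<lambda>p. (- 1) * (inverse (f p) * frechet_derivative f (at p) h * inverse (f p)))" for h
    using Suc.prems smooth_on_const[unfolded smooth_on_def, rule_format, of m S "- 1 :: real"]
    by (intro diff_of_class_mult[OF S]) simp_all
  then have "diff_of_class m S (\<lambda>p. frechet_derivative (\<lambda>p. inverse (f p)) (at p) h)" for h
    using diff_of_class_cong[OF S, of "\<lambda>p. frechet_derivative (\<lambda>p. inverse (f p)) (at p) h"
        "\<lambda>p. (- 1) * (inverse (f p) * frechet_derivative f (at p) h * inverse (f p))" m]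
      frechet_derivative_eqI[OF *] by simp
  then show ?case using * unfolding diff_of_class.simps differentiable_def by blast
qed

lemma diff_of_class_linear_compose:
  assumes S: "open S" and L: "bounded_linear L"
  shows "diff_of_class m S f \<Longrightarrow> diff_of_class m S (\<lambda>p. L (f p))"
proof (induction m arbitrary: f)
  case 0
  then show ?case using L by (auto intro: bounded_linear.continuous_on)
next
  case (Suc m)
  have *: "((\<lambda>p. L (f p)) has_derivative (\<lambda>h. L (frechet_derivative f (at p) h))) (at p)" if "p \<in> S" for p
    using Suc.prems that by (intro bounded_linear.has_derivative[OF L]) (simp add: frechet_derivative_works)
  have "diff_of_class m S (\<lambda>p. L (frechet_derivative f (at p) h))" for h
    using Suc by simp
  then have "diff_of_class m S (\<lambda>p. frechet_derivative (\<lambda>p. L (f p)) (at p) h)" for h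
    using diff_of_class_cong[OF S, of "\<lambda>p. frechet_derivative (\<lambda>p. L (f p)) (at p) h"
        "\<lambda>p. L (frechet_derivative f (at p) h)" m] frechet_derivative_eqI[OF *] by presburger
  then show ?case using * unfolding diff_of_class.simps differentiable_def by blast
qed

lemma smooth_on_bounded_linear: "bounded_linear f \<Longrightarrow> smooth_on S f"
proof -
  assume f: "bounded_linear f"
  have *: "frechet_derivative f (at p) = f" for p
    by (rule frechet_derivative_eqI) (rule bounded_linear_imp_has_derivative[OF f])
  have "f differentiable at p" for p
    using bounded_linear_imp_has_derivative[OF f] differentiableI by blast
  then have "diff_of_class (Suc m) S f" for m
    using smooth_on_const[of S] unfolding diff_of_class.simps * smooth_on_def by blast
  then have "diff_of_class m S f" for m by (rule diff_of_class_Suc_imp)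
  then show ?thesis unfolding smooth_on_def by blast
qed

lemma smooth_on_linear_compose:
  "open S \<Longrightarrow> bounded_linear L \<Longrightarrow> smooth_on S f \<Longrightarrow> smooth_on S (\<lambda>p. L (f p))"
  unfolding smooth_on_def by (blast intro: diff_of_class_linear_compose)

lemma smooth_on_add:
  "open S \<Longrightarrow> smooth_on S f \<Longrightarrow> smooth_on S g \<Longrightarrow> smooth_on S (\<lambda>p. f p + g p)"
  unfolding smooth_on_def by (blast intro: diff_of_class_add)

lemma smooth_on_mult:
  fixes f g :: "'a::real_normed_vector \<Rightarrow> real"
  shows "open S \<Longrightarrow> smooth_on S f \<Longrightarrow> smooth_on S g \<Longrightarrow> smooth_on S (\<lambda>p. f p * g p)"
  unfolding smooth_on_def by (blast intro: diff_of_class_mult)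

lemma smooth_on_inverse:
  fixes f :: "'a::real_normed_vector \<Rightarrow> real"
  shows "open S \<Longrightarrow> smooth_on S f \<Longrightarrow> (\<And>p. p \<in> S \<Longrightarrow> f p \<noteq> 0) \<Longrightarrow> smooth_on S (\<lambda>p. inverse (f p))"
  unfolding smooth_on_def by (blast intro: diff_of_class_inverse)

text \<open>Links the Frechet derivatives, in which smoothness on the plane is stated, with the
  one-variable derivatives by which differential functions are differentiated.\<close>

lemma slice_derivatives:
  fixes g :: "real \<times> real \<Rightarrow> real"
  assumes "g differentiable at (s, t)"
  shows "((\<lambda>s. g (s, t)) has_field_derivative d1 g (s, t)) (at s)"
    and "((\<lambda>t. g (s, t)) has_field_derivative d2 g (s, t)) (at t)"
    and "frechet_derivative g (at (s, t)) (h, k) = h * d1 g (s, t) + k * d2 g (s, t)"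
proof -
  define D where "D = frechet_derivative g (at (s, t))"
  have D: "(g has_derivative D) (at (s, t))"
    using assms by (simp add: D_def frechet_derivative_works[symmetric])
  interpret bounded_linear D by (rule has_derivative_bounded_linear[OF D])
  have lin: "D (h, 0) = D (1, 0) * h" "D (0, h) = D (0, 1) * h" for h
    using scaleR[of h "(1, 0)"] scaleR[of h "(0, 1)"] by simp_all
  then have D1: "(*) (D (1, 0)) = (\<lambda>h. D (h, 0))" "(*) (D (0, 1)) = (\<lambda>h. D (0, h))"
    by (metis ext)+
  have "((\<lambda>s. (s, t)) has_derivative (\<lambda>h. (h, 0))) (at s)" "((\<lambda>t. (s, t)) has_derivative (\<lambda>h. (0, h))) (at t)"
    by (auto intro!: derivative_eq_intros)
  from this[THEN has_derivative_compose, OF D]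
  show "((\<lambda>s. g (s, t)) has_field_derivative d1 g (s, t)) (at s)"
    "((\<lambda>t. g (s, t)) has_field_derivative d2 g (s, t)) (at t)"
    by (simp_all add: has_field_derivative_def D1 D_def[symmetric])
  have "D (h, k) = D (h, 0) + D (0, k)" by (simp add: add[symmetric])
  then show "frechet_derivative g (at (s, t)) (h, k) = h * d1 g (s, t) + k * d2 g (s, t)"
    unfolding lin(1)[of h] lin(2)[of k] by (simp add: D_def mult.commute)
qed

lemma frechet_derivative_coordinates:
  fixes g :: "real \<times> real \<Rightarrow> real"
  assumes "g differentiable at p"
  shows "frechet_derivative g (at p) h = fst h * d1 g p + snd h * d2 g p"
  using slice_derivatives(3)[of g "fst p" "snd p" "fst h" "snd h"] assms by simp

section \<open>Partial and total derivatives of differential functions\<close>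

type_synonym jet = "real \<times> (nat \<Rightarrow> real)"

text \<open>The independent variable is the coordinate with index \<open>0\<close>, and \<open>y\<^bsup>(k)\<^esup>\<close> has index \<open>Suc k\<close>.\<close>

definition slot :: "nat \<Rightarrow> jet \<Rightarrow> real"
  where "slot i q = (case i of 0 \<Rightarrow> fst q | Suc k \<Rightarrow> snd q k)"

definition put :: "nat \<Rightarrow> real \<Rightarrow> jet \<Rightarrow> jet"
  where "put i t q = (case i of 0 \<Rightarrow> (t, snd q) | Suc k \<Rightarrow> (fst q, (snd q)(k := t)))"

definition pd :: "nat \<Rightarrow> dfun \<Rightarrow> dfun"
  where "pd i P = (case i of 0 \<Rightarrow> pd_x P | Suc k \<Rightarrow> pd_u k P)"

lemma pd_simps [simp]: "pd 0 P = pd_x P" "pd (Suc k) P = pd_u k P"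
  by (simp_all add: pd_def)

lemma slot_simps [simp]: "slot 0 (x, u) = x" "slot (Suc k) (x, u) = u k"
  by (simp_all add: slot_def)

lemma put_simps [simp]: "put 0 t (x, u) = (t, u)" "put (Suc k) t (x, u) = (x, u(k := t))"
  by (simp_all add: put_def)

lemma slot_put: "slot j (put i t q) = (if i = j then t else slot j q)"
  by (auto simp: slot_def put_def split: nat.splits)

lemma slot_put_same [simp]: "slot i (put i t q) = t"
  by (simp add: slot_put)

lemma put_slot [simp]: "put i (slot i q) q = q"
  by (auto simp: slot_def put_def split: nat.splits)

lemma put_put [simp]: "put i t (put i s q) = put i t q"
  by (auto simp: put_def split: nat.splits)

lemma put_commute: "i \<noteq> j \<Longrightarrow> put i t (put j s q) = put j s (put i t q)"
  by (auto simp: put_def fun_upd_twist split: nat.splits)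

text \<open>With slots, the derivatives with respect to x and to every y^(k) have one description,
  so later arguments need no separate case for x.\<close>

lemma case_prod_pd: "case_prod (pd i P) q = deriv (\<lambda>t. case_prod P (put i t q)) (slot i q)"
  by (cases q; cases i) (simp_all add: pd_x_def pd_u_def)

lemma continuous_on_put [continuous_intros]:
  assumes f: "continuous_on A f" and g: "continuous_on A g"
  shows "continuous_on A (\<lambda>p. put i (f p) (g p))"
proof (cases i)
  case 0
  then show ?thesis using assms by (simp add: put_def continuous_on_Pair continuous_on_snd)
next
  case (Suc k)
  have "continuous_on A (\<lambda>p. if j = k then f p else snd (g p) j)" for j
    using f g by (cases "j = k")
      (auto intro!: continuous_on_product_then_coordinatewise[OF continuous_on_snd])
  then have "continuous_on A (\<lambda>p. (snd (g p))(k := f p))"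
    by (intro continuous_on_coordinatewise_then_product) (simp add: fun_upd_def)
  with Suc g show ?thesis by (simp add: put_def continuous_on_Pair continuous_on_fst)
qed

lemma fun2_apply [simp]:
  fixes P Q :: "'a \<Rightarrow> 'b \<Rightarrow> 'c::comm_ring_1"
  shows "(P ^ k) x u = P x u ^ k" "sum F A x u = (\<Sum>i\<in>A. F i x u)"
proof -
  show "(P ^ k) x u = P x u ^ k" by (induction k) auto
  show "sum F A x u = (\<Sum>i\<in>A. F i x u)" by (induction A rule: infinite_finite_induct) auto
qed

definition cst :: "real \<Rightarrow> dfun" where "cst c = (\<lambda>x u. c)"
definition cx :: dfun where "cx = (\<lambda>x u. x)"
definition cu :: "nat \<Rightarrow> dfun" where "cu k = (\<lambda>x u. u k)"

lemma cst_apply [simp]: "cst c x u = c"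
  and cx_apply [simp]: "cx x u = x"
  and cu_apply [simp]: "cu k x u = u k"
  by (simp_all add: cst_def cx_def cu_def)

lemma cst_simps: "cst (a + b) = cst a + cst b" "cst (a - b) = cst a - cst b" "cst (a * b) = cst a * cst b"
  "cst (- a) = - cst a" "cst 0 = 0" "cst 1 = 1" "cst (a ^ k) = cst a ^ k"
  by (auto simp: fun_eq_iff)

section \<open>Smoothness classes on an open set of jets\<close>

locale jet_domain =
  fixes U :: "jet set"
  assumes open_U: "open U"
begin

abbreviation sm :: "nat \<Rightarrow> dfun \<Rightarrow> bool" where "sm m P \<equiv> diff_function m U P"

definition sd :: "dfun \<Rightarrow> bool" where "sd P \<longleftrightarrow> (\<forall>r. dfun_of_class r U P)"

text \<open>The bound is \<open>Suc m\<close> because x occupies slot \<open>0\<close> and y^(m)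
  slot \<open>Suc m\<close>.\<close>

definition depends :: "nat \<Rightarrow> dfun \<Rightarrow> bool" where
  "depends m P \<longleftrightarrow> (\<forall>q\<in>U. \<forall>q'\<in>U. (\<forall>i\<le>Suc m. slot i q = slot i q') \<longrightarrow> case_prod P q = case_prod P q')"

lemma sm_iff: "sm m P \<longleftrightarrow> sd P \<and> depends m P"
proof -
  have "(\<forall>i\<le>Suc m. slot i (x, u) = slot i (x', u')) \<longleftrightarrow> x = x' \<and> (\<forall>k\<le>m. u k = u' k)" for x u x' u'
  proof
    assume *: "\<forall>i\<le>Suc m. slot i (x, u) = slot i (x', u')"
    then show "x = x' \<and> (\<forall>k\<le>m. u k = u' k)"
      using *[rule_format, of 0] *[rule_format, of "Suc k" for k] by simp
  next
    assume "x = x' \<and> (\<forall>k\<le>m. u k = u' k)"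
    then show "\<forall>i\<le>Suc m. slot i (x, u) = slot i (x', u')" by (auto simp: slot_def split: nat.splits)
  qed
  then have "depends m P \<longleftrightarrow> (\<forall>x u x' u'. (x, u) \<in> U \<longrightarrow> (x', u') \<in> U \<longrightarrow>
      x = x' \<and> (\<forall>k\<le>m. u k = u' k) \<longrightarrow> P x u = P x' u')"
    unfolding depends_def Ball_def split_paired_All split_conv by blast
  then show ?thesis unfolding diff_function_def sd_def by blast
qed

lemma slice_open: "open {t. put i t q \<in> U}"
proof -
  have "continuous_on UNIV (\<lambda>t. put i t q)" by (intro continuous_intros)
  then have "open ((\<lambda>t. put i t q) -` U)" by (rule open_vimage[OF open_U])
  then show ?thesis by (simp add: vimage_def)
qed

lemma eventually_slice: "q \<in> U \<Longrightarrow> eventually (\<lambda>t. put i t q \<in> U) (nhds (slot i q))"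
  using eventually_nhds_in_open[OF slice_open[of i q], of "slot i q"] by simp

text \<open>\<open>U\<close> is open, so its slice in one coordinate direction is open too, and a
  derivative only sees the slice near the point.\<close>

lemma pd_cong:
  assumes "\<And>q. q \<in> U \<Longrightarrow> case_prod P q = case_prod Q q" "q \<in> U"
  shows "case_prod (pd i P) q = case_prod (pd i Q) q"
  unfolding case_prod_pd using eventually_slice[OF assms(2), of i]
  by (intro deriv_cong_ev) (auto elim!: eventually_mono simp: assms(1))

definition cls :: "nat \<Rightarrow> dfun \<Rightarrow> bool" where "cls r P \<longleftrightarrow> dfun_of_class r U P"

lemma cls_0: "cls 0 P \<longleftrightarrow> continuous_on U (\<lambda>q. case_prod P q)"
  by (simp add: cls_def)

lemma cls_Suc:
  "cls (Suc r) P \<longleftrightarrow>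
    (\<forall>q\<in>U. \<forall>i. (\<lambda>t. case_prod P (put i t q)) differentiable at (slot i q)) \<and> cls 0 P \<and> (\<forall>i. cls r (pd i P))"
proof -
  have *: "(\<forall>i. Z i) \<longleftrightarrow> Z 0 \<and> (\<forall>k. Z (Suc k))" for Z by (metis not0_implies_Suc)
  show ?thesis
    by (subst (1 2) *) (auto simp: cls_def case_prod_unfold Ball_def)
qed

lemma cls_Suc_imp: "cls (Suc r) P \<Longrightarrow> cls r P"
proof (induction r arbitrary: P)
  case 0
  then show ?case by (simp add: cls_Suc)
next
  case (Suc r)
  then show ?case unfolding cls_Suc[of "Suc r"] cls_Suc[of r] by blast
qed

lemma differentiable_cong_slice:
  assumes "\<And>q. q \<in> U \<Longrightarrow> case_prod P q = case_prod Q q" "q \<in> U"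
  shows "(\<lambda>t. case_prod P (put i t q)) differentiable at (slot i q) \<longleftrightarrow>
    (\<lambda>t. case_prod Q (put i t q)) differentiable at (slot i q)"
  using frechet_derivative_cong_open(2)[OF slice_open[of i q], of "slot i q"
    "\<lambda>t. case_prod P (put i t q)" "\<lambda>t. case_prod Q (put i t q)"] assms by simp

lemma cls_cong:
  assumes "\<And>q. q \<in> U \<Longrightarrow> case_prod P q = case_prod Q q"
  shows "cls r P \<longleftrightarrow> cls r Q"
  using assms
proof (induction r arbitrary: P Q)
  case 0
  then show ?case unfolding cls_0 by (rule continuous_on_cong[OF refl])
next
  case (Suc r)
  have "cls r (pd i P) \<longleftrightarrow> cls r (pd i Q)" for i
    by (rule Suc.IH) (rule pd_cong[OF Suc.prems])
  moreover have "cls 0 P \<longleftrightarrow> cls 0 Q"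
    unfolding cls_0 using Suc.prems by (rule continuous_on_cong[OF refl])
  ultimately show ?case
    unfolding cls_Suc using differentiable_cong_slice[OF Suc.prems] by simp
qed

lemma sd_cls: "sd P \<longleftrightarrow> (\<forall>r. cls r P)"
  by (simp add: sd_def cls_def)

lemma sm_cong:
  assumes "\<And>x u. (x, u) \<in> U \<Longrightarrow> P x u = Q x u"
  shows "sm m P \<longleftrightarrow> sm m Q"
  using cls_cong[of P Q] assms unfolding diff_function_def cls_def by auto

lemma cls_has_deriv:
  assumes "cls (Suc r) P" "q \<in> U"
  shows "((\<lambda>t. case_prod P (put i t q)) has_field_derivative case_prod (pd i P) q) (at (slot i q))"
  using assms unfolding cls_Suc case_prod_pd
  by (simp add: DERIV_deriv_iff_real_differentiable)

lemma pd_eqI: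
  assumes "((\<lambda>t. case_prod P (put i t q)) has_field_derivative c) (at (slot i q))"
  shows "case_prod (pd i P) q = c"
  using DERIV_imp_deriv[OF assms] by (simp add: case_prod_pd)

text \<open>Explicit candidates \<open>P'\<close> may stand for the partial derivatives, since they
  agree with \<open>pd i P\<close> on \<open>U\<close>. Closure under the ring operations thus
  follows from one-variable derivative rules.\<close>

lemma cls_SucI:
  assumes d: "\<And>q i. q \<in> U \<Longrightarrow> ((\<lambda>t. case_prod P (put i t q)) has_field_derivative case_prod (P' i) q) (at (slot i q))"
    and "cls 0 P" "\<And>i. cls r (P' i)"
  shows "cls (Suc r) P"
proof -
  have "cls r (pd i P)" for i
    using cls_cong[of "pd i P" "P' i"] pd_eqI[OF d] assms(3) by blast
  moreover have "(\<lambda>t. case_prod P (put i t q)) differentiable at (slot i q)" if "q \<in> U" for q i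
    using d[OF that] real_differentiable_def by blast
  ultimately show ?thesis
    using assms(2) unfolding cls_Suc by blast
qed

lemma case_prod_ring:
  "case_prod (P + Q) q = case_prod P q + case_prod Q q" "case_prod (P * Q) q = case_prod P q * case_prod Q q"
  "case_prod (cst c) q = c" for P Q :: dfun
  by (simp_all add: case_prod_unfold)

lemma cls_cst: "cls r (cst c)"
proof (induction r arbitrary: c)
  case 0 show ?case by (simp add: cls_0 case_prod_ring)
next
  case (Suc r)
  have *: "cls 0 (cst c)" by (simp add: cls_0 case_prod_ring)
  show ?case by (rule cls_SucI[where P' = "\<lambda>i. cst 0", OF _ * Suc]) (simp add: case_prod_ring)
qed

lemma cls_add: "cls r P \<Longrightarrow> cls r Q \<Longrightarrow> cls r (P + Q)"
proof (induction r arbitrary: P Q)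
  case 0 then show ?case unfolding cls_0 case_prod_ring by (rule continuous_on_add)
next
  case (Suc r)
  have *: "cls 0 (P + Q)"
    using Suc.prems unfolding cls_Suc cls_0 case_prod_ring by (blast intro: continuous_on_add)
  show ?case
  proof (rule cls_SucI[OF _ *])
    show "((\<lambda>t. case_prod (P + Q) (put i t q)) has_field_derivative case_prod (pd i P + pd i Q) q) (at (slot i q))"
      if "q \<in> U" for q i
      unfolding case_prod_ring
      using DERIV_add[OF cls_has_deriv[OF Suc.prems(1) that] cls_has_deriv[OF Suc.prems(2) that]] .
    show "cls r (pd i P + pd i Q)" for i
      using Suc unfolding cls_Suc by blast
  qed
qed

lemma cls_mult: "cls r P \<Longrightarrow> cls r Q \<Longrightarrow> cls r (P * Q)"
proof (induction r arbitrary: P Q)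
  case 0 then show ?case unfolding cls_0 case_prod_ring by (rule continuous_on_mult)
next
  case (Suc r)
  have *: "cls 0 (P * Q)"
    using Suc.prems unfolding cls_Suc cls_0 case_prod_ring by (blast intro: continuous_on_mult)
  show ?case
  proof (rule cls_SucI[OF _ *])
    show "((\<lambda>t. case_prod (P * Q) (put i t q)) has_field_derivative case_prod (pd i P * Q + pd i Q * P) q) (at (slot i q))"
      if "q \<in> U" for q i
      unfolding case_prod_ring
      using DERIV_mult[OF cls_has_deriv[OF Suc.prems(1) that] cls_has_deriv[OF Suc.prems(2) that]] by simp
    have "cls r P" "cls r Q" using Suc.prems cls_Suc_imp by blast+
    then show "cls r (pd i P * Q + pd i Q * P)" for i
      using Suc.prems unfolding cls_Suc by (intro cls_add Suc.IH) blast+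
  qed
qed

lemma cls_inverse:
  assumes nz: "\<And>q. q \<in> U \<Longrightarrow> case_prod P q \<noteq> 0"
  shows "cls r P \<Longrightarrow> cls r (\<lambda>x u. inverse (P x u))"
proof (induction r)
  case 0 then show ?case using nz unfolding cls_0 case_prod_unfold
    by (intro continuous_on_inverse) auto
next
  case (Suc r)
  let ?Q = "\<lambda>x u. inverse (P x u)"
  have inv: "case_prod ?Q q = inverse (case_prod P q)" for q by (simp add: case_prod_unfold)
  have *: "cls 0 ?Q"
    using Suc.prems nz unfolding cls_Suc cls_0 inv by (blast intro: continuous_on_inverse)
  show ?case
  proof (rule cls_SucI[OF _ *])
    show "((\<lambda>t. case_prod ?Q (put i t q)) has_field_derivative case_prod (cst (- 1) * (?Q * pd i P * ?Q)) q) (at (slot i q))"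
      if "q \<in> U" for q i
      unfolding inv case_prod_ring
      using DERIV_inverse'[OF cls_has_deriv[OF Suc.prems that]] nz that by simp
    have "cls r ?Q" using Suc cls_Suc_imp by blast
    then show "cls r (cst (- 1) * (?Q * pd i P * ?Q))" for i
      using Suc.prems unfolding cls_Suc by (intro cls_mult cls_cst) blast+
  qed
qed

lemma cls_coordinate: "cls r (\<lambda>x u. slot i (x, u))"
proof -
  have c: "case_prod (\<lambda>x u. slot i (x, u)) q = slot i q" for q by (simp add: case_prod_unfold)
  have "continuous_on U (\<lambda>q. slot i q)"
  proof (cases i)
    case 0
    then show ?thesis by (simp add: slot_def continuous_on_fst)
  next
    case (Suc k)
    then show ?thesis
      using continuous_on_product_then_coordinatewise[OF continuous_on_snd[OF continuous_on_id], of U k]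
      by (simp add: slot_def)
  qed
  then have *: "cls 0 (\<lambda>x u. slot i (x, u))"
    by (simp only: cls_0 c)
  have "cls (Suc r) (\<lambda>x u. slot i (x, u))"
  proof (rule cls_SucI[OF _ *])
    show "((\<lambda>t. case_prod (\<lambda>x u. slot i (x, u)) (put j t q)) has_field_derivative
        case_prod (cst (if i = j then 1 else 0)) q) (at (slot j q))" for j q
      unfolding c case_prod_ring slot_put by auto
  qed (rule cls_cst)
  then show ?thesis by (rule cls_Suc_imp)
qed

lemma sd_add: "sd P \<Longrightarrow> sd Q \<Longrightarrow> sd (P + Q)" by (simp add: sd_cls cls_add)
lemma sd_mult: "sd P \<Longrightarrow> sd Q \<Longrightarrow> sd (P * Q)" by (simp add: sd_cls cls_mult)
lemma sd_cst: "sd (cst c)" by (simp add: sd_cls cls_cst)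

lemma sd_has_deriv:
  assumes "sd P" "put i t q \<in> U"
  shows "((\<lambda>t. case_prod P (put i t q)) has_field_derivative case_prod (pd i P) (put i t q)) (at t)"
  using cls_has_deriv[of _ P "put i t q" i] assms by (simp add: sd_cls)

lemma sd_pd: "sd P \<Longrightarrow> sd (pd i P)"
  unfolding sd_cls using cls_Suc by blast

lemma sd_continuous: "sd P \<Longrightarrow> continuous_on U (\<lambda>q. case_prod P q)"
  unfolding sd_cls using cls_0 by blast

lemma depends_mono: "depends m P \<Longrightarrow> m \<le> m' \<Longrightarrow> depends m' P"
  unfolding depends_def by (meson le_trans not_less_eq_eq Suc_le_mono)

lemma sm_mono: "sm m P \<Longrightarrow> m \<le> m' \<Longrightarrow> sm m' P"
  unfolding sm_iff using depends_mono by blast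

lemma sm_add: "sm m P \<Longrightarrow> sm m Q \<Longrightarrow> sm m (P + Q)"
  unfolding sm_iff depends_def case_prod_ring by (metis sd_add)

lemma sm_mult: "sm m P \<Longrightarrow> sm m Q \<Longrightarrow> sm m (P * Q)"
  unfolding sm_iff depends_def case_prod_ring by (metis sd_mult)

lemma sm_cst: "sm m (cst c)"
  unfolding sm_iff depends_def case_prod_ring by (simp add: sd_cst)

lemma sm_uminus: "sm m P \<Longrightarrow> sm m (- P)"
proof -
  assume "sm m P"
  moreover have "- P = cst (- 1) * P" by (simp add: fun_eq_iff)
  ultimately show ?thesis by (simp add: sm_mult sm_cst)
qed

lemma sm_diff: "sm m P \<Longrightarrow> sm m Q \<Longrightarrow> sm m (P - Q)"
  using sm_add[of m P "- Q"] sm_uminus[of m Q] by simp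

lemma sm_0: "sm m 0" and sm_1: "sm m 1"
  using sm_cst[of m 0] sm_cst[of m 1] by (simp_all add: cst_simps)

lemma sm_sum: "(\<And>i. i \<in> A \<Longrightarrow> sm m (P i)) \<Longrightarrow> sm m (\<Sum>i\<in>A. P i)"
  by (induction A rule: infinite_finite_induct) (auto intro: sm_add sm_0)

lemma sm_power: "sm m P \<Longrightarrow> sm m (P ^ k)"
  by (induction k) (auto intro: sm_mult sm_1)

lemma sm_inverse:
  assumes "sm m P" "\<And>x u. (x, u) \<in> U \<Longrightarrow> P x u \<noteq> 0"
  shows "sm m (\<lambda>x u. inverse (P x u))"
proof -
  have "sd (\<lambda>x u. inverse (P x u))"
    using assms cls_inverse[of P] unfolding sm_iff sd_cls by auto
  moreover have "depends m (\<lambda>x u. inverse (P x u))"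
    using assms(1) unfolding sm_iff depends_def case_prod_unfold by metis
  ultimately show ?thesis by (simp add: sm_iff)
qed

lemma sm_cx: "sm m cx"
proof -
  have "sd (\<lambda>x u. slot 0 (x, u))" unfolding sd_cls by (blast intro: cls_coordinate)
  then have "sd cx" by (simp add: cx_def)
  moreover have "depends m cx"
    unfolding depends_def case_prod_unfold by (metis slot_simps(1) cx_apply prod.collapse zero_le)
  ultimately show ?thesis by (simp add: sm_iff)
qed

lemma sm_cu: "k \<le> m \<Longrightarrow> sm m (cu k)"
proof -
  assume k: "k \<le> m"
  have "sd (\<lambda>x u. slot (Suc k) (x, u))" unfolding sd_cls by (blast intro: cls_coordinate)
  then have "sd (cu k)" by (simp add: cu_def)
  moreover have "depends m (cu k)"
    unfolding depends_def case_prod_unfold using k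
    by (metis slot_simps(2) cu_apply prod.collapse Suc_le_mono)
  ultimately show ?thesis by (simp add: sm_iff)
qed

section \<open>Order of the partial derivatives, and their commutation\<close>

lemma dependsD:
  "depends m P \<Longrightarrow> q \<in> U \<Longrightarrow> q' \<in> U \<Longrightarrow> (\<And>i. i \<le> Suc m \<Longrightarrow> slot i q = slot i q') \<Longrightarrow>
    case_prod P q = case_prod P q'"
  unfolding depends_def by blast

text \<open>The modified jets need not stay in \<open>U\<close>; the two slices are therefore
  compared only near the common slot value, where both do.\<close>

lemma pd_agree:
  assumes P: "depends m P" and q: "q \<in> U" "q' \<in> U" "\<And>j. j \<le> Suc m \<Longrightarrow> slot j q = slot j q'"
    and i: "slot i q = slot i q'"
  shows "case_prod (pd i P) q = case_prod (pd i P) q'"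
proof -
  have "case_prod P (put i t q) = case_prod P (put i t q')" if "put i t q \<in> U" "put i t q' \<in> U" for t
    using q(3) that by (intro dependsD[OF P]) (simp_all add: slot_put)
  then have "\<forall>\<^sub>F t in nhds (slot i q'). case_prod P (put i t q) = case_prod P (put i t q')"
    using eventually_slice[OF q(1), of i] eventually_slice[OF q(2), of i] unfolding i
    by (auto elim: eventually_elim2)
  then show ?thesis
    unfolding case_prod_pd i by (rule deriv_cong_ev) (rule refl)
qed

lemma pd_beyond:
  assumes P: "depends m P" and q: "q \<in> U" and i: "i > Suc m"
  shows "case_prod (pd i P) q = 0"
proof -
  have "case_prod (pd i P) q = deriv (\<lambda>t. case_prod P q) (slot i q)"
  proof -
    have "case_prod P (put i t q) = case_prod P q" if "put i t q \<in> U" for t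
      using i q that by (intro dependsD[OF P]) (simp_all add: slot_put)
    then have "\<forall>\<^sub>F t in nhds (slot i q). case_prod P (put i t q) = case_prod P q"
      using eventually_slice[OF q, of i] by (auto elim: eventually_mono)
    then show ?thesis
      unfolding case_prod_pd by (rule deriv_cong_ev) (rule refl)
  qed
  then show ?thesis by simp
qed

lemma sm_pd: "sm m P \<Longrightarrow> sm m (pd i P)"
proof -
  assume P: "sm m P"
  have "depends m (pd i P)"
    unfolding depends_def
  proof (intro ballI impI)
    fix q q' assume q: "q \<in> U" "q' \<in> U" "\<forall>i\<le>Suc m. slot i q = slot i q'"
    show "case_prod (pd i P) q = case_prod (pd i P) q'"
    proof (cases "i \<le> Suc m")
      case True
      then show ?thesis using pd_agree[of m P q q' i] P q by (simp add: sm_iff)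
    next
      case False
      then show ?thesis using pd_beyond[of m P _ i] P q by (simp add: sm_iff)
    qed
  qed
  with P show ?thesis by (simp add: sm_iff sd_pd)
qed

text \<open>Varying only the slots \<open>i\<close> and \<open>j\<close> gives a function on an open
  subset of the plane, to which the theorem on mixed partial derivatives applies.\<close>

lemma pd_commute:
  assumes P: "sd P" and q: "q \<in> U"
  shows "case_prod (pd i (pd j P)) q = case_prod (pd j (pd i P)) q"
proof (cases "i = j")
  case False
  define c where "c = (\<lambda>(s, t). put i s (put j t q))"
  define A where "A = c -` U"
  have cont: "continuous_on S c" for S
    unfolding c_def case_prod_unfold by (intro continuous_intros)
  have A: "open A" unfolding A_def by (rule open_vimage[OF open_U cont])
  have c': "c (s, t) = put j t (put i s q)" for s t
    using put_commute[OF False] by (simp add: c_def)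
  have contP: "continuous_on A (\<lambda>(s, t). case_prod Q (c (s, t)))" if "sd Q" for Q
    using continuous_on_compose2[OF sd_continuous[OF that] cont, of A]
    by (auto simp: A_def case_prod_unfold)
  have di: "((\<lambda>s. case_prod Q (c (s, t))) has_field_derivative case_prod (pd i Q) (c (s, t))) (at s)"
    if "sd Q" "(s, t) \<in> A" for Q s t
    using sd_has_deriv[OF that(1), of i s "put j t q"] that(2) by (simp add: A_def c_def)
  have dj: "((\<lambda>t. case_prod Q (c (s, t))) has_field_derivative case_prod (pd j Q) (c (s, t))) (at t)"
    if "sd Q" "(s, t) \<in> A" for Q s t
    using sd_has_deriv[OF that(1), of j t "put i s q"] that(2) by (simp add: A_def c')
  have c0: "c (slot i q, slot j q) = q" by (simp add: c_def)
  have "(slot i q, slot j q) \<in> A" using c0 q by (simp add: A_def)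
  then have "case_prod (pd j (pd i P)) (c (slot i q, slot j q)) = case_prod (pd i (pd j P)) (c (slot i q, slot j q))"
    using mixed_partials_eq[OF A, of "slot i q" "slot j q" "\<lambda>s t. case_prod P (c (s, t))"
        "\<lambda>s t. case_prod (pd i P) (c (s, t))" "\<lambda>s t. case_prod (pd j P) (c (s, t))"
        "\<lambda>s t. case_prod (pd j (pd i P)) (c (s, t))" "\<lambda>s t. case_prod (pd i (pd j P)) (c (s, t))"]
      di dj contP sd_pd P by blast
  then show ?thesis by (simp add: c0)
qed simp

text \<open>Functions are truncated to zero outside \<open>U\<close>, so that identities on \<open>U\<close> become
  identities in the ring of all functions.\<close>

definition trunc :: "dfun \<Rightarrow> dfun" where "trunc P = (\<lambda>x u. if (x, u) \<in> U then P x u else 0)"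

text \<open>This element is the unit for truncated functions: a truncated function times its
  truncated inverse is \<open>un\<close>, not \<open>1\<close>.\<close>

definition un :: dfun where "un = trunc 1"

definition dT :: "nat \<Rightarrow> dfun \<Rightarrow> dfun" where "dT i P = trunc (pd i P)"

definition dD :: "dfun \<Rightarrow> dfun" where "dD P = trunc (Dx P)"

abbreviation du :: "nat \<Rightarrow> dfun \<Rightarrow> dfun" where "du k P \<equiv> dT (Suc k) P"

lemma trunc_eq_iff: "trunc P = trunc Q \<longleftrightarrow> (\<forall>x u. (x, u) \<in> U \<longrightarrow> P x u = Q x u)"
  by (auto simp: trunc_def fun_eq_iff)

lemma trunc_at: "(x, u) \<in> U \<Longrightarrow> trunc P x u = P x u"
  by (simp add: trunc_def)

lemma trunc_trunc [simp]: "trunc (trunc P) = trunc P"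
  by (simp add: trunc_def fun_eq_iff)

lemma trunc_un: "trunc P = un * P"
  by (simp add: trunc_def un_def fun_eq_iff)

lemma un_un [simp]: "un * un = un" "un * (un * P) = un * P"
  by (simp_all add: trunc_def un_def fun_eq_iff)

lemma un_at: "(x, u) \<in> U \<Longrightarrow> un x u = 1"
  by (simp add: trunc_def un_def)

lemma sm_trunc [simp]: "sm m (trunc P) \<longleftrightarrow> sm m P"
  by (rule sm_cong) (simp add: trunc_at)

lemma sm_un: "sm m un"
  by (simp add: un_def sm_1)

lemma un_dT [simp]: "un * dT i P = dT i P" "dT i P * un = dT i P"
  by (simp_all add: dT_def trunc_un[symmetric] mult.commute[of _ un])

lemma un_dD [simp]: "un * dD P = dD P" "dD P * un = dD P"
  by (simp_all add: dD_def trunc_un[symmetric] mult.commute[of _ un])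

lemma dT_at: "(x, u) \<in> U \<Longrightarrow> dT i P x u = pd i P x u"
  by (simp add: dT_def trunc_at)

lemma dD_at: "(x, u) \<in> U \<Longrightarrow> dD P x u = Dx P x u"
  by (simp add: dD_def trunc_at)

lemma dT_cong: "trunc P = trunc Q \<Longrightarrow> dT i P = dT i Q"
  using pd_cong[of P Q _ i] unfolding dT_def trunc_eq_iff by (metis case_prod_conv surj_pair)

lemma dT_trunc [simp]: "dT i (trunc P) = dT i P"
  by (rule dT_cong) simp

lemma dD_cong: "trunc P = trunc Q \<Longrightarrow> dD P = dD Q"
proof -
  assume *: "trunc P = trunc Q"
  have "pd i P x u = pd i Q x u" if "(x, u) \<in> U" for i x u
    using dT_cong[OF *, of i] that by (simp add: dT_def trunc_eq_iff)
  from this[of _ _ 0] this[of _ _ "Suc k" for k] show ?thesis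
    by (simp add: dD_def trunc_eq_iff Dx_def)
qed

lemma dD_trunc [simp]: "dD (trunc P) = dD P"
  by (rule dD_cong) simp

lemma dT_eqI:
  assumes "\<And>q. q \<in> U \<Longrightarrow> ((\<lambda>t. case_prod P (put i t q)) has_field_derivative case_prod Q q) (at (slot i q))"
  shows "dT i P = trunc Q"
  unfolding dT_def trunc_eq_iff
proof (intro allI impI)
  fix x u assume "(x, u) \<in> U"
  then show "pd i P x u = Q x u"
    using pd_eqI[OF assms[of "(x, u)"]] by simp
qed

lemma sd_deriv_slot:
  assumes "sd P" "q \<in> U"
  shows "((\<lambda>t. case_prod P (put i t q)) has_field_derivative case_prod (pd i P) q) (at (slot i q))"
  using sd_has_deriv[of P i "slot i q" q] assms by simp

lemma dT_add: "sd P \<Longrightarrow> sd Q \<Longrightarrow> dT i (P + Q) = dT i P + dT i Q"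
proof -
  assume "sd P" "sd Q"
  then have "dT i (P + Q) = trunc (pd i P + pd i Q)"
    by (intro dT_eqI) (unfold case_prod_ring, intro DERIV_add sd_deriv_slot)
  then show ?thesis by (simp add: dT_def trunc_un distrib_left)
qed

lemma dT_mult: "sd P \<Longrightarrow> sd Q \<Longrightarrow> dT i (P * Q) = dT i P * Q + P * dT i Q"
proof -
  assume P: "sd P" "sd Q"
  have "dT i (P * Q) = trunc (pd i P * Q + pd i Q * P)"
  proof (rule dT_eqI)
    fix q assume q: "q \<in> U"
    show "((\<lambda>t. case_prod (P * Q) (put i t q)) has_field_derivative case_prod (pd i P * Q + pd i Q * P) q) (at (slot i q))"
      unfolding case_prod_ring
      using DERIV_mult[OF sd_deriv_slot[OF P(1) q, of i] sd_deriv_slot[OF P(2) q, of i]] by simp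
  qed
  then show ?thesis by (simp add: dT_def trunc_un algebra_simps)
qed

lemma dT_cst [simp]: "dT i (cst c) = 0"
proof -
  have "dT i (cst c) = trunc 0"
    by (rule dT_eqI) (simp add: case_prod_unfold)
  then show ?thesis by (simp add: trunc_def fun_eq_iff)
qed

lemma dT_coordinate: "dT i (\<lambda>x u. slot j (x, u)) = (if i = j then un else 0)"
proof -
  have "dT i (\<lambda>x u. slot j (x, u)) = trunc (cst (if i = j then 1 else 0))"
    by (rule dT_eqI) (auto simp: case_prod_unfold slot_put)
  then show ?thesis by (auto simp: trunc_def un_def fun_eq_iff)
qed

lemma dT_cx: "dT 0 cx = un" "du k cx = 0"
  using dT_coordinate[of 0 0] dT_coordinate[of "Suc k" 0] by (simp_all add: cx_def)

lemma dT_cu: "dT 0 (cu k) = 0" "du j (cu k) = (if j = k then un else 0)"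
  using dT_coordinate[of 0 "Suc k"] dT_coordinate[of "Suc j" "Suc k"] by (simp_all add: cu_def)

lemma dT_commute: "sd P \<Longrightarrow> dT i (dT j P) = dT j (dT i P)"
proof -
  assume P: "sd P"
  have "dT i (pd j P) = dT j (pd i P)"
    unfolding dT_def trunc_eq_iff using pd_commute[OF P, of "(x, u)" i j for x u] by simp
  then show ?thesis by (simp add: dT_def[of j P] dT_def[of i P])
qed

lemma sm_dT: "sm m P \<Longrightarrow> sm m (dT i P)"
  unfolding dT_def by (simp add: sm_pd)

lemma dT_beyond: "sm m P \<Longrightarrow> m < k \<Longrightarrow> du k P = 0"
  unfolding dT_def using pd_beyond[of m P "(x, u)" "Suc k" for x u]
  by (simp add: sm_iff trunc_def fun_eq_iff)

text \<open>Beyond the order of \<open>P\<close> all partial derivatives vanish on \<open>U\<close>,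
  which makes the series in \<open>Dx\<close> a finite sum.\<close>

lemma dD_eq:
  assumes "sm m P"
  shows "dD P = dT 0 P + (\<Sum>k\<le>m. cu (Suc k) * du k P)"
proof -
  have "Dx P x u = pd_x P x u + (\<Sum>k\<le>m. u (Suc k) * pd_u k P x u)" if "(x, u) \<in> U" for x u
    unfolding Dx_def
    using suminf_finite[of "{..m}" "\<lambda>k. u (Suc k) * pd_u k P x u"]
      pd_beyond[of m P "(x, u)" "Suc k" for k] that assms by (simp add: sm_iff not_le)
  then have "dD P = trunc (pd_x P + (\<Sum>k\<le>m. cu (Suc k) * pd_u k P))"
    unfolding dD_def trunc_eq_iff by simp
  then show ?thesis
    by (simp add: dT_def trunc_un distrib_left sum_distrib_left mult.left_commute)
qed

lemma sm_sd: "sm m P \<Longrightarrow> sd P" by (simp add: sm_iff)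

lemma sm_dD: "sm m P \<Longrightarrow> sm (Suc m) (dD P)"
  unfolding dD_eq by (intro sm_add sm_sum sm_mult sm_cu sm_dT)
    (auto elim: sm_mono)

text \<open>The union over all orders is closed under \<open>dD\<close>, although \<open>dD\<close>
  raises the order; no bound has to be carried along.\<close>

definition SS :: "dfun set" where "SS = {P. \<exists>m. sm m P}"

lemma SS_I: "sm m P \<Longrightarrow> P \<in> SS" by (auto simp: SS_def)

lemma SS_obtain2:
  assumes "P \<in> SS" "Q \<in> SS"
  obtains m where "sm m P" "sm m Q"
proof -
  obtain a b where "sm a P" "sm b Q" using assms by (auto simp: SS_def)
  then have "sm (max a b) P" "sm (max a b) Q" by (auto elim: sm_mono)
  then show ?thesis by (rule that)
qed

lemma SS_sd: "P \<in> SS \<Longrightarrow> sd P" by (auto simp: SS_def sm_sd)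

lemma SS_add [intro]: "P \<in> SS \<Longrightarrow> Q \<in> SS \<Longrightarrow> P + Q \<in> SS" by (meson SS_obtain2 SS_I sm_add)
lemma SS_mult [intro]: "P \<in> SS \<Longrightarrow> Q \<in> SS \<Longrightarrow> P * Q \<in> SS" by (meson SS_obtain2 SS_I sm_mult)
lemma SS_diff [intro]: "P \<in> SS \<Longrightarrow> Q \<in> SS \<Longrightarrow> P - Q \<in> SS" by (meson SS_obtain2 SS_I sm_diff)
lemma SS_uminus [intro]: "P \<in> SS \<Longrightarrow> - P \<in> SS" by (auto simp: SS_def intro: sm_uminus)
lemma SS_cst [simp, intro]: "cst c \<in> SS" using SS_I sm_cst by blast
lemma SS_0 [simp, intro]: "0 \<in> SS" using SS_I sm_0 by blast
lemma SS_1 [simp, intro]: "1 \<in> SS" using SS_I sm_1 by blast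
lemma SS_un [simp, intro]: "un \<in> SS" using SS_I sm_un by blast
lemma SS_cx [simp, intro]: "cx \<in> SS" using SS_I sm_cx by blast
lemma SS_cu [simp, intro]: "cu k \<in> SS" using SS_I sm_cu by blast
lemma SS_power [intro]: "P \<in> SS \<Longrightarrow> P ^ k \<in> SS" by (auto simp: SS_def intro: sm_power)
lemma SS_sum [intro]: "(\<And>i. i \<in> A \<Longrightarrow> P i \<in> SS) \<Longrightarrow> (\<Sum>i\<in>A. P i) \<in> SS"
  by (induction A rule: infinite_finite_induct) (auto intro: SS_add)
lemma SS_dT [intro]: "P \<in> SS \<Longrightarrow> dT i P \<in> SS" by (auto simp: SS_def intro: sm_dT)
lemma SS_dD [intro]: "P \<in> SS \<Longrightarrow> dD P \<in> SS" by (auto simp: SS_def intro: sm_dD)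
lemma SS_trunc [simp]: "trunc P \<in> SS \<longleftrightarrow> P \<in> SS" by (simp add: SS_def)
lemma SS_dD_funpow [intro]: "P \<in> SS \<Longrightarrow> (dD ^^ k) P \<in> SS" by (induction k) auto
lemma SS_inverse: "P \<in> SS \<Longrightarrow> (\<And>x u. (x, u) \<in> U \<Longrightarrow> P x u \<noteq> 0) \<Longrightarrow> (\<lambda>x u. inverse (P x u)) \<in> SS"
  by (auto simp: SS_def intro: sm_inverse)

lemma dD_add: "P \<in> SS \<Longrightarrow> Q \<in> SS \<Longrightarrow> dD (P + Q) = dD P + dD Q"
  by (erule (1) SS_obtain2) (simp add: dD_eq[OF sm_add] dD_eq dT_add sm_sd algebra_simps sum.distrib)

lemma dD_mult: "P \<in> SS \<Longrightarrow> Q \<in> SS \<Longrightarrow> dD (P * Q) = dD P * Q + P * dD Q"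
  by (erule (1) SS_obtain2)
    (simp add: dD_eq[OF sm_mult] dD_eq dT_mult sm_sd algebra_simps sum.distrib sum_distrib_left)

lemma dD_cst [simp]: "dD (cst c) = 0"
  by (simp add: dD_eq[OF sm_cst[of 0]])

lemma dD_0 [simp]: "dD 0 = 0"
  using dD_cst[of 0] by (simp add: cst_simps)

lemma dD_un [simp]: "dD un = 0"
  using dD_cst[of 1] by (simp add: un_def cst_simps)

end

text \<open>As simplification rules these would expand ring elements to abstractions.\<close>

declare zero_fun_apply [simp del] plus_fun_apply [simp del] times_fun_apply [simp del] one_fun_apply [simp del]
  numeral_fun_apply [simp del] of_nat_fun_apply [simp del] minus_apply [simp del] uminus_apply [simp del]
  fun2_apply [simp del] cst_apply [simp del] cx_apply [simp del] cu_apply [simp del]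

lemmas ev = zero_fun_apply plus_fun_apply times_fun_apply one_fun_apply numeral_fun_apply of_nat_fun_apply
  minus_apply uminus_apply fun2_apply cst_apply cx_apply cu_apply

context jet_domain begin

lemmas SSI = SS_add SS_mult SS_diff SS_uminus SS_cst SS_0 SS_1 SS_un SS_cx SS_cu SS_power SS_sum
  SS_dT SS_dD SS_dD_funpow

lemma un_cancel: "un * P = un * Q \<Longrightarrow> (x, u) \<in> U \<Longrightarrow> P x u = Q x u"
  unfolding trunc_un[symmetric] trunc_eq_iff by blast

lemma dT_0 [simp]: "dT i 0 = 0"
  using dT_cst[of i 0] by (simp add: cst_simps)

lemma dT_un [simp]: "dT i un = 0"
  using dT_cst[of i 1] by (simp add: un_def cst_simps)

lemma dT_sum: "(\<And>k. k \<in> A \<Longrightarrow> P k \<in> SS) \<Longrightarrow> dT i (\<Sum>k\<in>A. P k) = (\<Sum>k\<in>A. dT i (P k))"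
  by (induction A rule: infinite_finite_induct) (simp_all add: dT_add SS_sd SS_sum)

lemma dD_sum: "(\<And>k. k \<in> A \<Longrightarrow> P k \<in> SS) \<Longrightarrow> dD (\<Sum>k\<in>A. P k) = (\<Sum>k\<in>A. dD (P k))"
  by (induction A rule: infinite_finite_induct) (simp_all add: dD_add SS_sum)

lemma dD_cst_mult: "P \<in> SS \<Longrightarrow> dD (cst c * P) = cst c * dD P"
  by (simp add: dD_mult)

lemma dD_uminus: "P \<in> SS \<Longrightarrow> dD (- P) = - dD P"
proof -
  assume "P \<in> SS"
  moreover have "- Q = cst (- 1) * Q" for Q by (simp add: fun_eq_iff ev)
  ultimately show ?thesis by (simp add: dD_cst_mult)
qed

lemma dD_diff: "P \<in> SS \<Longrightarrow> Q \<in> SS \<Longrightarrow> dD (P - Q) = dD P - dD Q"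
  using dD_add[of P "- Q"] dD_uminus[of Q] SS_uminus[of Q] by simp

text \<open>The commutator of the derivative by y^(k) with D_x comes from the coefficient y^(k) that
  D_x gives to the derivative by y^(k-1).\<close>

lemma du_dD:
  assumes "P \<in> SS"
  shows "du k (dD P) = dD (du k P) + (case k of 0 \<Rightarrow> 0 | Suc j \<Rightarrow> du j P)"
proof -
  obtain m where m: "sm m P" using assms by (auto simp: SS_def)
  have s: "sd (dT 0 P)" "sd (\<Sum>j\<le>m. cu (Suc j) * du j P)" "\<And>j. sd (cu j)" "\<And>j. sd (du j P)"
    using assms by (auto intro!: SS_sd SSI)
  have "du k (dD P) = dT 0 (du k P) + (\<Sum>j\<le>m. du k (cu (Suc j) * du j P))"
    unfolding dD_eq[OF m] dT_add[OF s(1,2)] dT_commute[OF sm_sd[OF m], of "Suc k" 0]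
    using assms by (subst dT_sum) (auto intro!: SSI)
  also have "(\<Sum>j\<le>m. du k (cu (Suc j) * du j P)) =
      (\<Sum>j\<le>m. (if k = Suc j then du j P else 0)) + (\<Sum>j\<le>m. cu (Suc j) * du j (du k P))"
    unfolding sum.distrib[symmetric]
  proof (rule sum.cong[OF refl])
    fix j
    show "du k (cu (Suc j) * du j P) = (if k = Suc j then du j P else 0) + cu (Suc j) * du j (du k P)"
      by (simp add: dT_mult s dT_cu dT_commute[OF sm_sd[OF m], of "Suc k" "Suc j"])
  qed
  \<comment> \<open>If \<open>k - 1\<close> exceeds \<open>m\<close>, both sides vanish because
    \<open>m\<close> bounds the order of \<open>P\<close>.\<close>
  also have "(\<Sum>j\<le>m. (if k = Suc j then du j P else 0)) = (case k of 0 \<Rightarrow> 0 | Suc j \<Rightarrow> du j P)"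
    using dT_beyond[OF m] by (cases k) (auto simp: not_le)
  finally show ?thesis
    by (simp add: dD_eq[OF sm_dT[OF m]] algebra_simps)
qed

section \<open>Evolutionary derivations and the Euler operator\<close>

text \<open>The evolutionary derivation with characteristic \<open>R\<close>. Summation over the
  support, which is finite for functions of finite order, keeps the order of \<open>P\<close> out of
  the definition.\<close>

definition pr :: "dfun \<Rightarrow> dfun \<Rightarrow> dfun"
  where "pr R P = (\<Sum>k\<in>{k. du k P \<noteq> 0}. (dD ^^ k) R * du k P)"

lemma pr_eq: "sm m P \<Longrightarrow> pr R P = (\<Sum>k\<le>m. (dD ^^ k) R * du k P)"
  unfolding pr_def
  by (rule sum.mono_neutral_left) (auto dest: dT_beyond simp: not_le[symmetric])

lemma SS_pr [intro]: "R \<in> SS \<Longrightarrow> P \<in> SS \<Longrightarrow> pr R P \<in> SS"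
  unfolding pr_def by (intro SSI)

lemma pr_add: "P \<in> SS \<Longrightarrow> Q \<in> SS \<Longrightarrow> pr R (P + Q) = pr R P + pr R Q"
  by (erule (1) SS_obtain2) (simp add: pr_eq[OF sm_add] pr_eq dT_add sm_sd algebra_simps sum.distrib)

lemma pr_mult: "P \<in> SS \<Longrightarrow> Q \<in> SS \<Longrightarrow> pr R (P * Q) = pr R P * Q + P * pr R Q"
  by (erule (1) SS_obtain2)
    (simp add: pr_eq[OF sm_mult] pr_eq dT_mult sm_sd algebra_simps sum.distrib sum_distrib_left)

text \<open>After an index shift, the commutator terms of \<open>du_dD\<close> are the part of the
  product rule in which D_x falls on the derivatives of \<open>R\<close>.\<close>

lemma pr_dD:
  assumes R: "R \<in> SS" and P: "P \<in> SS"
  shows "pr R (dD P) = dD (pr R P)"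
proof -
  obtain m where m: "sm m P" using P by (auto simp: SS_def)
  have "pr R (dD P) = (\<Sum>k\<le>Suc m. (dD ^^ k) R * dD (du k P)) +
      (\<Sum>k\<le>Suc m. (dD ^^ k) R * (case k of 0 \<Rightarrow> 0 | Suc j \<Rightarrow> du j P))"
    by (simp only: pr_eq[OF sm_dD[OF m]] du_dD[OF P] distrib_left sum.distrib)
  also have "(\<Sum>k\<le>Suc m. (dD ^^ k) R * dD (du k P)) = (\<Sum>k\<le>m. (dD ^^ k) R * dD (du k P))"
    using dT_beyond[OF m, of "Suc m"] by simp
  also have "(\<Sum>k\<le>Suc m. (dD ^^ k) R * (case k of 0 \<Rightarrow> 0 | Suc j \<Rightarrow> du j P)) = (\<Sum>k\<le>m. (dD ^^ Suc k) R * du k P)"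
    by (subst sum.atMost_Suc_shift) simp
  also have "(\<Sum>k\<le>m. (dD ^^ k) R * dD (du k P)) + (\<Sum>k\<le>m. (dD ^^ Suc k) R * du k P)
      = (\<Sum>k\<le>m. dD ((dD ^^ k) R * du k P))"
    unfolding sum.distrib[symmetric] using R P
    by (intro sum.cong refl) (subst dD_mult, auto intro!: SSI)
  also have "\<dots> = dD (pr R P)"
    unfolding pr_eq[OF m] using R P by (subst dD_sum) (auto intro!: SSI)
  finally show ?thesis .
qed

lemma trunc_dD [simp]: "trunc (dD P) = dD P"
  by (simp add: dD_def)

lemma trunc_Dx_funpow: "trunc P = trunc Q \<Longrightarrow> trunc ((Dx ^^ k) P) = trunc ((dD ^^ k) Q)"
proof (induction k)
  case (Suc k)
  then have "dD ((Dx ^^ k) P) = dD ((dD ^^ k) Q)" by (intro dD_cong) simp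
  then show ?case by (simp add: dD_def[of "(Dx ^^ k) P"])
qed simp

lemma Dx_funpow_at:
  assumes "trunc P = trunc Q" "(x, u) \<in> U"
  shows "(Dx ^^ k) P x u = (dD ^^ k) Q x u"
  using trunc_Dx_funpow[OF assms(1), of k] assms(2) by (simp add: trunc_eq_iff)

lemma dD_funpow_0 [simp]: "(dD ^^ k) 0 = 0"
  by (induction k) simp_all

lemma dD_funpow_add: "P \<in> SS \<Longrightarrow> Q \<in> SS \<Longrightarrow> (dD ^^ k) (P + Q) = (dD ^^ k) P + (dD ^^ k) Q"
  by (induction k) (simp_all add: dD_add SSI)

section \<open>Euler operator, formal adjoints and integration by parts\<close>

definition eul :: "dfun \<Rightarrow> dfun" where "eul P = trunc (euler P)"

lemma adjoint_eq:
  assumes "sm m P"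
  shows "trunc (frechet_adjoint P R) = (\<Sum>k\<le>m. (- 1) ^ k * (dD ^^ k) (du k P * trunc R))"
proof -
  have *: "trunc (\<lambda>x u. pd_u k P x u * R x u) = trunc (du k P * trunc R)" for k
    by (simp add: trunc_eq_iff dT_at trunc_at ev)
  have "frechet_adjoint P R x u = (\<Sum>k\<le>m. (- 1) ^ k * (dD ^^ k) (du k P * trunc R) x u)" if "(x, u) \<in> U" for x u
  proof -
    have "(\<Sum>k. (- 1) ^ k * (dD ^^ k) (du k P * trunc R) x u) =
        (\<Sum>k\<le>m. (- 1) ^ k * (dD ^^ k) (du k P * trunc R) x u)"
      using dT_beyond[OF assms] by (intro suminf_finite) (auto simp: not_le ev)
    then show ?thesis
      unfolding frechet_adjoint_def Dx_funpow_at[OF * that] .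
  qed
  moreover have "trunc (\<Sum>k\<le>m. (- 1) ^ k * (dD ^^ k) (du k P * trunc R)) = (\<Sum>k\<le>m. (- 1) ^ k * (dD ^^ k) (du k P * trunc R))"
  proof -
    have "un * (dD ^^ k) (du k P * trunc R) = (dD ^^ k) (du k P * trunc R)" for k
      by (cases k) (simp_all add: mult.assoc[symmetric])
    then have "un * ((- 1) ^ k * (dD ^^ k) (du k P * trunc R)) = (- 1) ^ k * (dD ^^ k) (du k P * trunc R)" for k
      by (simp only: mult.left_commute[of un])
    then show ?thesis by (simp only: trunc_un[of "\<Sum>k\<le>m. _ k"] sum_distrib_left)
  qed
  ultimately show ?thesis
    using trunc_eq_iff[of "frechet_adjoint P R" "\<Sum>k\<le>m. (- 1) ^ k * (dD ^^ k) (du k P * trunc R)"]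
    by (simp add: ev)
qed

lemma eul_eq:
  assumes "sm m P"
  shows "eul P = (\<Sum>k\<le>m. (- 1) ^ k * (dD ^^ k) (du k P))"
proof -
  have "euler P = frechet_adjoint P 1"
    by (simp add: euler_def frechet_adjoint_def ev)
  then have "eul P = (\<Sum>k\<le>m. (- 1) ^ k * (dD ^^ k) (du k P * trunc 1))"
    unfolding eul_def using adjoint_eq[OF assms, of 1] by (simp only:)
  then show ?thesis by (simp add: un_def[symmetric])
qed

text \<open>The product rule for each \<open>du k\<close> splits the Euler sum into two adjoints.
  This identifies the divergence condition with an Euler expression.\<close>

lemma eul_mult:
  assumes "P \<in> SS" "Q \<in> SS"
  shows "eul (P * Q) = trunc (frechet_adjoint P Q) + trunc (frechet_adjoint Q P)"
proof -
  obtain m where m: "sm m P" "sm m Q" using SS_obtain2[OF assms] .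
  have "du k (P * Q) = du k P * trunc Q + du k Q * trunc P" for k
  proof -
    have "un * du k (P * Q) = un * (du k P * Q + P * du k Q)"
      using m by (simp only: dT_mult sm_sd)
    then show ?thesis by (simp add: trunc_un distrib_left mult.assoc mult.left_commute mult.commute)
  qed
  then have "(dD ^^ k) (du k (P * Q)) = (dD ^^ k) (du k P * trunc Q) + (dD ^^ k) (du k Q * trunc P)" for k
    using assms by (simp only:) (rule dD_funpow_add; intro SSI; simp)
  then show ?thesis
    by (simp add: eul_eq[OF sm_mult[OF m]] adjoint_eq[OF m(1)] adjoint_eq[OF m(2)] distrib_left sum.distrib)
qed

lemma SS_eul [intro]: "P \<in> SS \<Longrightarrow> eul P \<in> SS"
proof -
  assume P: "P \<in> SS"
  then obtain m where m: "sm m P" by (auto simp: SS_def)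
  show ?thesis unfolding eul_eq[OF m] using P by (intro SSI)
qed

text \<open>The commutator terms of \<open>du_dD\<close>, shifted by one index, carry the opposite
  sign and cancel the main sum.\<close>

lemma eul_dD:
  assumes P: "P \<in> SS"
  shows "eul (dD P) = 0"
proof -
  obtain m where m: "sm m P" using P by (auto simp: SS_def)
  have s: "(dD ^^ k) (du k (dD P)) = (dD ^^ Suc k) (du k P) + (dD ^^ k) (case k of 0 \<Rightarrow> 0 | Suc j \<Rightarrow> du j P)" for k
    unfolding du_dD[OF P] using P
    by (subst dD_funpow_add) (auto intro!: SSI split: nat.splits simp: funpow_swap1)
  have "eul (dD P) = (\<Sum>k\<le>Suc m. (- 1) ^ k * (dD ^^ Suc k) (du k P)) +
      (\<Sum>k\<le>Suc m. (- 1) ^ k * (dD ^^ k) (case k of 0 \<Rightarrow> 0 | Suc j \<Rightarrow> du j P))"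
    by (simp only: eul_eq[OF sm_dD[OF m]] s distrib_left sum.distrib)
  also have "(\<Sum>k\<le>Suc m. (- 1) ^ k * (dD ^^ Suc k) (du k P)) = (\<Sum>k\<le>m. (- 1) ^ k * (dD ^^ Suc k) (du k P))"
    using dT_beyond[OF m, of "Suc m"] by simp
  also have "(\<Sum>k\<le>Suc m. (- 1) ^ k * (dD ^^ k) (case k of 0 \<Rightarrow> 0 | Suc j \<Rightarrow> du j P)) =
      (\<Sum>k\<le>m. (- 1) ^ Suc k * (dD ^^ Suc k) (du k P))"
    by (subst sum.atMost_Suc_shift) simp
  finally show ?thesis by (simp add: sum_negf)
qed

lemma integrate_by_parts:
  "R \<in> SS \<Longrightarrow> G \<in> SS \<Longrightarrow> \<exists>B\<in>SS. (dD ^^ k) R * G = R * ((- 1) ^ k * (dD ^^ k) G) + dD B"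
proof (induction k arbitrary: G)
  case 0
  show ?case by (rule bexI[of _ 0]) simp_all
next
  case (Suc k)
  then obtain B where B: "B \<in> SS" "(dD ^^ k) R * dD G = R * ((- 1) ^ k * (dD ^^ k) (dD G)) + dD B"
    using SS_dD by blast
  have D: "(dD ^^ k) R * G \<in> SS" using Suc.prems by (intro SSI)
  have "dD ((dD ^^ k) R * G) = (dD ^^ Suc k) R * G + (dD ^^ k) R * dD G"
    using Suc.prems by (subst dD_mult) (auto intro!: SSI)
  then have "(dD ^^ Suc k) R * G = R * ((- 1) ^ Suc k * (dD ^^ Suc k) G) + dD ((dD ^^ k) R * G - B)"
    using B D by (simp add: dD_diff funpow_swap1 algebra_simps)
  with B D show ?case by blast
qed

lemma integrate_by_parts_sum:
  assumes "finite A" "R \<in> SS" "\<And>k. k \<in> A \<Longrightarrow> G k \<in> SS"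
  shows "\<exists>B\<in>SS. (\<Sum>k\<in>A. (dD ^^ k) R * G k) = R * (\<Sum>k\<in>A. (- 1) ^ k * (dD ^^ k) (G k)) + dD B"
  using assms
proof (induction A)
  case empty
  show ?case by (rule bexI[of _ 0]) simp_all
next
  case (insert k A)
  obtain B where B: "B \<in> SS" "(\<Sum>k\<in>A. (dD ^^ k) R * G k) = R * (\<Sum>k\<in>A. (- 1) ^ k * (dD ^^ k) (G k)) + dD B"
    using insert by auto
  obtain B' where B': "B' \<in> SS" "(dD ^^ k) R * G k = R * ((- 1) ^ k * (dD ^^ k) (G k)) + dD B'"
    using integrate_by_parts insert.prems by blast
  from B B' insert.hyps show ?case
    by (intro bexI[of _ "B' + B"]) (simp_all add: dD_add algebra_simps SS_add)
qed

lemma pr_eul: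
  assumes "R \<in> SS" "P \<in> SS"
  shows "\<exists>B\<in>SS. pr R P = R * eul P + dD B"
proof -
  obtain m where m: "sm m P" using assms by (auto simp: SS_def)
  show ?thesis
    unfolding pr_eq[OF m] eul_eq[OF m] using assms by (intro integrate_by_parts_sum) (auto intro!: SSI)
qed

text \<open>By the product rule, every term of the derivative contains some
  \<open>(dD ^^ i) R\<close> with \<open>i <= k\<close>.\<close>

lemma dD_funpow_mult_vanish:
  assumes "R \<in> SS" "G \<in> SS" "\<And>i. i \<le> k \<Longrightarrow> (dD ^^ i) R x u = 0"
  shows "(dD ^^ k) (R * G) x u = 0"
  using assms
proof (induction k arbitrary: R G)
  case 0
  then show ?case using "0.prems"(3)[of 0] by (simp add: ev)
next
  case (Suc k)
  have *: "(dD ^^ Suc k) (R * G) = (dD ^^ k) (dD R * G) + (dD ^^ k) (R * dD G)"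
    unfolding funpow_Suc_right o_apply using Suc.prems
    by (subst dD_mult) (auto intro!: dD_funpow_add SSI)
  moreover have "(dD ^^ k) (dD R * G) x u = 0"
    using Suc.prems Suc.prems(3)[of "Suc _"] by (intro Suc.IH) (auto simp: funpow_swap1)
  moreover have "(dD ^^ k) (R * dD G) x u = 0"
    using Suc.prems by (intro Suc.IH) auto
  ultimately show ?case unfolding * by (simp add: plus_fun_apply)
qed

section \<open>Falling factorials and iterated derivations of powers\<close>

definition ff :: "nat \<Rightarrow> nat \<Rightarrow> real" where "ff k j = (\<Prod>i<j. real k - real i)"

lemma ff_0 [simp]: "ff k 0 = 1" and ff_Suc: "ff k (Suc j) = ff k j * (real k - real j)"
  by (simp_all add: ff_def)

lemma ff_eq_0: "k < j \<Longrightarrow> ff k j = 0"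
  by (auto simp: ff_def)

lemma ff_pos: "j \<le> k \<Longrightarrow> ff k j > 0"
  unfolding ff_def by (intro prod_pos) auto

lemma ff_fact: "j \<le> k \<Longrightarrow> ff k j = fact k / fact (k - j)"
proof (induction j)
  case (Suc j)
  then have "fact (k - j) = (real k - real j) * fact (k - Suc j)"
    using fact_reduce[of "k - j", where 'a = real] by (simp add: of_nat_diff)
  with Suc show ?case by (simp add: ff_Suc field_simps)
qed simp

text \<open>Collects what D_x, d/dz and the corrected evolutionary derivations share. The element
  \<open>un\<close> is listed separately because it need not be a constant function outside
  \<open>U\<close>.\<close>

definition derivation :: "(dfun \<Rightarrow> dfun) \<Rightarrow> bool" where
  "derivation \<delta> \<longleftrightarrow> (\<forall>P\<in>SS. \<delta> P \<in> SS) \<and> (\<forall>P\<in>SS. \<forall>Q\<in>SS. \<delta> (P + Q) = \<delta> P + \<delta> Q) \<and>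
    (\<forall>P\<in>SS. \<forall>Q\<in>SS. \<delta> (P * Q) = \<delta> P * Q + P * \<delta> Q) \<and> (\<forall>c. \<delta> (cst c) = 0) \<and> \<delta> un = 0"

lemma derivation_dD: "derivation dD"
  unfolding derivation_def by (auto simp: dD_add dD_mult)

context
  fixes \<delta> assumes \<delta>: "derivation \<delta>"
begin

lemma dv_SS: "P \<in> SS \<Longrightarrow> \<delta> P \<in> SS"
  and dv_add: "P \<in> SS \<Longrightarrow> Q \<in> SS \<Longrightarrow> \<delta> (P + Q) = \<delta> P + \<delta> Q"
  and dv_mult: "P \<in> SS \<Longrightarrow> Q \<in> SS \<Longrightarrow> \<delta> (P * Q) = \<delta> P * Q + P * \<delta> Q"
  and dv_cst: "\<delta> (cst c) = 0" and dv_un: "\<delta> un = 0"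
  using \<delta> unfolding derivation_def by blast+

lemma dv_0: "\<delta> 0 = 0" using dv_cst[of 0] by (simp add: cst_simps)

lemma dv_numeral: "\<delta> 1 = 0" "\<delta> (numeral w) = 0" "\<delta> (of_nat k) = 0"
  using dv_cst[of 1] dv_cst[of "numeral w"] dv_cst[of "of_nat k"]
  by (simp_all add: cst_def one_fun_def numeral_fun of_nat_fun)

lemma dv_uminus: "P \<in> SS \<Longrightarrow> \<delta> (- P) = - \<delta> P"
  using dv_add[of P "- P"] SS_uminus[of P] by (simp add: dv_0 eq_neg_iff_add_eq_0 add.commute)

lemma dv_diff: "P \<in> SS \<Longrightarrow> Q \<in> SS \<Longrightarrow> \<delta> (P - Q) = \<delta> P - \<delta> Q"
  using dv_add[of P "- Q"] SS_uminus[of Q] dv_uminus[of Q] by simp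

lemma dv_sum: "(\<And>k. k \<in> A \<Longrightarrow> P k \<in> SS) \<Longrightarrow> \<delta> (\<Sum>k\<in>A. P k) = (\<Sum>k\<in>A. \<delta> (P k))"
  by (induction A rule: infinite_finite_induct) (simp_all add: dv_add dv_0 SS_sum)

lemma dv_funpow_SS: "P \<in> SS \<Longrightarrow> (\<delta> ^^ k) P \<in> SS"
  by (induction k) (auto intro: dv_SS)

lemma dv_funpow_add: "P \<in> SS \<Longrightarrow> Q \<in> SS \<Longrightarrow> (\<delta> ^^ k) (P + Q) = (\<delta> ^^ k) P + (\<delta> ^^ k) Q"
  by (induction k) (simp_all add: dv_add dv_funpow_SS)

lemma dv_funpow_0: "(\<delta> ^^ k) 0 = 0"
  by (induction k) (simp_all add: dv_0)

lemma dv_funpow_sum: "(\<And>i. i \<in> A \<Longrightarrow> P i \<in> SS) \<Longrightarrow> (\<delta> ^^ k) (\<Sum>i\<in>A. P i) = (\<Sum>i\<in>A. (\<delta> ^^ k) (P i))"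
  by (induction A rule: infinite_finite_induct) (simp_all add: dv_funpow_add dv_funpow_0 SS_sum)

lemma dv_funpow_cst_mult: "P \<in> SS \<Longrightarrow> (\<delta> ^^ k) (cst c * P) = cst c * (\<delta> ^^ k) P"
  by (induction k) (simp_all add: dv_mult dv_funpow_SS dv_cst)

lemma dv_power:
  assumes t: "t \<in> SS" "\<delta> t = un"
  shows "\<delta> (t ^ k) = un * (cst (real k) * t ^ (k - 1))"
proof (induction k)
  case 0
  then show ?case by (simp add: dv_numeral cst_simps)
next
  case (Suc k)
  have "\<delta> (t ^ Suc k) = un * t ^ k + t * (un * (cst (real k) * t ^ (k - 1)))"
    using t Suc by (simp add: dv_mult SS_power)
  also have "t * (un * (cst (real k) * t ^ (k - 1))) = un * (cst (real k) * t ^ k)"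
    by (cases k) (simp_all add: cst_simps mult_ac)
  finally show ?case by (simp add: cst_simps(1,6) distrib_left distrib_right)
qed

text \<open>Applied to D_x with t = x - x0, and to d/dz with t = z or t = z - z0. The factor
  \<open>un\<close> is on both sides because the undifferentiated power need not vanish outside
  \<open>U\<close>.\<close>

lemma dv_funpow_power:
  assumes t: "t \<in> SS" "\<delta> t = un"
  shows "un * (\<delta> ^^ j) (t ^ k) = un * (cst (ff k j) * t ^ (k - j))"
proof (induction j)
  case 0
  then show ?case by (simp add: cst_simps)
next
  case (Suc j)
  have s: "(\<delta> ^^ j) (t ^ k) \<in> SS" "t ^ (k - j) \<in> SS" using t(1) by (auto intro: dv_funpow_SS)
  have "un * (\<delta> ^^ Suc j) (t ^ k) = \<delta> (un * (\<delta> ^^ j) (t ^ k))"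
    using s by (simp add: dv_mult dv_un)
  also have "\<dots> = un * (cst (ff k j) * (cst (real (k - j)) * t ^ (k - j - 1)))"
    using s unfolding Suc by (simp add: dv_mult dv_un dv_cst dv_power[OF t] SS_mult mult_ac)
  also have "cst (ff k j) * (cst (real (k - j)) * t ^ (k - j - 1)) = cst (ff k (Suc j)) * t ^ (k - Suc j)"
    by (cases "j \<le> k") (simp_all add: ff_Suc of_nat_diff cst_simps ff_eq_0 mult.assoc)
  finally show ?case .
qed

end

lemma dD_coordinates: "dD cx = un" "dD (cu j) = un * cu (Suc j)"
  by (simp_all add: dD_eq[OF sm_cx[of 0]] dD_eq[OF sm_cu[of j j]] dT_cx dT_cu if_distrib[of "\<lambda>z. _ * z"] mult.commute
      cong: if_cong)

text \<open>\<open>R\<close> is y minus the polynomial in x whose Taylor coefficients at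
  \<open>x0\<close> are given by the jet \<open>u0\<close>: at this jet the total derivatives of y
  are the entries of \<open>u0\<close>, and the polynomial cancels them up to order
  \<open>m\<close>.\<close>

lemma ex_vanishing_jet:
  assumes "(x0, u0) \<in> U"
  obtains R where "R \<in> SS" "du 0 R = un" "\<And>k. k > 0 \<Longrightarrow> du k R = 0" "\<And>j. j \<le> m \<Longrightarrow> (dD ^^ j) R x0 u0 = 0"
proof -
  define t where "t = cx - cst x0"
  have cx: "cx \<in> SS" by blast
  have t: "t \<in> SS" "dD t = un"
  proof -
    show "t \<in> SS" unfolding t_def by (intro SSI)
    show "dD t = un" by (simp add: t_def dD_diff dD_coordinates)
  qed
  have du_t: "du k (t ^ i) = 0" for i k
  proof (induction i)
    case 0
    have "(1 :: dfun) = cst 1" by (simp add: fun_eq_iff ev)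
    then have "du k (1 :: dfun) = 0" by (metis dT_cst)
    then show ?case by simp
  next
    case (Suc i)
    have "du k t = 0"
    proof -
      have "t = cx + cst (- x0)" by (simp add: t_def cst_simps)
      then show ?thesis
        using dT_add[OF sm_sd[OF sm_cx[of 0]] sd_cst[of "- x0"], of "Suc k"] by (simp only: dT_cx dT_cst add_0)
    qed
    with Suc t show ?case by (simp add: dT_mult SS_sd SS_power)
  qed
  define p where "p = (\<Sum>i\<le>m. cst (- (u0 i / fact i)) * t ^ i)"
  have p: "p \<in> SS" unfolding p_def using t by (intro SSI)
  have cu: "cu 0 \<in> SS" by blast
  have du_p: "du k p = 0" for k
    unfolding p_def using t by (subst dT_sum) (auto intro!: SSI sum.neutral simp: dT_mult SS_sd SS_power sd_cst du_t)
  have D_cu: "(dD ^^ j) (cu 0) x0 u0 = u0 j" for j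
  proof -
    have "un * (dD ^^ j) (cu 0) = un * cu j"
    proof (induction j)
      case (Suc j)
      have "un * (dD ^^ Suc j) (cu 0) = dD (un * (dD ^^ j) (cu 0))" by (simp add: dD_mult SSI)
      also have "\<dots> = un * cu (Suc j)" unfolding Suc by (simp add: dD_mult dD_coordinates)
      finally show ?case .
    qed simp
    from un_cancel[OF this assms] show ?thesis by (simp add: cu_apply)
  qed
  have D_p: "(dD ^^ j) p x0 u0 = - u0 j" if "j \<le> m" for j
  proof -
    have e: "(dD ^^ j) (t ^ i) x0 u0 = (if i = j then fact j else 0)" for i
    proof -
      have "(dD ^^ j) (t ^ i) x0 u0 = (cst (ff i j) * t ^ (i - j)) x0 u0"
      proof -
        have "un * (dD ^^ j) (t ^ i) = un * (cst (ff i j) * t ^ (i - j))"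
          by (rule dv_funpow_power[OF derivation_dD, OF t])
        from un_cancel[OF this assms] show ?thesis .
      qed
      also have "\<dots> = ff i j * 0 ^ (i - j)"
        by (simp add: t_def ev)
      also have "\<dots> = (if i = j then fact j else 0)"
        using ff_eq_0[of i j] ff_fact[of j j] by (auto simp: power_0_left)
      finally show ?thesis .
    qed
    have "(dD ^^ j) p = (\<Sum>i\<le>m. cst (- (u0 i / fact i)) * (dD ^^ j) (t ^ i))"
      unfolding p_def using t
      by (subst dv_funpow_sum[OF derivation_dD])
        (auto intro!: SSI simp: dv_funpow_cst_mult[OF derivation_dD] SS_power)
    then have "(dD ^^ j) p x0 u0 = (\<Sum>i\<le>m. - (u0 i / fact i) * (dD ^^ j) (t ^ i) x0 u0)"
      by (simp only: fun2_apply times_fun_apply cst_apply)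
    then     have "(dD ^^ j) p x0 u0 = (\<Sum>i\<le>m. - (u0 i / fact i) * (if i = j then fact j else 0))"
      by (simp only: e)
    also have "\<dots> = - u0 j" using that by (simp add: if_distrib[of "\<lambda>z. _ * z"] cong: if_cong)
    finally show ?thesis .
  qed
  show ?thesis
  proof (rule that[of "cu 0 + p"])
    show "cu 0 + p \<in> SS" using p cu by blast
    show "du 0 (cu 0 + p) = un" "\<And>k. k > 0 \<Longrightarrow> du k (cu 0 + p) = 0"
      using p cu by (simp_all add: dT_add SS_sd dT_cu du_p)
    show "(dD ^^ j) (cu 0 + p) x0 u0 = 0" if "j \<le> m" for j
      using that p cu by (simp add: dD_funpow_add D_cu D_p ev)
  qed
qed

text \<open>The first variation determines the Euler expression: testing with a characteristic that
  vanishes to high order at a given jet leaves only the undifferentiated term.\<close>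

lemma eul_unique:
  assumes P: "P \<in> SS" and S: "S \<in> SS" and *: "\<And>R. R \<in> SS \<Longrightarrow> \<exists>B\<in>SS. pr R P = R * S + dD B"
  shows "eul P = trunc S"
proof -
  define G where "G = eul P - S"
  have G: "G \<in> SS" unfolding G_def using P S by blast
  \<comment> \<open>The hypothesis and the first variation formula differ by \<open>R * G\<close>,
    which is therefore a total derivative.\<close>
  have eul0: "eul (R * G) = 0" if R: "R \<in> SS" for R
  proof -
    obtain B B' where "B \<in> SS" "B' \<in> SS" "pr R P = R * S + dD B" "pr R P = R * eul P + dD B'"
      using *[OF R] pr_eul[OF R P] by blast
    then have "R * G = dD (B - B')" "B - B' \<in> SS"
      by (simp_all add: G_def dD_diff algebra_simps SS_diff)
    then show ?thesis using eul_dD by simp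
  qed
  obtain m where m: "sm m G" using G by (auto simp: SS_def)
  have "G x u = 0" if q: "(x, u) \<in> U" for x u
  proof -
    obtain R where R: "R \<in> SS" "du 0 R = un" "\<And>k. k > 0 \<Longrightarrow> du k R = 0" "\<And>j. j \<le> m \<Longrightarrow> (dD ^^ j) R x u = 0"
      using ex_vanishing_jet[OF q, of m] by blast
    obtain m' where m': "sm m' R" "sm m' G" using SS_obtain2[OF R(1) G] by blast
    define M where "M = max m m'"
    have M: "sm M (R * G)" using m' by (auto simp: M_def intro: sm_mult sm_mono)
    \<comment> \<open>Up to the order \<open>m\<close> of \<open>G\<close>, the derivatives of
      \<open>R\<close> vanish at the jet; beyond it, \<open>du k G\<close> is zero. Only the term in
      which \<open>du 0\<close> falls on \<open>R\<close> survives.\<close>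
    have trm: "(dD ^^ k) (du k (R * G)) x u = (if k = 0 then G x u else 0)" for k
    proof -
      have "(dD ^^ k) (R * du k G) x u = 0"
      proof (cases "k \<le> m")
        case True
        then show ?thesis using R G by (intro dD_funpow_mult_vanish) auto
      next
        case False
        then show ?thesis using dT_beyond[OF m, of k] by (simp add: ev)
      qed
      moreover have "du k (R * G) = (if k = 0 then un * G else 0) + R * du k G"
        using R G by (simp add: dT_mult SS_sd)
      moreover have "(dD ^^ k) ((if k = 0 then un * G else 0) + R * du k G) =
          (dD ^^ k) (if k = 0 then un * G else 0) + (dD ^^ k) (R * du k G)"
        using R G by (intro dD_funpow_add) (auto intro!: SSI)
      ultimately show ?thesis using un_at[OF q] by (simp add: ev)
    qed
    have "eul (R * G) x u = (\<Sum>k\<le>M. (- 1) ^ k * (if k = 0 then G x u else 0))"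
      unfolding eul_eq[OF M] by (simp add: trm ev)
    also have "\<dots> = G x u" by (simp add: if_distrib[of "\<lambda>z. _ * z"] cong: if_cong)
    finally show ?thesis using eul0[OF R(1)] by (simp add: ev)
  qed
  then have "trunc (eul P) = trunc S" unfolding trunc_eq_iff by (simp add: G_def ev)
  then show ?thesis by (simp add: eul_def)
qed

end

section \<open>Differential functions along curves\<close>

lemma jet_eqI: "(\<And>i. slot i p = slot i q) \<Longrightarrow> p = q"
proof -
  assume *: "\<And>i. slot i p = slot i q"
  have "fst p = fst q" using *[of 0] by (simp add: slot_def)
  moreover have "snd p = snd q"
  proof
    show "snd p k = snd q k" for k using *[of "Suc k"] by (simp add: slot_def)
  qed
  ultimately show ?thesis by (rule prod_eqI)
qed

lemma smooth_on_deriv: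
  fixes f :: "real \<Rightarrow> real"
  assumes "open I" "smooth_on I f"
  shows "smooth_on I (deriv f)"
proof -
  have "frechet_derivative f (at t) 1 = deriv f t" if t: "t \<in> I" for t
  proof -
    have "(f has_field_derivative deriv f t) (at t)"
      using smooth_on_differentiable[OF assms(2) t] by (simp add: DERIV_deriv_iff_real_differentiable)
    then have "frechet_derivative f (at t) = (*) (deriv f t)"
      by (intro frechet_derivative_eqI) (simp add: has_field_derivative_def)
    then show ?thesis by simp
  qed
  then have "smooth_on I (\<lambda>t. frechet_derivative f (at t) 1) \<longleftrightarrow> smooth_on I (deriv f)"
    by (rule smooth_on_cong[OF assms(1)])
  then show ?thesis
    using smooth_on_frechet_derivative[OF assms(2), of 1] by simp
qed

lemma jet_of_has_deriv:
  assumes "open I" "smooth_on I f" "t \<in> I"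
  shows "((\<lambda>t. jet_of f t k) has_field_derivative jet_of f t (Suc k)) (at t)"
proof -
  have "smooth_on I ((deriv ^^ k) f)"
    by (induction k) (simp_all add: assms smooth_on_deriv)
  from smooth_on_differentiable[OF this assms(3)] show ?thesis
    by (simp add: jet_of_def DERIV_deriv_iff_real_differentiable)
qed

context jet_domain begin

text \<open>A chain rule on a space without a norm: the coordinates on which \<open>P\<close>
  depends are moved along the curve one after the other, and each contributes one partial
  derivative.\<close>

lemma curve_has_deriv:
  assumes P: "sm m P" and I: "open I" "smooth_on I f" and jets: "\<And>t. t \<in> I \<Longrightarrow> (t, jet_of f t) \<in> U"
    and x: "x \<in> I"
  shows "((\<lambda>t. P t (jet_of f t)) has_field_derivative Dx P x (jet_of f x)) (at x)"
proof -
  define q where "q = (x, jet_of f x)"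
  define c where "c j t = slot j (t, jet_of f t)" for j t
  define c' where "c' j = (case j of 0 \<Rightarrow> 1 | Suc k \<Rightarrow> jet_of f x (Suc k))" for j
  \<comment> \<open>This is the jet at \<open>x\<close> with its first \<open>i\<close> slots
    replaced by those of the curve at \<open>t\<close>.\<close>
  define M where "M i t = fold (\<lambda>j. put j (c j t)) [0..<i] q" for i t
  have q: "q \<in> U" using jets[OF x] by (simp add: q_def)
  have cx: "c j x = slot j q" for j by (simp add: c_def q_def)
  have c_deriv: "(c j has_field_derivative c' j) (at x)" for j
    using jet_of_has_deriv[OF I x] by (cases j) (simp_all add: c_def[abs_def] c'_def)
  have c_cont: "continuous_on I (c j)" for j
  proof (cases j)
    case 0
    then show ?thesis by (simp add: c_def[abs_def] continuous_on_id)
  next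
    case (Suc k)
    have "continuous_on I (\<lambda>t. jet_of f t k)"
      using jet_of_has_deriv[OF I] by (intro DERIV_continuous_on) (auto intro: has_field_derivative_at_within)
    with Suc show ?thesis by (simp add: c_def[abs_def])
  qed
  have M0: "M 0 t = q" and MS: "M (Suc i) t = put i (c i t) (M i t)" for i t
    by (simp_all add: M_def)
  have slot_M: "slot j (M i t) = (if j < i then c j t else slot j q)" for i j t
    by (induction i) (auto simp: M0 MS slot_put)
  have M_x: "M i x = q" for i by (rule jet_eqI) (simp add: slot_M cx)
  have M_cont: "continuous_on I (M i)" for i
  proof (induction i)
    case 0
    then show ?case by (simp add: M0[abs_def])
  next
    case (Suc i)
    then show ?case unfolding MS[abs_def] using c_cont by (intro continuous_on_put)
  qed
  have main: "((\<lambda>t. case_prod P (M i t)) has_field_derivative (\<Sum>l<i. case_prod (pd l P) q * c' l)) (at x)" for i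
  proof (induction i)
    case 0
    then show ?case by (simp add: M0)
  next
    case (Suc i)
    let ?S = "\<Sum>l<i. case_prod (pd l P) q * c' l"
    define F where "F t s = case_prod P (put i s (M i t))" for t s
    define g where "g = (\<lambda>(t, s). put i s (M i t))"
    have g_cont: "continuous_on (I \<times> UNIV) g"
      unfolding g_def case_prod_unfold
      by (intro continuous_on_put continuous_on_snd continuous_on_id
          continuous_on_compose2[OF M_cont continuous_on_fst[OF continuous_on_id]]) auto
    define A where "A = (I \<times> UNIV) \<inter> g -` U"
    have "open A" unfolding A_def
      using continuous_open_preimage[OF g_cont _ open_U] I(1) by (simp add: open_Times)
    moreover have "(x, slot i q) \<in> A" using x q by (simp add: A_def g_def M_x)
    ultimately obtain X Y where XY: "open X" "open Y" "x \<in> X" "slot i q \<in> Y" "X \<times> Y \<subseteq> A"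
      by (elim open_prod_elim) auto
    obtain r where r: "r > 0" "ball (slot i q) r \<subseteq> Y" using XY openE by blast
    define B where "B = ball (slot i q) r"
    have B: "open B" "convex B" "slot i q \<in> B" "X \<times> B \<subseteq> A"
      using r XY by (auto simp: B_def)
    have pd_cont: "continuous_on (X \<times> B) (\<lambda>p. case_prod (pd i P) (g p))"
    proof (rule continuous_on_compose2[OF sd_continuous[OF sd_pd[OF sm_sd[OF P]]]])
      show "continuous_on (X \<times> B) g" using B(4) by (intro continuous_on_subset[OF g_cont]) (auto simp: A_def)
      show "g ` (X \<times> B) \<subseteq> U" using B(4) by (auto simp: A_def)
    qed
    \<comment> \<open>The derivative in \<open>t\<close> at the base point is the induction
      hypothesis; with continuity of the derivative in \<open>s\<close> it gives joint
      differentiability, and the curve \<open>s = c i t\<close> can be inserted.\<close>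
    have "((\<lambda>(t, s). F t s) has_derivative (\<lambda>(ht, hs). ?S * ht + blinfun_mult_right (case_prod (pd i P) (g (x, slot i q))) hs))
        (at (x, slot i q) within X \<times> B)"
    proof (rule has_derivative_partialsI[where fy = "\<lambda>t s. blinfun_mult_right (case_prod (pd i P) (g (t, s)))"])
      have "(\<lambda>t. F t (slot i q)) = (\<lambda>t. case_prod P (M i t))"
      proof
        fix t
        have "put i (slot i q) (M i t) = M i t" using put_slot[of i "M i t"] by (simp add: slot_M)
        then show "F t (slot i q) = case_prod P (M i t)" by (simp add: F_def)
      qed
      with Suc show "((\<lambda>t. F t (slot i q)) has_derivative (*) ?S) (at x within X)"
        by (simp add: has_field_derivative_def has_derivative_at_withinI)
      show "((\<lambda>s. F t s) has_derivative blinfun_apply (blinfun_mult_right (case_prod (pd i P) (g (t, s))))) (at s within B)"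
        if "t \<in> X" "s \<in> B" for t s
      proof -
        have "put i s (M i t) \<in> U" using that B(4) by (auto simp: A_def g_def)
        from sd_has_deriv[OF sm_sd[OF P] this] show ?thesis
          by (simp add: F_def g_def has_field_derivative_def has_derivative_at_withinI)
      qed
      have "continuous_on (X \<times> B) (\<lambda>p. blinfun_mult_right (case_prod (pd i P) (g p)))"
        by (rule bounded_linear.continuous_on[OF bounded_linear_blinfun_mult_right pd_cont])
      then show "continuous (at (x, slot i q) within X \<times> B) (\<lambda>(t, s). blinfun_mult_right (case_prod (pd i P) (g (t, s))))"
        using XY(3) B(3) by (simp add: continuous_on_eq_continuous_within case_prod_unfold)
    qed (use B in auto)
    then have F_deriv: "((\<lambda>(t, s). F t s) has_derivative (\<lambda>(ht, hs). ?S * ht + case_prod (pd i P) q * hs)) (at (x, c i x))"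
      using at_within_open[OF _ open_Times[OF XY(1) B(1)], of "(x, slot i q)"] XY(3) B(3)
      by (simp add: cx g_def M_x)
    have "((\<lambda>t. (t, c i t)) has_derivative (\<lambda>h. (h, c' i * h))) (at x)"
      using c_deriv[of i] by (intro has_derivative_Pair has_derivative_ident) (simp add: has_field_derivative_def)
    from has_derivative_compose[OF this F_deriv]
    have "((\<lambda>t. F t (c i t)) has_derivative (\<lambda>h. ?S * h + case_prod (pd i P) q * (c' i * h))) (at x)"
      by simp
    moreover have "(\<lambda>h. ?S * h + case_prod (pd i P) q * (c' i * h)) = (*) (\<Sum>l<Suc i. case_prod (pd l P) q * c' l)"
      by (rule ext) (simp add: algebra_simps)
    ultimately show ?case
      by (simp add: has_field_derivative_def F_def MS)
  qed
  \<comment> \<open>Order \<open>m\<close> involves the slots \<open>0\<close> to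
    \<open>Suc m\<close>; after this many replacements \<open>P\<close> has the same value at the
    mixed jet and on the curve.\<close>
  let ?m = "Suc (Suc m)"
  have "\<forall>\<^sub>F t in nhds x. t \<in> I \<and> M ?m t \<in> U"
  proof -
    have "open (I \<inter> M ?m -` U)" by (rule continuous_open_preimage[OF M_cont I(1) open_U])
    moreover have "x \<in> I \<inter> M ?m -` U" using x q by (simp add: M_x)
    ultimately show ?thesis using eventually_nhds_in_open[of "I \<inter> M ?m -` U" x] by simp
  qed
  then have "\<forall>\<^sub>F t in nhds x. case_prod P (M ?m t) = P t (jet_of f t)"
  proof eventually_elim
    case (elim t)
    have "case_prod P (M ?m t) = case_prod P (t, jet_of f t)"
      by (rule dependsD[of m]) (use elim jets P in \<open>auto simp: sm_iff slot_M c_def\<close>)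
    then show ?case by simp
  qed
  from DERIV_cong_ev[OF refl this refl] main[of ?m]
  have "((\<lambda>t. P t (jet_of f t)) has_field_derivative (\<Sum>l<?m. case_prod (pd l P) q * c' l)) (at x)"
    by blast
  moreover have "(\<Sum>l<?m. case_prod (pd l P) q * c' l) = Dx P x (jet_of f x)"
  proof -
    have "dD P x (jet_of f x) = pd_x P x (jet_of f x) + (\<Sum>k\<le>m. jet_of f x (Suc k) * pd_u k P x (jet_of f x))"
      using jets[OF x] unfolding dD_eq[OF P] by (simp add: ev dT_at)
    then show ?thesis
      using jets[OF x] by (subst sum.lessThan_Suc_shift)
        (simp add: dD_at c'_def q_def lessThan_Suc_atMost mult.commute)
  qed
  ultimately show ?thesis by simp
qed

end

section \<open>Functions on the plane and prolonged vector fields\<close>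

locale jets_above = jet_domain +
  fixes \<Omega> :: "(real \<times> real) set"
  assumes open_\<Omega>: "open \<Omega>" and U_above: "U \<subseteq> jets_over \<Omega>"
begin

lemma base_point: "(x, u) \<in> U \<Longrightarrow> (x, u 0) \<in> \<Omega>"
  using U_above by (auto simp: jets_over_def)

lemma lift_slices:
  assumes g: "smooth_on \<Omega> g" and q: "q \<in> U"
  shows "((\<lambda>t. case_prod (lift g) (put i t q)) has_field_derivative
    case_prod (case i of 0 \<Rightarrow> lift (d1 g) | Suc 0 \<Rightarrow> lift (d2 g) | _ \<Rightarrow> cst 0) q) (at (slot i q))"
proof -
  obtain x u where xu: "q = (x, u)" by (cases q)
  have d: "g differentiable at (x, u 0)"
    using smooth_on_differentiable[OF g] base_point[of x u] q xu by simp
  consider "i = 0" | "i = 1" | k where "i = Suc (Suc k)" by (metis One_nat_def not0_implies_Suc)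
  then show ?thesis
    by cases (use slice_derivatives(1,2)[OF d] in \<open>simp_all add: xu lift_def cst_def\<close>)
qed

lemma cls_lift: "smooth_on \<Omega> g \<Longrightarrow> cls r (lift g)"
proof (induction r arbitrary: g)
  have base: "cls 0 (lift g)" if "smooth_on \<Omega> g" for g
  proof -
    have "continuous_on U (\<lambda>q. g (fst q, snd q 0))"
      by (rule continuous_on_compose2[OF smooth_on_continuous_on[OF that]])
        (use base_point in \<open>auto intro!: continuous_on_Pair continuous_on_fst continuous_on_id
          continuous_on_product_then_coordinatewise[OF continuous_on_snd]\<close>)
    then show ?thesis by (simp add: cls_0 case_prod_unfold lift_def)
  qed
  {
    case 0
    then show ?case by (rule base)
  next
    case (Suc r)
    show ?case
    proof (rule cls_SucI[OF lift_slices[OF Suc.prems] base[OF Suc.prems]])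
      show "cls r (case i of 0 \<Rightarrow> lift (d1 g) | Suc 0 \<Rightarrow> lift (d2 g) | Suc (Suc k) \<Rightarrow> cst 0)" for i
        using Suc.IH[OF smooth_on_frechet_derivative[OF Suc.prems]] cls_cst
        by (simp split: nat.split)
    qed
  }
qed

lemma sm_lift: "smooth_on \<Omega> g \<Longrightarrow> sm m (lift g)"
proof -
  assume "smooth_on \<Omega> g"
  then have "sd (lift g)" using cls_lift by (simp add: sd_cls)
  moreover have "depends m (lift g)"
    unfolding depends_def case_prod_unfold lift_def
    by (metis slot_simps prod.collapse zero_le Suc_le_mono)
  ultimately show ?thesis by (simp add: sm_iff)
qed

lemma SS_lift: "smooth_on \<Omega> g \<Longrightarrow> lift g \<in> SS"
  by (rule SS_I[OF sm_lift[of _ 0]])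

lemma dT_lift:
  assumes "smooth_on \<Omega> g"
  shows "dT 0 (lift g) = trunc (lift (d1 g))" "du 0 (lift g) = trunc (lift (d2 g))" "du (Suc k) (lift g) = 0"
  using dT_eqI[OF lift_slices[OF assms], of 0] dT_eqI[OF lift_slices[OF assms], of 1]
    dT_eqI[OF lift_slices[OF assms], of "Suc (Suc k)"]
  by (simp_all add: trunc_un cst_simps)

lemma dD_lift:
  assumes "smooth_on \<Omega> g"
  shows "dD (lift g) = un * (lift (d1 g) + cu 1 * lift (d2 g))"
  unfolding dD_eq[OF sm_lift[OF assms, of 0]]
  by (simp add: dT_lift[OF assms] trunc_un algebra_simps)

text \<open>With the characteristic for \<open>R\<close> and the x-component for
  \<open>\<eta>\<close> this is the prolongation of a vector field; another choice of
  \<open>\<eta>\<close> gives the variation at fixed z.\<close>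

definition vX :: "dfun \<Rightarrow> dfun \<Rightarrow> dfun \<Rightarrow> dfun" where "vX R \<eta> P = pr R P + \<eta> * dD P"

lemma derivation_vX:
  assumes "R \<in> SS" "\<eta> \<in> SS"
  shows "derivation (vX R \<eta>)"
  unfolding derivation_def
proof (intro conjI ballI allI)
  show "vX R \<eta> P \<in> SS" if "P \<in> SS" for P
    unfolding vX_def using assms that by (intro SSI SS_pr)
  show "vX R \<eta> (P + Q) = vX R \<eta> P + vX R \<eta> Q" if "P \<in> SS" "Q \<in> SS" for P Q
    using that by (simp add: vX_def pr_add dD_add algebra_simps)
  show "vX R \<eta> (P * Q) = vX R \<eta> P * Q + P * vX R \<eta> Q" if "P \<in> SS" "Q \<in> SS" for P Q
    using that by (simp add: vX_def pr_mult dD_mult algebra_simps)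
qed (simp_all add: vX_def pr_def)

text \<open>\<open>pr R\<close> commutes with D_x, so only the coefficient of the D_x part
  contributes to the commutator.\<close>

lemma vX_dD:
  assumes "R \<in> SS" "\<eta> \<in> SS" "P \<in> SS"
  shows "vX R \<eta> (dD P) = dD (vX R \<eta> P) - dD \<eta> * dD P"
proof -
  have "pr R P \<in> SS" "\<eta> * dD P \<in> SS" "dD P \<in> SS" using assms by (auto intro: SSI)
  then show ?thesis
    using assms by (simp add: vX_def pr_dD dD_add dD_mult algebra_simps)
qed

lemma vX_cong: "trunc P = trunc Q \<Longrightarrow> vX R \<eta> P = vX R \<eta> Q"
  by (simp add: vX_def pr_def dT_cong[of P Q] dD_cong[of P Q])

text \<open>The summands xi y^(k+1) in the coefficients, together with the x-derivative, add up to
  xi times the total derivative.\<close>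

lemma prolong_at:
  assumes P: "P \<in> SS" and q: "(x, u) \<in> U"
  shows "prolong v P x u = vX (characteristic v) (lift (\<lambda>p. fst (v p))) P x u"
proof -
  obtain m where m: "sm m P" using P by (auto simp: SS_def)
  have D: "(Dx ^^ k) (characteristic v) x u = (dD ^^ k) (characteristic v) x u" for k
    by (rule Dx_funpow_at[OF refl q])
  have "(\<Sum>k. ((Dx ^^ k) (characteristic v) x u + fst (v (x, u 0)) * u (Suc k)) * pd_u k P x u) =
    (\<Sum>k\<le>m. ((dD ^^ k) (characteristic v) x u + fst (v (x, u 0)) * u (Suc k)) * du k P x u)"
  proof -
    have "pd_u k P x u = 0" if "k \<notin> {..m}" for k
      using dT_beyond[OF m, of k] dT_at[OF q, of "Suc k" P] that by (simp add: ev)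
    then show ?thesis unfolding D using dT_at[OF q, of "Suc k" P for k]
      by (subst suminf_finite[of "{..m}"]) simp_all
  qed
  moreover have "vX (characteristic v) (lift (\<lambda>p. fst (v p))) P x u =
      (\<Sum>k\<le>m. (dD ^^ k) (characteristic v) x u * du k P x u) + fst (v (x, u 0)) *
        (dT 0 P x u + (\<Sum>k\<le>m. u (Suc k) * du k P x u))"
    unfolding vX_def pr_eq[OF m] dD_eq[OF m]
    by (simp only: plus_fun_apply times_fun_apply fun2_apply lift_def cu_apply)
  ultimately show ?thesis
    using dT_at[OF q, of 0 P] by (simp add: prolong_def algebra_simps sum.distrib sum_distrib_left)
qed

end

section \<open>Changing variables\<close>

lemma open_jets_over: "open \<Omega> \<Longrightarrow> open (jets_over \<Omega>)"
proof -
  assume \<Omega>: "open \<Omega>"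
  have "continuous_on UNIV (\<lambda>q :: jet. (fst q, snd q 0))"
    by (intro continuous_on_Pair continuous_on_fst continuous_on_id
        continuous_on_product_then_coordinatewise[OF continuous_on_snd[OF continuous_on_id]])
  then have "open ((\<lambda>q :: jet. (fst q, snd q 0)) -` \<Omega>)" by (rule open_vimage[OF \<Omega>])
  moreover have "jets_over \<Omega> = (\<lambda>q. (fst q, snd q 0)) -` \<Omega>" by (auto simp: jets_over_def)
  ultimately show ?thesis by simp
qed

text \<open>A nonvanishing Jacobian is all that is assumed of the map here; the identity coordinates
  \<open>fst\<close> and \<open>snd\<close> are an instance, which later covers the trivial equation
  itself.\<close>

locale change_of_vars =
  fixes \<Omega> :: "(real \<times> real) set" and \<zeta> \<phi> :: "real \<times> real \<Rightarrow> real"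
  assumes open_base: "open \<Omega>" and smooth_\<zeta>: "smooth_on \<Omega> \<zeta>" and smooth_\<phi>: "smooth_on \<Omega> \<phi>"
    and jac_nonzero: "\<And>p. p \<in> \<Omega> \<Longrightarrow> d1 \<zeta> p * d2 \<phi> p - d2 \<zeta> p * d1 \<phi> p \<noteq> 0"
begin

text \<open>The calculus is first used on all jets over the base, where D_x zeta is continuous; the
  regular jets are the preimage of the nonzero reals.\<close>

lemma open_regular_jets: "open (regular_jets \<Omega> \<zeta>)"
proof -
  interpret J: jets_above "jets_over \<Omega>" \<Omega>
    by unfold_locales (simp_all add: open_base open_jets_over)
  have "continuous_on (jets_over \<Omega>) (\<lambda>q. case_prod (J.dD (lift \<zeta>)) q)"
    by (rule J.sd_continuous[OF J.SS_sd[OF J.SS_dD[OF J.SS_lift[OF smooth_\<zeta>]]]])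
  then have "open (jets_over \<Omega> \<inter> (\<lambda>q. case_prod (J.dD (lift \<zeta>)) q) -` (- {0}))"
    by (rule continuous_open_preimage) (simp_all add: open_jets_over open_base open_Compl)
  moreover have "regular_jets \<Omega> \<zeta> = jets_over \<Omega> \<inter> (\<lambda>q. case_prod (J.dD (lift \<zeta>)) q) -` (- {0})"
    by (auto simp: regular_jets_def J.dD_at)
  ultimately show ?thesis by simp
qed

sublocale jets_above "regular_jets \<Omega> \<zeta>" \<Omega>
  by unfold_locales (rule open_regular_jets open_base | force simp: regular_jets_def)+

abbreviation U where "U \<equiv> regular_jets \<Omega> \<zeta>"

definition jac :: "real \<times> real \<Rightarrow> real" where "jac p = d1 \<zeta> p * d2 \<phi> p - d2 \<zeta> p * d1 \<phi> p"

text \<open>Here \<open>Z\<close> and \<open>W k\<close> are z and w^(k) as functions of x and the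
  derivatives of y, \<open>D1\<close> is D_x zeta, and \<open>Dz\<close> is d/dz.\<close>

definition Z where "Z = trunc (lift \<zeta>)"
definition W where "W k = trunc (w_deriv \<zeta> \<phi> k)"
definition D1 where "D1 = dD Z"
definition iv where "iv = trunc (\<lambda>x u. inverse (D1 x u))"
definition Jc where "Jc = trunc (lift jac)"
definition iJ where "iJ = trunc (\<lambda>x u. inverse (Jc x u))"
definition zy where "zy = du 0 Z"
definition Dz where "Dz P = iv * dD P"

lemma Z_SS: "Z \<in> SS" by (simp add: Z_def SS_lift smooth_\<zeta>)
lemma D1_SS: "D1 \<in> SS" unfolding D1_def by (intro SSI Z_SS)
lemma zy_SS: "zy \<in> SS" unfolding zy_def by (intro SSI Z_SS)

lemma smooth_jac: "smooth_on \<Omega> jac"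
proof -
  have "smooth_on \<Omega> (\<lambda>p. d1 \<zeta> p * d2 \<phi> p + (- 1) * (d2 \<zeta> p * d1 \<phi> p))"
    using open_base smooth_\<zeta> smooth_\<phi>
    by (intro smooth_on_add smooth_on_mult smooth_on_const smooth_on_frechet_derivative)
  then show ?thesis by (simp add: jac_def[abs_def])
qed

lemma Jc_SS: "Jc \<in> SS" by (simp add: Jc_def SS_lift smooth_jac)

lemma D1_at: "(x, u) \<in> U \<Longrightarrow> D1 x u = Dx (lift \<zeta>) x u"
  by (simp add: D1_def Z_def dD_at)

lemma D1_nonzero: "(x, u) \<in> U \<Longrightarrow> D1 x u \<noteq> 0"
  by (simp add: D1_at) (simp add: regular_jets_def)

lemma Jc_at: "(x, u) \<in> U \<Longrightarrow> Jc x u = jac (x, u 0)"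
  by (simp add: Jc_def trunc_at lift_def)

lemma Jc_nonzero: "(x, u) \<in> U \<Longrightarrow> Jc x u \<noteq> 0"
  using jac_nonzero[OF base_point] by (simp add: Jc_at jac_def)

lemma iv_SS: "iv \<in> SS"
  unfolding iv_def SS_trunc by (rule SS_inverse[OF D1_SS]) (rule D1_nonzero)
lemma iJ_SS: "iJ \<in> SS"
  unfolding iJ_def SS_trunc by (rule SS_inverse[OF Jc_SS]) (rule Jc_nonzero)

lemma inverses: "D1 * iv = un" "iv * D1 = un" "Jc * iJ = un" "iJ * Jc = un"
  using D1_nonzero Jc_nonzero by (simp_all add: fun_eq_iff ev iv_def iJ_def trunc_def un_def)

lemma un_absorb: "un * Z = Z" "un * W k = W k" "un * D1 = D1" "un * iv = iv" "un * Jc = Jc" "un * iJ = iJ"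
    "un * zy = zy" "un * Dz P = Dz P"
proof -
  have t: "un * trunc P = trunc P" for P by (simp add: trunc_un)
  show "un * Z = Z" "un * W k = W k" "un * iv = iv" "un * Jc = Jc" "un * iJ = iJ"
    unfolding Z_def W_def iv_def Jc_def iJ_def by (rule t)+
  then show "un * Dz P = Dz P" by (simp add: Dz_def mult.assoc[symmetric])
qed (simp_all add: D1_def zy_def)

lemma inverses_mult: "D1 * (iv * P) = un * P" "iv * (D1 * P) = un * P" "Jc * (iJ * P) = un * P" "iJ * (Jc * P) = un * P"
  by (simp_all add: mult.assoc[symmetric] inverses)

lemma D1_Dz: "D1 * Dz P = dD P"
  by (simp add: Dz_def inverses_mult)

lemma W_Suc: "W (Suc k) = Dz (W k)"
proof -
  have "w_deriv \<zeta> \<phi> (Suc k) x u = (iv * dD (W k)) x u" if "(x, u) \<in> U" for x u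
    using that by (simp add: ev iv_def trunc_at D1_at W_def dD_at divide_inverse)
  then have "trunc (w_deriv \<zeta> \<phi> (Suc k)) = trunc (iv * dD (W k))"
    unfolding trunc_eq_iff by blast
  then show ?thesis
    unfolding W_def[of "Suc k"] Dz_def by (simp add: trunc_un mult.left_commute[of un])
qed

lemma sm_Z: "sm m Z" by (simp add: Z_def sm_lift smooth_\<zeta>)

lemma sm_D1: "sm (Suc m) D1"
  unfolding D1_def by (intro sm_dD sm_Z)

lemma sm_iv: "sm (Suc m) iv"
  unfolding iv_def sm_trunc by (rule sm_inverse[OF sm_D1]) (rule D1_nonzero)

lemma sm_W: "sm k (W k)"
proof (induction k)
  case 0
  then show ?case by (simp add: W_def sm_lift smooth_\<phi>)
next
  case (Suc k)
  then show ?case unfolding W_Suc Dz_def by (intro sm_mult sm_iv sm_dD)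
qed

lemma W_SS: "W k \<in> SS" by (rule SS_I[OF sm_W])

lemma Dz_SS: "P \<in> SS \<Longrightarrow> Dz P \<in> SS" unfolding Dz_def by (intro SSI iv_SS)

lemmas SSV = SSI Z_SS W_SS D1_SS iv_SS Jc_SS iJ_SS zy_SS Dz_SS

lemma derivation_Dz: "derivation Dz"
  unfolding derivation_def by (auto simp: Dz_def dD_add dD_mult algebra_simps intro!: SSV)

lemma Dz_Z: "Dz Z = un" by (simp add: Dz_def D1_def[symmetric] inverses)

lemma Dz_W: "Dz (W k) = W (Suc k)" by (simp add: W_Suc)

lemma Dz_funpow_W: "(Dz ^^ j) (W k) = W (k + j)"
  by (induction j) (simp_all add: Dz_W)

lemma Dz_funpow_SS: "P \<in> SS \<Longrightarrow> (Dz ^^ k) P \<in> SS"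
  by (rule dv_funpow_SS[OF derivation_Dz])

lemma vX_D1:
  assumes "R \<in> SS" "\<eta> \<in> SS"
  shows "vX R \<eta> D1 = dD (vX R \<eta> Z) - dD \<eta> * D1"
  unfolding D1_def by (rule vX_dD[OF assms Z_SS])

text \<open>Apply the derivation to \<open>D1 * W (Suc k) = dD (W k)\<close> and divide by
  \<open>D1\<close>; the terms with \<open>dD \<eta>\<close> cancel. This is the usual recursion for
  prolongation coefficients, in the coordinates z and w.\<close>

lemma vX_W_Suc:
  assumes "R \<in> SS" "\<eta> \<in> SS"
  shows "vX R \<eta> (W (Suc k)) = Dz (vX R \<eta> (W k)) - W (Suc k) * Dz (vX R \<eta> Z)"
proof -
  note X = dv_mult[OF derivation_vX[OF assms]]
  let ?X = "vX R \<eta>"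
  have "D1 * W (Suc k) = dD (W k)" by (simp add: W_Suc D1_Dz)
  then have "?X D1 * W (Suc k) + D1 * ?X (W (Suc k)) = ?X (dD (W k))"
    using X[OF D1_SS W_SS[of "Suc k"]] by simp
  also have "\<dots> = dD (?X (W k)) - dD \<eta> * (D1 * W (Suc k))"
    using vX_dD[OF assms W_SS] by (simp add: W_Suc D1_Dz)
  finally have "D1 * ?X (W (Suc k)) = dD (?X (W k)) - W (Suc k) * dD (?X Z)"
    by (simp add: vX_D1[OF assms] algebra_simps)
  then have "iv * (D1 * ?X (W (Suc k))) = iv * (dD (?X (W k)) - W (Suc k) * dD (?X Z))"
    by simp
  then have *: "un * ?X (W (Suc k)) = Dz (?X (W k)) - W (Suc k) * Dz (?X Z)"
    by (simp add: inverses_mult Dz_def algebra_simps)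
  have "un * ?X (W (Suc k)) = ?X (un * W (Suc k))"
    using X[OF SS_un W_SS[of "Suc k"]] dv_un[OF derivation_vX[OF assms]] by simp
  then show ?thesis using * by (simp add: un_absorb)
qed

text \<open>The derivation \<open>\<partial>\<close> that fixes \<open>z\<close>, commutes with \<open>d/dz\<close> and sends \<open>w\<close> to \<open>R J / D\<^sub>x \<zeta>\<close>:
  the evolutionary derivation of \<open>R\<close> corrected by a multiple of \<open>D\<^sub>x\<close>.\<close>

definition vZ where "vZ R = vX R (- (zy * R * iv))"

lemma derivation_vZ: "R \<in> SS \<Longrightarrow> derivation (vZ R)"
  unfolding vZ_def by (intro derivation_vX SSV)

lemma pr_lift:
  assumes "smooth_on \<Omega> g"
  shows "pr R (trunc (lift g)) = R * trunc (lift (d2 g))"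
  using pr_eq[of 0 "trunc (lift g)" R] sm_lift[OF assms, of 0] by (simp add: dT_lift[OF assms])

lemma zy_eq: "zy = trunc (lift (d2 \<zeta>))"
  by (simp add: zy_def Z_def dT_lift smooth_\<zeta>)

lemma vZ_Z: "vZ R Z = 0"
proof -
  have "pr R Z = R * zy" by (simp add: zy_eq Z_def pr_lift smooth_\<zeta>)
  moreover have "zy * R * iv * D1 = R * zy"
    by (simp add: mult.assoc inverses) (simp add: un_absorb mult.left_commute[of _ un] mult.commute[of _ un] mult.commute[of zy] mult.left_commute[of un R])
  ultimately show ?thesis by (simp add: vZ_def vX_def D1_def)
qed

lemma W0_eq: "W 0 = trunc (lift \<phi>)" by (simp add: W_def)

text \<open>In phi_y D_x zeta - zeta_y D_x phi the terms with y' cancel, and the Jacobian is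
  left.\<close>

lemma vZ_W0: "vZ R (W 0) = R * Jc * iv"
proof -
  have "vZ R (W 0) = R * trunc (lift (d2 \<phi>)) - zy * R * iv * dD (W 0)"
    by (simp add: vZ_def vX_def W0_eq pr_lift smooth_\<phi>)
  also have "R * trunc (lift (d2 \<phi>)) = R * (trunc (lift (d2 \<phi>)) * D1 * iv)"
    by (simp add: mult.assoc inverses) (simp add: trunc_un mult.commute[of _ un])
  finally have "vZ R (W 0) = R * (trunc (lift (d2 \<phi>)) * D1 - zy * dD (W 0)) * iv"
    by (simp add: algebra_simps)
  also have "trunc (lift (d2 \<phi>)) * D1 - zy * dD (W 0) = Jc"
  proof -
    have "D1 = un * (lift (d1 \<zeta>) + cu 1 * lift (d2 \<zeta>))" "dD (W 0) = un * (lift (d1 \<phi>) + cu 1 * lift (d2 \<phi>))"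
      by (simp_all add: D1_def Z_def W0_eq dD_lift smooth_\<zeta> smooth_\<phi>)
    then have "(trunc (lift (d2 \<phi>)) * D1 - zy * dD (W 0)) x u = Jc x u" for x u
      by (cases "(x, u) \<in> U")
        (simp_all add: zy_eq Jc_def ev trunc_def un_def jac_def lift_def algebra_simps)
    then show ?thesis by (intro ext)
  qed
  finally show ?thesis .
qed

lemma vZ_W:
  assumes "R \<in> SS"
  shows "vZ R (W k) = (Dz ^^ k) (R * Jc * iv)"
proof (induction k)
  case 0
  then show ?case by (simp add: vZ_W0)
next
  case (Suc k)
  have "vZ R (W (Suc k)) = Dz (vZ R (W k)) - W (Suc k) * Dz (vZ R Z)"
    unfolding vZ_def using assms by (intro vX_W_Suc SSV)
  then show ?case
    by (simp add: Suc vZ_Z dv_0[OF derivation_Dz])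
qed

text \<open>Correcting a derivation by a multiple of D_x changes its value on a density
  \<open>D1 * P\<close> only by a total derivative: the commutator term from \<open>D1\<close>
  completes the product rule.\<close>

lemma pr_density:
  assumes R: "R \<in> SS" and P: "P \<in> SS"
  shows "pr R (D1 * P) = D1 * vZ R P + dD (zy * R * P)"
proof -
  define \<eta> where "\<eta> = - (zy * R * iv)"
  have \<eta>: "\<eta> \<in> SS" unfolding \<eta>_def using R by (intro SSV)
  have "vZ R (D1 * P) = vZ R D1 * P + D1 * vZ R P"
    using R P by (intro dv_mult[OF derivation_vZ] SSV)
  moreover have "vZ R D1 = - (dD \<eta> * D1)"
    using vX_D1[OF R \<eta>] vZ_Z[of R] by (simp add: vZ_def \<eta>_def[symmetric])
  moreover have "vZ R (D1 * P) = pr R (D1 * P) + \<eta> * dD (D1 * P)"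
    by (simp add: vZ_def \<eta>_def[symmetric]) (simp add: vX_def)
  ultimately have "pr R (D1 * P) = D1 * vZ R P - (dD \<eta> * (D1 * P) + \<eta> * dD (D1 * P))"
    by (simp add: algebra_simps)
  also have "dD \<eta> * (D1 * P) + \<eta> * dD (D1 * P) = dD (\<eta> * (D1 * P))"
    using \<eta> P by (subst dD_mult) (auto intro!: SSV)
  also have "\<eta> * (D1 * P) = - (zy * R * P)"
  proof -
    have "zy * R * iv * (D1 * P) = zy * R * (iv * (D1 * P))" by (simp add: mult.assoc)
    also have "\<dots> = un * zy * R * P" by (simp add: inverses_mult mult_ac)
    finally show ?thesis by (simp add: un_absorb \<eta>_def)
  qed
  finally show ?thesis using R P by (simp add: dD_uminus SSV)
qed

section \<open>Euler expressions of densities\<close>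

lemma eul_density:
  assumes P: "P \<in> SS" and S: "S \<in> SS"
    and *: "\<And>R. R \<in> SS \<Longrightarrow> \<exists>B\<in>SS. D1 * vZ R P = D1 * ((R * Jc * iv) * S) + dD B"
  shows "eul (D1 * P) = Jc * S"
proof -
  have "eul (D1 * P) = trunc (Jc * S)"
  proof (rule eul_unique)
    show "D1 * P \<in> SS" "Jc * S \<in> SS" using P S by (auto intro: SSV)
    show "\<exists>B\<in>SS. pr R (D1 * P) = R * (Jc * S) + dD B" if R: "R \<in> SS" for R
    proof -
      obtain B where B: "B \<in> SS" "D1 * vZ R P = D1 * ((R * Jc * iv) * S) + dD B"
        using *[OF R] by blast
      \<comment> \<open>The variation of w is R J / D_x zeta; multiplied by the density factor it
        becomes R J, which is how the Jacobian enters.\<close>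
      have "D1 * ((R * Jc * iv) * S) = (D1 * iv) * Jc * R * S" by (simp add: mult_ac)
      also have "\<dots> = (un * Jc) * R * S" by (simp only: inverses)
      also have "\<dots> = R * (Jc * S)" unfolding un_absorb by (simp only: mult_ac)
      finally have "pr R (D1 * P) = R * (Jc * S) + dD (B + zy * R * P)"
        using B R P by (simp add: pr_density dD_add SSV add.assoc)
      moreover have "B + zy * R * P \<in> SS" using B R P by (intro SSV)
      ultimately show ?thesis by blast
    qed
  qed
  then show ?thesis by (simp add: trunc_un mult.assoc[symmetric] un_absorb)
qed

text \<open>The factor \<open>D1\<close> makes d/dz integrable by parts, since
  \<open>D1 * Dz P\<close> is a total derivative in x.\<close>

lemma integrate_by_parts_Dz:
  "A \<in> SS \<Longrightarrow> G \<in> SS \<Longrightarrow> \<exists>B\<in>SS. D1 * ((Dz ^^ k) A * G) = D1 * (A * ((- 1) ^ k * (Dz ^^ k) G)) + dD B"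
proof (induction k arbitrary: G)
  case 0
  show ?case by (rule bexI[of _ 0]) simp_all
next
  case (Suc k)
  then obtain B where B: "B \<in> SS"
    "D1 * ((Dz ^^ k) A * Dz G) = D1 * (A * ((- 1) ^ k * (Dz ^^ k) (Dz G))) + dD B"
    using Dz_SS by blast
  have A: "(Dz ^^ k) A \<in> SS" "(Dz ^^ k) A * G \<in> SS"
    using Suc.prems by (auto intro!: SSV Dz_funpow_SS)
  have "dD ((Dz ^^ k) A * G) = D1 * ((Dz ^^ Suc k) A * G) + D1 * ((Dz ^^ k) A * Dz G)"
    using Suc.prems A by (subst dD_mult) (simp_all add: D1_Dz[symmetric] algebra_simps)
  then have "D1 * ((Dz ^^ Suc k) A * G) = D1 * (A * ((- 1) ^ Suc k * (Dz ^^ Suc k) G)) + dD ((Dz ^^ k) A * G - B)"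
    using B A by (simp add: dD_diff funpow_swap1 algebra_simps)
  with B A show ?case by blast
qed

text \<open>\<open>A\<close> and \<open>K\<close> play the parts of the derivatives of
  \<open>Q\<close> by w and w'. Varying w^(n) gives the first summand, varying w and w' in
  \<open>Q\<close> the other two.\<close>

lemma eul_multiplier:
  assumes Q: "Q \<in> SS" and A: "A \<in> SS" and K: "K \<in> SS"
    and vQ: "\<And>R. R \<in> SS \<Longrightarrow> vZ R Q = A * (R * Jc * iv) + K * Dz (R * Jc * iv)"
  shows "eul (D1 * (Q * W n)) = Jc * ((- 1) ^ n * (Dz ^^ n) Q + A * W n - Dz (K * W n))"
proof (rule eul_density)
  show "Q * W n \<in> SS" using Q by (intro SSV)
  have c: "(- 1 :: dfun) ^ n \<in> SS" by (intro SSV)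
  show "(- 1) ^ n * (Dz ^^ n) Q + A * W n - Dz (K * W n) \<in> SS"
    using Q A K by (intro SSV Dz_funpow_SS)
  fix R assume R: "R \<in> SS"
  define \<rho> where "\<rho> = R * Jc * iv"
  have \<rho>: "\<rho> \<in> SS" unfolding \<rho>_def using R by (intro SSV)
  note vQ' = vQ[OF R, folded \<rho>_def] and vW = vZ_W[OF R, folded \<rho>_def]
  obtain B1 where B1: "B1 \<in> SS" "D1 * ((Dz ^^ n) \<rho> * Q) = D1 * (\<rho> * ((- 1) ^ n * (Dz ^^ n) Q)) + dD B1"
    using integrate_by_parts_Dz[OF \<rho> Q] by blast
  have "K * W n \<in> SS" using K by (intro SSV)
  then obtain B2 where B2: "B2 \<in> SS" "D1 * (Dz \<rho> * (K * W n)) = D1 * (\<rho> * (- Dz (K * W n))) + dD B2"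
    using integrate_by_parts_Dz[OF \<rho>, of "K * W n" 1] by auto
  have "vZ R (Q * W n) = vZ R Q * W n + Q * vZ R (W n)"
    using Q by (intro dv_mult[OF derivation_vZ[OF R]] SSV)
  then have "D1 * vZ R (Q * W n) = D1 * (\<rho> * (A * W n)) + D1 * (Dz \<rho> * (K * W n)) + D1 * ((Dz ^^ n) \<rho> * Q)"
    by (simp add: vQ' vW algebra_simps)
  also have "\<dots> = D1 * (\<rho> * ((- 1) ^ n * (Dz ^^ n) Q + A * W n - Dz (K * W n))) + dD (B1 + B2)"
    using B1 B2 by (simp add: dD_add algebra_simps)
  finally show "\<exists>B\<in>SS. D1 * vZ R (Q * W n) =
      D1 * (R * Jc * iv * ((- 1) ^ n * (Dz ^^ n) Q + A * W n - Dz (K * W n))) + dD B"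
    unfolding \<rho>_def[symmetric] using B1 B2 by blast
qed

text \<open>The square cancels the factor 1/2, and the sign from integrating by parts
  \<open>m\<close> times cancels the sign in the Lagrangian.\<close>

lemma eul_lagrangian: "eul (D1 * (cst ((- 1) ^ m / 2) * (W m)\<^sup>2)) = Jc * W (2 * m)"
proof (rule eul_density)
  show "cst ((- 1) ^ m / 2) * (W m)\<^sup>2 \<in> SS" "W (2 * m) \<in> SS" by (intro SSV)+
  fix R assume R: "R \<in> SS"
  define \<rho> where "\<rho> = R * Jc * iv"
  have \<rho>: "\<rho> \<in> SS" unfolding \<rho>_def using R by (intro SSV)
  note vW = vZ_W[OF R, folded \<rho>_def]
  note V = dv_mult[OF derivation_vZ[OF R]]
  have "cst ((- 1) ^ m) * W m \<in> SS" by (intro SSV)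
  then obtain B where B: "B \<in> SS" "D1 * ((Dz ^^ m) \<rho> * (cst ((- 1) ^ m) * W m)) =
      D1 * (\<rho> * ((- 1) ^ m * (Dz ^^ m) (cst ((- 1) ^ m) * W m))) + dD B"
    using integrate_by_parts_Dz[OF \<rho>, of "cst ((- 1) ^ m) * W m" m] by blast
  have "(- 1) ^ m * (Dz ^^ m) (cst ((- 1) ^ m) * W m) = W (2 * m)"
  proof -
    have "(- 1 :: dfun) ^ m = cst ((- 1) ^ m)" by (simp add: cst_simps)
    moreover have "cst ((- 1) ^ m) * (cst ((- 1) ^ m) * W (m + m)) = W (m + m)"
      by (simp add: cst_simps mult.assoc[symmetric] power_mult_distrib[symmetric])
    ultimately show ?thesis
      by (simp only: dv_funpow_cst_mult[OF derivation_Dz W_SS] Dz_funpow_W mult_2)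
  qed
  moreover have "vZ R (cst ((- 1) ^ m / 2) * (W m)\<^sup>2) = (Dz ^^ m) \<rho> * (cst ((- 1) ^ m) * W m)"
  proof -
    have "vZ R (cst ((- 1) ^ m / 2) * (W m)\<^sup>2) = cst ((- 1) ^ m / 2) * ((Dz ^^ m) \<rho> * W m + W m * (Dz ^^ m) \<rho>)"
      by (simp add: V SSV power2_eq_square vW dv_cst[OF derivation_vZ[OF R]])
    also have "\<dots> = (cst ((- 1) ^ m / 2) + cst ((- 1) ^ m / 2)) * ((Dz ^^ m) \<rho> * W m)"
      by (simp add: algebra_simps)
    also have "cst ((- 1) ^ m / 2) + cst ((- 1) ^ m / 2) = cst ((- 1) ^ m)"
      by (simp add: cst_simps(1)[symmetric])
    finally show ?thesis by (simp add: mult_ac)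
  qed
  ultimately show "\<exists>B\<in>SS. D1 * vZ R (cst ((- 1) ^ m / 2) * (W m)\<^sup>2) = D1 * (R * Jc * iv * W (2 * m)) + dD B"
    unfolding \<rho>_def[symmetric] using B by (intro bexI[of _ B]) simp_all
qed

end

section \<open>Symmetries of the trivial equation and their invariance conditions\<close>

text \<open>The vector fields of \<open>sl(3)\<close> that are symmetries only for \<open>n = 2\<close> have the coefficients
  \<open>C (n + 4)\<close> and \<open>C (n + 5)\<close>.\<close>

definition gf :: "nat \<Rightarrow> (nat \<Rightarrow> real) \<Rightarrow> vfield"
  where "gf n C = (\<lambda>(z, w).
    (C (n + 1) + 2 * C (n + 2) * z - C (n + 3) * z\<^sup>2 + C (n + 4) * w + C (n + 5) * (z * w),
     (\<Sum>k<n. C k * z ^ k) + C n * w + (real n - 1) * (C (n + 2) * w - C (n + 3) * (z * w)) + C (n + 5) * w\<^sup>2))"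

context change_of_vars begin

text \<open>Relatedness of vector fields under the map, written in components, so that no inverse
  map is involved.\<close>

definition related :: "vfield \<Rightarrow> vfield \<Rightarrow> bool"
  where "related v t \<longleftrightarrow> (\<forall>p\<in>\<Omega>. fst (v p) * d1 \<zeta> p + snd (v p) * d2 \<zeta> p = fst (t (\<zeta> p, \<phi> p)) \<and>
    fst (v p) * d1 \<phi> p + snd (v p) * d2 \<phi> p = snd (t (\<zeta> p, \<phi> p)))"

lemma Dz_cong: "trunc P = trunc Q \<Longrightarrow> Dz P = Dz Q"
  unfolding Dz_def using dD_cong by metis

lemmas Dz_rules = dv_add[OF derivation_Dz] dv_diff[OF derivation_Dz] dv_mult[OF derivation_Dz]
  dv_cst[OF derivation_Dz] dv_un[OF derivation_Dz] dv_numeral[OF derivation_Dz] Dz_Z Dz_W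

text \<open>\<open>Xi\<close> and \<open>Psi\<close> below are the components of
  \<open>gf n C\<close> at (z, w), and \<open>Po\<close> is the polynomial part; as ring elements
  they can be subjected to derivations.\<close>

definition Po :: "nat \<Rightarrow> (nat \<Rightarrow> real) \<Rightarrow> dfun" where "Po n C = (\<Sum>k<n. cst (C k) * Z ^ k)"

definition Xi :: "nat \<Rightarrow> (nat \<Rightarrow> real) \<Rightarrow> dfun"
  where "Xi n C = cst (C (n + 1)) + cst (2 * C (n + 2)) * Z - cst (C (n + 3)) * (Z * Z) + cst (C (n + 4)) * W 0 +
    cst (C (n + 5)) * (Z * W 0)"

definition Psi :: "nat \<Rightarrow> (nat \<Rightarrow> real) \<Rightarrow> dfun"
  where "Psi n C = Po n C + cst (C n) * W 0 + cst (real n - 1) * (cst (C (n + 2)) * W 0 - cst (C (n + 3)) * (Z * W 0)) +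
    cst (C (n + 5)) * (W 0 * W 0)"

lemma Po_SS: "Po n C \<in> SS" unfolding Po_def by (intro SSV)
lemma Xi_SS: "Xi n C \<in> SS" unfolding Xi_def by (intro SSV)
lemma Psi_SS: "Psi n C \<in> SS" unfolding Psi_def by (intro SSV Po_SS)

lemma Z_at: "(x, u) \<in> U \<Longrightarrow> Z x u = \<zeta> (x, u 0)"
  and W0_at: "(x, u) \<in> U \<Longrightarrow> W 0 x u = \<phi> (x, u 0)"
  by (simp_all add: Z_def W_def trunc_at lift_def)

lemma gf_at:
  assumes "(x, u) \<in> U"
  shows "Xi n C x u = fst (gf n C (\<zeta> (x, u 0), \<phi> (x, u 0)))" "Psi n C x u = snd (gf n C (\<zeta> (x, u 0), \<phi> (x, u 0)))"
  using assms by (simp_all add: Xi_def Psi_def Po_def gf_def ev Z_at W0_at power2_eq_square)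

lemma Dz_funpow_Po_at:
  assumes "(x, u) \<in> U"
  shows "(Dz ^^ j) (Po n C) x u = (\<Sum>k<n. C k * ff k j * Z x u ^ (k - j))"
proof -
  have e: "(Dz ^^ j) (Z ^ k) x u = ff k j * Z x u ^ (k - j)" for k
  proof -
    have "un * (Dz ^^ j) (Z ^ k) = un * (cst (ff k j) * Z ^ (k - j))"
      by (rule dv_funpow_power[OF derivation_Dz, OF Z_SS Dz_Z])
    from un_cancel[OF this assms] show ?thesis by (simp add: ev)
  qed
  have "(Dz ^^ j) (Po n C) = (\<Sum>k<n. cst (C k) * (Dz ^^ j) (Z ^ k))"
    unfolding Po_def using Z_SS
    by (subst dv_funpow_sum[OF derivation_Dz])
      (auto intro!: SSV simp: dv_funpow_cst_mult[OF derivation_Dz] SS_power)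
  then have "(Dz ^^ j) (Po n C) x u = (\<Sum>k<n. C k * (Dz ^^ j) (Z ^ k) x u)"
    by (simp only: fun2_apply times_fun_apply cst_apply)
  then show ?thesis by (simp only: e mult.assoc)
qed

lemma Dz_funpow_Po_0: "(x, u) \<in> U \<Longrightarrow> n \<le> j \<Longrightarrow> (Dz ^^ j) (Po n C) x u = 0"
  by (simp add: Dz_funpow_Po_at ff_eq_0)

lemma Dz_Xi: "Dz (Xi n C) = cst (2 * C (n + 2)) * un - cst (C (n + 3)) * (un * Z + Z * un) +
    cst (C (n + 4)) * W 1 + cst (C (n + 5)) * (un * W 0 + Z * W 1)"
  unfolding Xi_def by (simp add: Dz_rules SSV)

lemma Dz_Xi_at: "(x, u) \<in> U \<Longrightarrow> Dz (Xi n C) x u = 2 * C (n + 2) - 2 * C (n + 3) * Z x u +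
    C (n + 4) * W 1 x u + C (n + 5) * (W 0 x u + Z x u * W 1 x u)"
  unfolding Dz_Xi by (simp add: ev un_at)

text \<open>The factor by which the prolongation multiplies w^(n). Its coefficients come from n - 1
  - 2n = -(n + 1); the term with \<open>W 1\<close> belongs to the two fields that are special to n
  = 2.\<close>

definition lam :: "nat \<Rightarrow> (nat \<Rightarrow> real) \<Rightarrow> dfun"
  where "lam n C = (\<lambda>x u. C n - (real n + 1) * C (n + 2) + (real n + 1) * C (n + 3) * Z x u
    - 3 * (C (n + 4) + C (n + 5) * Z x u) * W 1 x u)"

text \<open>Here \<open>vX R \<eta>\<close> is the prolongation of a vector field related to \<open>gf n C\<close>.\<close>

context
  fixes R \<eta> n C
  assumes R: "R \<in> SS" and \<eta>: "\<eta> \<in> SS"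
    and XZ: "trunc (vX R \<eta> Z) = trunc (Xi n C)" and XW0: "trunc (vX R \<eta> (W 0)) = trunc (Psi n C)"
begin

lemma vX_W_Suc_Xi: "vX R \<eta> (W (Suc k)) = Dz (vX R \<eta> (W k)) - W (Suc k) * Dz (Xi n C)"
  using vX_W_Suc[OF R \<eta>, of k] Dz_cong[OF XZ] by simp

text \<open>Each step lowers the weight n - 1 - 2j by 2, and j (n - j) is the sum of these weights
  over all smaller indices. At j = n it is zero, so w^(n-1) drops out.\<close>

lemma vX_W:
  assumes "C (n + 4) = 0" "C (n + 5) = 0"
  shows "trunc (vX R \<eta> (W j)) = trunc ((Dz ^^ j) (Po n C) + cst (C n + C (n + 2) * (real n - 1 - 2 * real j)) * W j -
    cst (C (n + 3) * (real n - 1 - 2 * real j)) * (Z * W j) - cst (C (n + 3) * (real j * (real n - real j))) * W (j - 1))"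
proof (induction j)
  case 0
  show ?case unfolding XW0 unfolding trunc_eq_iff
    by (simp add: Psi_def ev assms algebra_simps)
next
  case (Suc j)
  let ?a = "C n + C (n + 2) * (real n - 1 - 2 * real j)" and ?b = "C (n + 3) * (real n - 1 - 2 * real j)"
    and ?e = "C (n + 3) * (real j * (real n - real j))"
  have p: "(Dz ^^ j) (Po n C) \<in> SS" by (rule Dz_funpow_SS[OF Po_SS])
  have "Dz (vX R \<eta> (W j)) = Dz ((Dz ^^ j) (Po n C)) + cst ?a * W (Suc j) - cst ?b * (un * W j + Z * W (Suc j))
      - cst ?e * W (Suc (j - 1))"
    unfolding Dz_cong[OF Suc.IH] by (simp add: Dz_rules SSV p)
  \<comment> \<open>For \<open>j = 0\<close> the truncated index is wrong, but the coefficient is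
    zero.\<close>
  moreover have "cst ?e * W (Suc (j - 1)) = cst ?e * W j"
    by (cases j) (simp_all add: cst_simps)
  ultimately have "vX R \<eta> (W (Suc j)) = (Dz ^^ Suc j) (Po n C) + cst ?a * W (Suc j) - cst ?b * (un * W j + Z * W (Suc j))
      - cst ?e * W j - W (Suc j) * Dz (Xi n C)"
    unfolding vX_W_Suc_Xi by simp
  then have "vX R \<eta> (W (Suc j)) x u = ((Dz ^^ Suc j) (Po n C)) x u + ?a * W (Suc j) x u - ?b * (W j x u + Z x u * W (Suc j) x u)
      - ?e * W j x u - W (Suc j) x u * Dz (Xi n C) x u" if "(x, u) \<in> U" for x u
    using un_at[OF that] by (simp only: plus_fun_apply minus_apply times_fun_apply cst_apply mult_1)
  then show ?case
    unfolding trunc_eq_iff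
    by (simp add: plus_fun_apply minus_apply times_fun_apply cst_apply Dz_Xi_at assms)
      (simp add: algebra_simps)
qed

text \<open>All coefficients are kept here: for n = 2 this is the last step before w^(n), and it is
  also the coefficient that the variational condition needs when m = 1.\<close>

lemma vX_W1: "trunc (vX R \<eta> (W 1)) = trunc (Dz (Po n C) + cst (C n) * W 1 +
    cst (real n - 1) * (cst (C (n + 2)) * W 1 - cst (C (n + 3)) * (W 0 + Z * W 1)) + cst (2 * C (n + 5)) * (W 0 * W 1) -
    W 1 * (cst (2 * C (n + 2)) - cst (2 * C (n + 3)) * Z + cst (C (n + 4)) * W 1 + cst (C (n + 5)) * (W 0 + Z * W 1)))"
proof -
  have "Dz (vX R \<eta> (W 0)) = Dz (Po n C) + cst (C n) * W 1 +
    cst (real n - 1) * (cst (C (n + 2)) * W 1 - cst (C (n + 3)) * (un * W 0 + Z * W 1)) + cst (C (n + 5)) * (W 1 * W 0 + W 0 * W 1)"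
    unfolding Dz_cong[OF XW0] Psi_def by (simp add: Dz_rules SSV Po_SS)
  then have "vX R \<eta> (W 1) = Dz (Po n C) + cst (C n) * W 1 +
    cst (real n - 1) * (cst (C (n + 2)) * W 1 - cst (C (n + 3)) * (un * W 0 + Z * W 1)) + cst (C (n + 5)) * (W 1 * W 0 + W 0 * W 1)
    - W 1 * Dz (Xi n C)"
    using vX_W_Suc_Xi[of 0] by simp
  then have "vX R \<eta> (W 1) x u = Dz (Po n C) x u + C n * W 1 x u +
    (real n - 1) * (C (n + 2) * W 1 x u - C (n + 3) * (W 0 x u + Z x u * W 1 x u)) + C (n + 5) * (W 1 x u * W 0 x u + W 0 x u * W 1 x u)
    - W 1 x u * Dz (Xi n C) x u" if "(x, u) \<in> U" for x u
    using un_at[OF that] by (simp only: plus_fun_apply minus_apply times_fun_apply cst_apply mult_1)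
  then show ?thesis
    unfolding trunc_eq_iff
    by (simp add: plus_fun_apply minus_apply times_fun_apply cst_apply Dz_Xi_at algebra_simps)
qed

lemma vX_Wn:
  assumes adm: "n = 2 \<or> C (n + 4) = 0 \<and> C (n + 5) = 0" and q: "(x, u) \<in> U"
  shows "vX R \<eta> (W n) x u = lam n C x u * W n x u"
proof (cases "C (n + 4) = 0 \<and> C (n + 5) = 0")
  case True
  then have "trunc (vX R \<eta> (W n)) x u = trunc ((Dz ^^ n) (Po n C) + cst (C n + C (n + 2) * (real n - 1 - 2 * real n)) * W n -
    cst (C (n + 3) * (real n - 1 - 2 * real n)) * (Z * W n) - cst (C (n + 3) * (real n * (real n - real n))) * W (n - 1)) x u"
    using vX_W[of n] by simp
  then have "vX R \<eta> (W n) x u = (C n + C (n + 2) * (real n - 1 - 2 * real n)) * W n x u -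
    C (n + 3) * (real n - 1 - 2 * real n) * (Z x u * W n x u)"
    unfolding trunc_at[OF q] plus_fun_apply minus_apply times_fun_apply cst_apply Dz_funpow_Po_0[OF q order_refl] by simp
  then show ?thesis using True by (simp add: lam_def algebra_simps)
next
  case False
  with adm have n: "n = 2" by blast
  have p: "Dz (Po n C) \<in> SS" by (intro SSV Po_SS)
  have "Dz (vX R \<eta> (W 1)) = Dz (Dz (Po n C)) + cst (C n) * W 2 +
    cst (real n - 1) * (cst (C (n + 2)) * W 2 - cst (C (n + 3)) * (W 1 + (un * W 1 + Z * W 2))) +
    cst (2 * C (n + 5)) * (W 1 * W 1 + W 0 * W 2) -
    (W 2 * (cst (2 * C (n + 2)) - cst (2 * C (n + 3)) * Z + cst (C (n + 4)) * W 1 + cst (C (n + 5)) * (W 0 + Z * W 1)) +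
     W 1 * (- (cst (2 * C (n + 3)) * un) + cst (C (n + 4)) * W 2 + cst (C (n + 5)) * (W 1 + (un * W 1 + Z * W 2))))"
    unfolding Dz_cong[OF vX_W1] by (simp add: Dz_rules SSV p numeral_2_eq_2)
  moreover have "vX R \<eta> (W 2) = Dz (vX R \<eta> (W 1)) - W 2 * Dz (Xi n C)"
    using vX_W_Suc_Xi[of 1] by (simp add: numeral_2_eq_2)
  moreover have "Dz (Dz (Po n C)) x u = 0"
    using Dz_funpow_Po_0[OF q, of n 2 C] n by (simp add: numeral_2_eq_2)
  ultimately have "vX R \<eta> (W 2) x u = C n * W 2 x u +
    (real n - 1) * (C (n + 2) * W 2 x u - C (n + 3) * (W 1 x u + (W 1 x u + Z x u * W 2 x u))) +
    2 * C (n + 5) * (W 1 x u * W 1 x u + W 0 x u * W 2 x u) -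
    (W 2 x u * (2 * C (n + 2) - 2 * C (n + 3) * Z x u + C (n + 4) * W 1 x u + C (n + 5) * (W 0 x u + Z x u * W 1 x u)) +
     W 1 x u * (- (2 * C (n + 3)) + C (n + 4) * W 2 x u + C (n + 5) * (W 1 x u + (W 1 x u + Z x u * W 2 x u)))) -
    W 2 x u * Dz (Xi n C) x u"
    using un_at[OF q] by (simp only: plus_fun_apply minus_apply uminus_apply times_fun_apply cst_apply mult_1 mult_1_right add_0)
  then show ?thesis
    unfolding n using q by (simp add: Dz_Xi_at lam_def algebra_simps)
qed

text \<open>The characteristic psi - xi w' is differentiated along z; the known action on w^(n)
  thereby yields the term (-d/dz)^n Q' of the Euler expression.\<close>

lemma Dz_funpow_multiplier:
  "trunc ((Dz ^^ j) (Psi n C - Xi n C * W 1)) = trunc (vX R \<eta> (W j) - Xi n C * W (Suc j))"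
proof (induction j)
  case 0
  then show ?case using XW0 by (simp add: trunc_un right_diff_distrib)
next
  case (Suc j)
  have v: "vX R \<eta> (W j) \<in> SS" by (rule dv_SS[OF derivation_vX[OF R \<eta>] W_SS])
  have "(Dz ^^ Suc j) (Psi n C - Xi n C * W 1) = Dz (vX R \<eta> (W j) - Xi n C * W (Suc j))"
    using Dz_cong[OF Suc] by simp
  also have "\<dots> = vX R \<eta> (W (Suc j)) - Xi n C * W (Suc (Suc j))"
    unfolding vX_W_Suc_Xi by (simp add: Dz_rules SSV v Xi_SS)
  finally show ?case by simp
qed

end

section \<open>Euler expression of the characteristic times w^(n)\<close>

lemma vZ_Po:
  assumes "R \<in> SS"
  shows "vZ R (Po n C) = 0"
proof -
  note r = derivation_vZ[OF assms]
  have "vZ R (Z ^ k) = 0" for k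
    by (induction k) (simp_all add: dv_numeral[OF r] dv_mult[OF r] SSV vZ_Z)
  then show ?thesis unfolding Po_def
    by (subst dv_sum[OF r]) (auto intro!: SSV sum.neutral simp: dv_mult[OF r] dv_cst[OF r] SS_power Z_SS)
qed

text \<open>Provides the two coefficients required by \<open>eul_multiplier\<close>: the derivative
  of psi - xi w' by w, and its derivative -xi by w'.\<close>

lemma vZ_multiplier:
  assumes "R \<in> SS"
  shows "vZ R (Psi n C - Xi n C * W 1) =
    (cst (C n) + cst (real n - 1) * (cst (C (n + 2)) - cst (C (n + 3)) * Z) + cst (2 * C (n + 5)) * W 0 -
      (cst (C (n + 4)) + cst (C (n + 5)) * Z) * W 1) * (R * Jc * iv) + (- Xi n C) * Dz (R * Jc * iv)"
proof -
  note r = derivation_vZ[OF assms]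
  have W: "vZ R (W 0) = R * Jc * iv" "vZ R (W 1) = Dz (R * Jc * iv)"
    using vZ_W[OF assms, of 0] vZ_W[OF assms, of 1] by simp_all
  have 2: "cst (2 * C (n + 5)) = cst (C (n + 5)) + cst (C (n + 5))"
    by (simp add: cst_simps(1)[symmetric])
  define \<rho> where "\<rho> = R * Jc * iv"
  have X: "vZ R (Xi n C) = cst (C (n + 4)) * \<rho> + cst (C (n + 5)) * (Z * \<rho>)"
    unfolding Xi_def by (simp add: dv_add[OF r] dv_diff[OF r] dv_mult[OF r] dv_cst[OF r] vZ_Z SSV W \<rho>_def[symmetric])
  have P: "vZ R (Psi n C) = cst (C n) * \<rho> + cst (real n - 1) * (cst (C (n + 2)) * \<rho> - cst (C (n + 3)) * (Z * \<rho>)) +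
    cst (C (n + 5)) * (\<rho> * W 0 + W 0 * \<rho>)"
    unfolding Psi_def by (simp add: dv_add[OF r] dv_diff[OF r] dv_mult[OF r] dv_cst[OF r] vZ_Z vZ_Po[OF assms] SSV Po_SS W \<rho>_def[symmetric])
  have "vZ R (Psi n C - Xi n C * W 1) = vZ R (Psi n C) - (vZ R (Xi n C) * W 1 + Xi n C * vZ R (W 1))"
    by (simp add: dv_diff[OF r] dv_mult[OF r] SSV Psi_SS Xi_SS)
  then show ?thesis
    unfolding \<rho>_def[symmetric] X P W(2)[folded \<rho>_def] 2 by (simp add: algebra_simps)
qed

text \<open>The Euler expression of Q' w^(n) D_x zeta, divided by the Jacobian. The two occurrences
  of xi w^(n+1), from (-d/dz)^n Q' and from the derivative of xi w^(n), cancel exactly when n is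
  even.\<close>

definition Ehat :: "nat \<Rightarrow> (nat \<Rightarrow> real) \<Rightarrow> dfun"
  where "Ehat n C = (\<lambda>x u. (1 - (- 1) ^ n) * Xi n C x u * W (Suc n) x u + ((- 1) ^ n * lam n C x u +
    C n + (real n + 1) * C (n + 2) - (real n + 1) * C (n + 3) * Z x u + 3 * C (n + 5) * W 0 x u) * W n x u)"

lemma eul_multiplier_gf:
  assumes R: "R \<in> SS" "\<eta> \<in> SS"
    and X: "trunc (vX R \<eta> Z) = trunc (Xi n C)" "trunc (vX R \<eta> (W 0)) = trunc (Psi n C)"
    and adm: "n = 2 \<or> C (n + 4) = 0 \<and> C (n + 5) = 0" and q: "(x, u) \<in> U"
  shows "eul (D1 * ((Psi n C - Xi n C * W 1) * W n)) x u = Jc x u * Ehat n C x u"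
proof -
  let ?A = "cst (C n) + cst (real n - 1) * (cst (C (n + 2)) - cst (C (n + 3)) * Z) + cst (2 * C (n + 5)) * W 0 -
      (cst (C (n + 4)) + cst (C (n + 5)) * Z) * W 1"
  have SS: "Psi n C - Xi n C * W 1 \<in> SS" "?A \<in> SS" "- Xi n C \<in> SS" by (intro SSV Psi_SS Xi_SS)+
  have "Dz (- Xi n C * W n) = - (Dz (Xi n C) * W n + Xi n C * W (Suc n))"
    by (simp add: Dz_rules dv_uminus[OF derivation_Dz] SSV Xi_SS)
  moreover have "eul (D1 * ((Psi n C - Xi n C * W 1) * W n)) =
      Jc * ((- 1) ^ n * (Dz ^^ n) (Psi n C - Xi n C * W 1) + ?A * W n - Dz (- Xi n C * W n))"
    by (rule eul_multiplier[OF SS vZ_multiplier])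
  ultimately have "eul (D1 * ((Psi n C - Xi n C * W 1) * W n)) =
      Jc * ((- 1) ^ n * (Dz ^^ n) (Psi n C - Xi n C * W 1) + ?A * W n + (Dz (Xi n C) * W n + Xi n C * W (Suc n)))"
    by (simp only: diff_minus_eq_add)
  then have "eul (D1 * ((Psi n C - Xi n C * W 1) * W n)) x u =
      Jc x u * ((- 1) ^ n * (Dz ^^ n) (Psi n C - Xi n C * W 1) x u + ?A x u * W n x u + (Dz (Xi n C) x u * W n x u + Xi n C x u * W (Suc n) x u))"
    by (simp only: plus_fun_apply times_fun_apply fun2_apply uminus_apply one_fun_apply)
  also have "(Dz ^^ n) (Psi n C - Xi n C * W 1) x u = vX R \<eta> (W n) x u - Xi n C x u * W (Suc n) x u"
  proof -
    have "(Dz ^^ n) (Psi n C - Xi n C * W 1) x u = (vX R \<eta> (W n) - Xi n C * W (Suc n)) x u"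
      using Dz_funpow_multiplier[OF R X, of n] q unfolding trunc_eq_iff by blast
    then show ?thesis by (simp only: minus_apply times_fun_apply)
  qed
  also have "vX R \<eta> (W n) x u = lam n C x u * W n x u" by (rule vX_Wn[OF R X adm q])
  also have "?A x u = C n + (real n - 1) * (C (n + 2) - C (n + 3) * Z x u) + 2 * C (n + 5) * W 0 x u -
      (C (n + 4) + C (n + 5) * Z x u) * W 1 x u"
    by (simp only: plus_fun_apply minus_apply times_fun_apply cst_apply)
  finally show ?thesis
    using q by (simp add: Dz_Xi_at Ehat_def algebra_simps)
qed

section \<open>Partial derivatives with respect to w^(j) at a jet\<close>

definition wR :: "nat \<Rightarrow> real \<Rightarrow> (nat \<Rightarrow> real) \<Rightarrow> dfun"
  where "wR j x u = cst (1 / fact j) * (Z - cst (Z x u)) ^ j * (D1 * iJ)"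

text \<open>The derivative with respect to \<open>w\<^bsup>(j)\<^esup>\<close> at a jet, obtained as the derivation with
  \<open>R J / D\<^sub>x \<zeta> = (z - z\<^sub>0)\<^bsup>j\<^esup> / j!\<close>.\<close>

definition wd :: "nat \<Rightarrow> real \<Rightarrow> (nat \<Rightarrow> real) \<Rightarrow> dfun \<Rightarrow> real"
  where "wd j x u P = vZ (wR j x u) P x u"

lemma wR_SS: "wR j x u \<in> SS"
  unfolding wR_def by (intro SSV)

lemma wd_add: "P \<in> SS \<Longrightarrow> Q \<in> SS \<Longrightarrow> wd j x u (P + Q) = wd j x u P + wd j x u Q"
  unfolding wd_def dv_add[OF derivation_vZ[OF wR_SS]] by (simp only: plus_fun_apply)

lemma wd_diff: "P \<in> SS \<Longrightarrow> Q \<in> SS \<Longrightarrow> wd j x u (P - Q) = wd j x u P - wd j x u Q"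
  unfolding wd_def dv_diff[OF derivation_vZ[OF wR_SS]] by (simp only: minus_apply)

lemma wd_mult: "P \<in> SS \<Longrightarrow> Q \<in> SS \<Longrightarrow> wd j x u (P * Q) = wd j x u P * Q x u + P x u * wd j x u Q"
  unfolding wd_def dv_mult[OF derivation_vZ[OF wR_SS]] by (simp only: plus_fun_apply times_fun_apply)

lemma wd_cst: "wd j x u (cst c) = 0"
  by (simp add: wd_def dv_cst[OF derivation_vZ[OF wR_SS]] zero_fun_apply)

lemma wd_Z: "wd j x u Z = 0"
  by (simp add: wd_def vZ_Z zero_fun_apply)

lemma wd_cong: "trunc P = trunc Q \<Longrightarrow> wd j x u P = wd j x u Q"
  unfolding wd_def vZ_def by (simp only: vX_cong[of P Q])

lemma wd_sum: "(\<And>k. k \<in> A \<Longrightarrow> P k \<in> SS) \<Longrightarrow> wd j x u (\<Sum>k\<in>A. P k) = (\<Sum>k\<in>A. wd j x u (P k))"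
  unfolding wd_def by (subst dv_sum[OF derivation_vZ[OF wR_SS]]) (simp_all add: fun2_apply)

lemma wd_Z_power: "wd j x u (Z ^ k) = 0"
proof (induction k)
  case 0
  have "(1 :: dfun) = cst 1" by (simp add: cst_simps)
  then show ?case using wd_cst by (metis power_0)
qed (simp add: wd_mult wd_Z SSV)

text \<open>At a jet, \<open>wd\<close> is a linear combination of the partial derivatives there.
  This carries vanishing differentials over to the coordinates w^(j).\<close>

lemma wd_eq_0:
  assumes P: "P \<in> SS" and 0: "\<And>i. dT i P x u = 0"
  shows "wd j x u P = 0"
proof -
  obtain m where m: "sm m P" using P by (auto simp: SS_def)
  show ?thesis
    unfolding wd_def vZ_def vX_def pr_eq[OF m] dD_eq[OF m]
    by (simp only: plus_fun_apply times_fun_apply fun2_apply 0 mult_zero_right sum.neutral_const add_0)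
qed

text \<open>The k-th derivative of (z - z0)^j / j! at z0 is 1 for k = j and 0 otherwise; in this
  sense the w^(k) behave as independent coordinates.\<close>

lemma wd_W:
  assumes q: "(x, u) \<in> U"
  shows "wd j x u (W k) = (if k = j then 1 else 0)"
proof -
  define t where "t = Z - cst (Z x u)"
  have t: "t \<in> SS" "Dz t = un" unfolding t_def by (auto intro!: SSV simp: Dz_rules SSV)
  define R where "R = wR j x u"
  have R: "R \<in> SS" unfolding R_def by (rule wR_SS)
  have \<rho>: "R * Jc * iv = un * (cst (1 / fact j) * t ^ j)"
  proof -
    have "R * Jc * iv = cst (1 / fact j) * t ^ j * ((D1 * iv) * (iJ * Jc))"
      unfolding R_def wR_def t_def by (simp only: mult_ac)
    then show ?thesis by (simp add: inverses mult_ac)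
  qed
  have "un * (Dz ^^ k) (un * P) = un * (Dz ^^ k) P" if "P \<in> SS" for P
    using that by (induction k) (simp_all add: Dz_rules dv_funpow_SS[OF derivation_Dz] un_absorb Dz_cong[of "(Dz ^^ _) (un * P)" "(Dz ^^ _) P"] trunc_un)
  moreover have "cst (1 / fact j) * t ^ j \<in> SS" using t by (intro SSV)
  ultimately have "un * (Dz ^^ k) (R * Jc * iv) = un * (Dz ^^ k) (cst (1 / fact j) * t ^ j)"
    unfolding \<rho> by blast
  also have "\<dots> = cst (1 / fact j) * (un * (Dz ^^ k) (t ^ j))"
    using t by (simp add: dv_funpow_cst_mult[OF derivation_Dz] SS_power mult.left_commute)
  also have "un * (Dz ^^ k) (t ^ j) = un * (cst (ff j k) * t ^ (j - k))"
    by (rule dv_funpow_power[OF derivation_Dz, OF t])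
  finally have "un * (Dz ^^ k) (R * Jc * iv) = un * (cst (1 / fact j) * (cst (ff j k) * t ^ (j - k)))"
    by (simp add: mult.left_commute)
  from un_cancel[OF this q] have "vZ R (W k) x u = (cst (1 / fact j) * (cst (ff j k) * t ^ (j - k))) x u"
    by (simp only: vZ_W[OF R])
  also have "\<dots> = 1 / fact j * (ff j k * 0 ^ (j - k))"
    by (simp add: t_def ev)
  also have "\<dots> = (if k = j then 1 else 0)"
    using ff_eq_0[of j k] ff_fact[of j j] by (auto simp: power_0_left)
  finally show ?thesis by (simp only: wd_def R_def)
qed

end

lemma lift_at: "lift g x u = g (x, u 0)"
  by (simp add: lift_def)

context jet_domain begin

lemma eul_cong:
  assumes "P \<in> SS" "trunc P = trunc Q"
  shows "eul P = eul Q"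
proof -
  obtain m where m: "sm m P" using assms by (auto simp: SS_def)
  then have "sm m Q" using assms(2) sm_trunc by metis
  then show ?thesis using m dT_cong[OF assms(2)] by (simp add: eul_eq)
qed

lemma eul_cst_mult:
  assumes "P \<in> SS"
  shows "eul (cst c * P) = cst c * eul P"
proof -
  obtain m where m: "sm m P" using assms by (auto simp: SS_def)
  have "du k (cst c * P) = cst c * du k P" for k
    by (simp add: dT_mult sd_cst sm_sd[OF m])
  moreover have "(dD ^^ k) (cst c * du k P) = cst c * (dD ^^ k) (du k P)" for k
    using assms by (intro dv_funpow_cst_mult[OF derivation_dD] SSI)
  ultimately show ?thesis
    by (simp add: eul_eq[OF m] eul_eq[OF sm_mult[OF sm_cst m]] sum_distrib_left mult.left_commute)
qed

end

section \<open>Polynomials with infinitely many zeros\<close>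

lemma polynomial_vanishes:
  fixes c :: "nat \<Rightarrow> real"
  assumes "infinite A" "\<And>z. z \<in> A \<Longrightarrow> (\<Sum>i\<le>N. c i * z ^ i) = 0" "i \<le> N"
  shows "c i = 0"
proof (rule ccontr)
  assume "c i \<noteq> 0"
  then have "finite {z. (\<Sum>i\<le>N. c i * z ^ i) = 0}"
    using Transcendental.polyfun_finite_roots[where c = c and n = N] assms(3) by blast
  moreover have "A \<subseteq> {z. (\<Sum>i\<le>N. c i * z ^ i) = 0}" using assms(2) by auto
  ultimately show False using assms(1) finite_subset by blast
qed

lemma quadratic_vanishes:
  fixes c0 c1 c2 :: real
  assumes "infinite A" "\<And>z. z \<in> A \<Longrightarrow> c0 + c1 * z + c2 * z\<^sup>2 = 0"
  shows "c0 = 0" "c1 = 0" "c2 = 0"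
proof -
  define c where "c i = (if i = 0 then c0 else if i = 1 then c1 else c2)" for i :: nat
  have "(\<Sum>i\<le>2. c i * z ^ i) = 0" if "z \<in> A" for z
    using assms(2)[OF that] by (simp add: c_def numeral_2_eq_2)
  from polynomial_vanishes[OF assms(1) this] have "c 0 = 0" "c 1 = 0" "c 2 = 0" by auto
  then show "c0 = 0" "c1 = 0" "c2 = 0" by (simp_all add: c_def)
qed

context change_of_vars begin

lemma jacobian_at: "(x, u) \<in> U \<Longrightarrow> jacobian \<zeta> \<phi> x u = Jc x u"
  using dT_at[of x u 0 "lift \<zeta>"] dT_at[of x u 1 "lift \<zeta>"] dT_at[of x u 0 "lift \<phi>"] dT_at[of x u 1 "lift \<phi>"]
  by (simp add: jacobian_def Jc_at jac_def dT_lift smooth_\<zeta> smooth_\<phi> trunc_at lift_at)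

lemma w_deriv_at: "(x, u) \<in> U \<Longrightarrow> w_deriv \<zeta> \<phi> k x u = W k x u"
  by (simp add: W_def trunc_at)

text \<open>The slope y' is 0 if zeta_x is nonzero; otherwise the Jacobian forces zeta_y to be
  nonzero, and the slope 1 is regular.\<close>

lemma ex_regular_jet:
  assumes p: "p \<in> \<Omega>"
  shows "\<exists>u. (fst p, u) \<in> U \<and> u 0 = snd p"
proof -
  interpret J: jets_above "jets_over \<Omega>" \<Omega>
    by unfold_locales (simp_all add: open_base open_jets_over)
  define u :: "nat \<Rightarrow> real" where "u k = (if k = 0 then snd p else if d1 \<zeta> p = 0 then 1 else 0)" for k
  have q: "(fst p, u) \<in> jets_over \<Omega>" using p by (simp add: jets_over_def u_def)
  have "Dx (lift \<zeta>) (fst p) u = J.dD (lift \<zeta>) (fst p) u" using q by (simp add: J.dD_at)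
  also have "\<dots> = d1 \<zeta> p + u 1 * d2 \<zeta> p"
    using q by (simp add: J.dD_lift[OF smooth_\<zeta>] ev J.un_at lift_at u_def)
  also have "\<dots> \<noteq> 0" using jac_nonzero[OF p] by (auto simp: u_def)
  finally show ?thesis using q by (intro exI[of _ u]) (simp add: regular_jets_def u_def)
qed

section \<open>Prolongation of a field related to a symmetry of the trivial equation\<close>

context
  fixes v :: vfield
  assumes smooth_v: "smooth_on \<Omega> v"
begin

definition ch where "ch = characteristic v"
definition xl where "xl = lift (\<lambda>p. fst (v p))"

lemma smooth_components: "smooth_on \<Omega> (\<lambda>p. fst (v p))" "smooth_on \<Omega> (\<lambda>p. snd (v p))"
  using smooth_on_linear_compose[OF open_base _ smooth_v] bounded_linear_fst bounded_linear_snd by blast+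

lemma xl_SS: "xl \<in> SS" unfolding xl_def by (intro SS_lift smooth_components)

lemma ch_eq: "ch = lift (\<lambda>p. snd (v p)) - xl * cu 1"
  by (simp add: ch_def characteristic_def xl_def lift_def fun_eq_iff ev)

lemma ch_SS: "ch \<in> SS" unfolding ch_eq by (intro SSI SS_lift smooth_components xl_SS)

text \<open>The terms with y' cancel between the characteristic and xi D_x, leaving the action of
  \<open>v\<close> on functions of the base point.\<close>

lemma vX_lift:
  assumes g: "smooth_on \<Omega> g"
  shows "trunc (vX ch xl (trunc (lift g))) = trunc (lift (\<lambda>p. fst (v p) * d1 g p + snd (v p) * d2 g p))"
proof -
  have *: "vX ch xl (trunc (lift g)) = ch * trunc (lift (d2 g)) + xl * (un * (lift (d1 g) + cu 1 * lift (d2 g)))"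
    by (simp add: vX_def pr_lift[OF g] dD_lift[OF g])
  show ?thesis
    unfolding * by (simp add: trunc_eq_iff ch_eq xl_def ev trunc_at un_at lift_at algebra_simps)
qed

lemma prolong_vX: "P \<in> SS \<Longrightarrow> (x, u) \<in> U \<Longrightarrow> prolong v P x u = vX ch xl P x u"
  unfolding ch_def xl_def by (rule prolong_at)

context
  fixes n C
  assumes rel: "related v (gf n C)" and adm: "n = 2 \<or> C (n + 4) = 0 \<and> C (n + 5) = 0"
begin

lemma vX_Z_gf: "trunc (vX ch xl Z) = trunc (Xi n C)"
  unfolding Z_def vX_lift[OF smooth_\<zeta>] trunc_eq_iff
  using rel base_point by (auto simp: gf_at lift_at related_def)

lemma vX_W0_gf: "trunc (vX ch xl (W 0)) = trunc (Psi n C)"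
  unfolding W0_eq vX_lift[OF smooth_\<phi>] trunc_eq_iff
  using rel base_point by (auto simp: gf_at lift_at related_def)

text \<open>Multiplied by D_x zeta, w' becomes D_x phi. The right side is then a determinant in the
  images of \<open>v\<close> and of (1, y') under the derivative of the map, hence J times the
  determinant of the two vectors, which is the characteristic.\<close>

lemma ch_Jc_at:
  assumes q: "(x, u) \<in> U"
  shows "ch x u * Jc x u = (Psi n C x u - Xi n C x u * W 1 x u) * D1 x u"
proof -
  let ?p = "(x, u 0)"
  have p: "?p \<in> \<Omega>" using base_point[OF q] .
  have X: "Xi n C x u = fst (v ?p) * d1 \<zeta> ?p + snd (v ?p) * d2 \<zeta> ?p"
    "Psi n C x u = fst (v ?p) * d1 \<phi> ?p + snd (v ?p) * d2 \<phi> ?p"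
    using rel p unfolding gf_at[OF q] related_def by auto
  have D: "D1 x u = d1 \<zeta> ?p + u 1 * d2 \<zeta> ?p"
    using q by (simp add: D1_def Z_def dD_lift smooth_\<zeta> ev un_at lift_at)
  have "dD (W 0) x u = d1 \<phi> ?p + u 1 * d2 \<phi> ?p"
    using q by (simp add: W0_eq dD_lift smooth_\<phi> ev un_at lift_at)
  moreover have "dD (W 0) x u = D1 x u * W 1 x u"
    using D1_Dz[of "W 0"] Dz_W[of 0] by (metis One_nat_def times_fun_apply)
  ultimately have W: "W 1 x u * D1 x u = d1 \<phi> ?p + u 1 * d2 \<phi> ?p" by (simp add: mult.commute)
  have "(Psi n C x u - Xi n C x u * W 1 x u) * D1 x u = Psi n C x u * D1 x u - Xi n C x u * (W 1 x u * D1 x u)"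
    by (simp add: algebra_simps)
  then show ?thesis
    unfolding W unfolding D X by (simp add: ch_eq xl_def ev lift_at Jc_at[OF q] jac_def algebra_simps)
qed

context
  fixes \<Delta> c
  assumes \<Delta>: "trunc \<Delta> = trunc (cst c * (Jc * W n))"
begin

lemma Delta_SS: "\<Delta> \<in> SS"
  using SS_trunc[of \<Delta>] unfolding \<Delta> by (simp add: SSV)

text \<open>The prolongation of J w^(n) is again divisible by w^(n), and w^(n) vanishes with
  \<open>\<Delta>\<close> because J and \<open>c\<close> are nonzero.\<close>

lemma prolong_Delta:
  assumes c: "c \<noteq> 0" and q: "(x, u) \<in> U" and 0: "\<Delta> x u = 0"
  shows "prolong v \<Delta> x u = 0"
proof -
  have "W n x u = 0"
    using \<Delta> q 0 c Jc_nonzero[OF q] unfolding trunc_eq_iff by (auto simp: ev)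
  moreover have "prolong v \<Delta> x u = vX ch xl (cst c * (Jc * W n)) x u"
    unfolding prolong_vX[OF Delta_SS q] using vX_cong[OF \<Delta>] by simp
  moreover have "vX ch xl (cst c * (Jc * W n)) = cst c * (vX ch xl Jc * W n + Jc * vX ch xl (W n))"
    using derivation_vX[OF ch_SS xl_SS] by (simp add: dv_mult dv_cst SSV)
  moreover have "vX ch xl (W n) x u = lam n C x u * W n x u"
    by (rule vX_Wn[OF ch_SS xl_SS vX_Z_gf vX_W0_gf adm q])
  ultimately show ?thesis by (simp only: plus_fun_apply times_fun_apply) simp
qed

lemma adjoint_sum:
  assumes q: "(x, u) \<in> U"
  shows "frechet_adjoint \<Delta> (characteristic v) x u + frechet_adjoint (characteristic v) \<Delta> x u = c * (Jc x u * Ehat n C x u)"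
proof -
  let ?M = "D1 * ((Psi n C - Xi n C * W 1) * W n)"
  have M: "?M \<in> SS" by (intro SSV Psi_SS Xi_SS)
  have "frechet_adjoint \<Delta> ch x u + frechet_adjoint ch \<Delta> x u = eul (\<Delta> * ch) x u"
    unfolding eul_mult[OF Delta_SS ch_SS] plus_fun_apply using q by (simp add: trunc_at)
  also have "eul (\<Delta> * ch) = eul (cst c * ?M)"
  proof (rule eul_cong)
    show "\<Delta> * ch \<in> SS" by (intro SSI Delta_SS ch_SS)
    show "trunc (\<Delta> * ch) = trunc (cst c * ?M)"
      unfolding trunc_eq_iff
    proof (intro allI impI)
      fix x u assume q: "(x, u) \<in> U"
      have "\<Delta> x u * ch x u = c * (ch x u * Jc x u) * W n x u"
        using \<Delta> q unfolding trunc_eq_iff by (simp add: ev)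
      also have "\<dots> = (cst c * ?M) x u"
        unfolding ch_Jc_at[OF q] by (simp only: times_fun_apply minus_apply cst_apply mult_ac)
      finally show "(\<Delta> * ch) x u = (cst c * ?M) x u" by (simp only: times_fun_apply)
    qed
  qed
  also have "\<dots> = cst c * eul ?M" by (rule eul_cst_mult[OF M])
  also have "(cst c * eul ?M) x u = c * eul ?M x u" by (simp only: times_fun_apply cst_apply)
  also have "eul ?M x u = Jc x u * Ehat n C x u"
    by (rule eul_multiplier_gf[OF ch_SS xl_SS vX_Z_gf vX_W0_gf adm q])
  finally show ?thesis by (simp add: ch_def)
qed

end

text \<open>On D_x zeta the prolongation yields \<open>D1 * Dz Xi\<close> minus a term with the
  total derivative of the x-component of \<open>v\<close>; the latter cancels the divergence term.
  The square leaves the common factor \<open>W m\<close>.\<close>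

lemma prolong_lagrangian:
  assumes L: "trunc L = trunc (D1 * (cst s * (W m)\<^sup>2))" and q: "(x, u) \<in> U"
  shows "prolong v L x u + L x u * Dx (lift (\<lambda>p. fst (v p))) x u =
    2 * s * D1 x u * (W m x u * (vX ch xl (W m) x u + W m x u * Dz (Xi n C) x u / 2))"
proof -
  note d = derivation_vX[OF ch_SS xl_SS]
  have LSS: "L \<in> SS" using SS_trunc[of L] unfolding L by (simp add: SSV)
  have "dD (vX ch xl Z) = D1 * Dz (Xi n C)"
    unfolding D1_Dz using dD_cong[OF vX_Z_gf] .
  then have XD: "vX ch xl D1 = D1 * Dz (Xi n C) - dD xl * D1"
    by (simp add: vX_D1[OF ch_SS xl_SS])
  have "prolong v L x u = vX ch xl (D1 * (cst s * (W m)\<^sup>2)) x u"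
    unfolding prolong_vX[OF LSS q] using vX_cong[OF L] by simp
  also have "vX ch xl (D1 * (cst s * (W m)\<^sup>2)) = (D1 * Dz (Xi n C) - dD xl * D1) * (cst s * (W m * W m)) +
      D1 * (cst s * (vX ch xl (W m) * W m + W m * vX ch xl (W m)))"
    using dv_mult[OF d] dv_cst[OF d] by (simp add: SSV power2_eq_square XD)
  also have "\<dots> x u = (D1 x u * Dz (Xi n C) x u - dD xl x u * D1 x u) * (s * (W m x u * W m x u)) +
      D1 x u * (s * (vX ch xl (W m) x u * W m x u + W m x u * vX ch xl (W m) x u))"
    by (simp only: plus_fun_apply minus_apply times_fun_apply cst_apply)
  finally have "prolong v L x u = \<dots>" .
  moreover have "L x u = D1 x u * (s * (W m x u * W m x u))"
    using L q unfolding trunc_eq_iff by (simp add: ev power2_eq_square)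
  moreover have "Dx (lift (\<lambda>p. fst (v p))) x u = dD xl x u"
    using q by (simp add: dD_at xl_def)
  ultimately show ?thesis by (simp add: algebra_simps)
qed

text \<open>For n = 2m the weight n - 1 - 2j is -1 at j = m, so the contribution of G cancels half
  the derivative of xi. H leaves the term with \<open>W (m - 1)\<close>, whose coefficient j (n - j)
  is m^2.\<close>

lemma variational_bracket:
  assumes n: "n = 2 * m" "m > 0" and q: "(x, u) \<in> U"
  shows "vX ch xl (W m) x u + W m x u * Dz (Xi n C) x u / 2 = (\<Sum>k<n. C k * ff k m * Z x u ^ (k - m)) +
    C n * W m x u - C (n + 3) * (real m)\<^sup>2 * W (m - 1) x u + 3 / 2 * C (n + 5) * W 0 x u * W m x u -
    1 / 2 * (C (n + 4) + C (n + 5) * Z x u) * (W m x u)\<^sup>2"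
proof (cases "C (n + 4) = 0 \<and> C (n + 5) = 0")
  case True
  then have "vX ch xl (W m) x u = ((Dz ^^ m) (Po n C) + cst (C n + C (n + 2) * (real n - 1 - 2 * real m)) * W m -
    cst (C (n + 3) * (real n - 1 - 2 * real m)) * (Z * W m) - cst (C (n + 3) * (real m * (real n - real m))) * W (m - 1)) x u"
    using vX_W[OF ch_SS xl_SS vX_Z_gf vX_W0_gf, of m] q unfolding trunc_eq_iff by blast
  then have "vX ch xl (W m) x u = (\<Sum>k<n. C k * ff k m * Z x u ^ (k - m)) + (C n - C (n + 2)) * W m x u +
      C (n + 3) * (Z x u * W m x u) - C (n + 3) * (real m * real m) * W (m - 1) x u"
    unfolding plus_fun_apply minus_apply times_fun_apply cst_apply Dz_funpow_Po_at[OF q] using n by simp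
  then show ?thesis
    using True by (simp add: Dz_Xi_at[OF q] algebra_simps power2_eq_square diff_divide_distrib)
next
  case False
  with adm n have m: "n = 2" "m = 1" by auto
  have "vX ch xl (W 1) x u = (Dz (Po n C) + cst (C n) * W 1 +
    cst (real n - 1) * (cst (C (n + 2)) * W 1 - cst (C (n + 3)) * (W 0 + Z * W 1)) + cst (2 * C (n + 5)) * (W 0 * W 1) -
    W 1 * (cst (2 * C (n + 2)) - cst (2 * C (n + 3)) * Z + cst (C (n + 4)) * W 1 + cst (C (n + 5)) * (W 0 + Z * W 1))) x u"
    using vX_W1[OF ch_SS xl_SS vX_Z_gf vX_W0_gf] q unfolding trunc_eq_iff by blast
  note v1 = this[unfolded plus_fun_apply minus_apply times_fun_apply cst_apply m]
  have p1: "Dz (Po 2 C) x u = (\<Sum>k<2. C k * ff k 1 * Z x u ^ (k - 1))"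
    using Dz_funpow_Po_at[OF q, of 1 2 C] by simp
  show ?thesis
    unfolding m v1 p1 Dz_Xi_at[OF q]
    by (simp add: algebra_simps power2_eq_square add_divide_distrib diff_divide_distrib)
qed

end

end

section \<open>Conditions on the coefficients\<close>

context
  fixes n :: nat and C :: "nat \<Rightarrow> real"
  assumes inf: "infinite (\<zeta> ` \<Omega>)"
begin

lemma vanishes_on_base:
  assumes "\<And>x u. (x, u) \<in> U \<Longrightarrow> f (Z x u) = (0 :: real)" "z \<in> \<zeta> ` \<Omega>"
  shows "f z = 0"
proof -
  obtain p where p: "p \<in> \<Omega>" "z = \<zeta> p" using assms(2) by blast
  obtain u where "(fst p, u) \<in> U" "u 0 = snd p" using ex_regular_jet[OF p(1)] by blast
  then show ?thesis using assms(1)[of "fst p" u] p(2) by (simp add: Z_at)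
qed

lemma quadratic_Z_vanishes:
  assumes "\<And>x u. (x, u) \<in> U \<Longrightarrow> c0 + c1 * Z x u + c2 * (Z x u)\<^sup>2 = 0"
  shows "c0 = 0" "c1 = 0" "c2 = 0"
  using quadratic_vanishes[OF inf vanishes_on_base[of "\<lambda>z. c0 + c1 * z + c2 * z\<^sup>2", OF assms]] by auto

lemma ex_jet: "\<exists>x u. (x, u) \<in> U"
  using inf ex_regular_jet by (metis all_not_in_conv finite.emptyI image_is_empty)

text \<open>For odd n the coefficient of w^(n+1) is 2 xi, a quadratic polynomial in z; once xi
  vanishes, the coefficient of w^(n) vanishes as well.\<close>

lemma Ehat_odd:
  assumes n: "odd n" "C (n + 4) = 0" "C (n + 5) = 0"
  shows "(\<forall>x u. (x, u) \<in> U \<longrightarrow> Ehat n C x u = 0) \<longleftrightarrow> C (n + 1) = 0 \<and> C (n + 2) = 0 \<and> C (n + 3) = 0"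
proof
  assume E: "\<forall>x u. (x, u) \<in> U \<longrightarrow> Ehat n C x u = 0"
  let ?r = "real n + 1"
  let ?q = "cst (2 * C (n + 1)) + cst (4 * C (n + 2)) * Z - cst (2 * C (n + 3)) * (Z * Z)"
    and ?l = "cst (2 * ?r * C (n + 2)) - cst (2 * ?r * C (n + 3)) * Z"
  have "trunc (?q * W (Suc n) + ?l * W n) = trunc (cst 0)"
    unfolding trunc_eq_iff
  proof (intro allI impI)
    fix x u assume "(x, u) \<in> U"
    then have "Ehat n C x u = 0" using E by blast
    then show "(?q * W (Suc n) + ?l * W n) x u = cst 0 x u"
      using n by (simp add: Ehat_def lam_def Xi_def ev algebra_simps)
  qed
  note t = this
  have "2 * C (n + 1) + 4 * C (n + 2) * Z x u + (- (2 * C (n + 3))) * (Z x u)\<^sup>2 = 0" if q: "(x, u) \<in> U" for x u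
  proof -
    have "wd (Suc n) x u (?q * W (Suc n) + ?l * W n) = ?q x u"
      by (simp add: wd_add wd_mult wd_diff wd_cst wd_Z wd_W[OF q] SSV)
    moreover have "wd (Suc n) x u (?q * W (Suc n) + ?l * W n) = 0" using wd_cong[OF t] wd_cst by simp
    ultimately show ?thesis by (simp add: ev power2_eq_square)
  qed
  from quadratic_Z_vanishes[OF this] show "C (n + 1) = 0 \<and> C (n + 2) = 0 \<and> C (n + 3) = 0" by simp
next
  assume "C (n + 1) = 0 \<and> C (n + 2) = 0 \<and> C (n + 3) = 0"
  with n show "\<forall>x u. (x, u) \<in> U \<longrightarrow> Ehat n C x u = 0"
    by (simp add: Ehat_def lam_def Xi_def ev)
qed

text \<open>For even n only a multiple of w^(n) remains, and in its factor the coefficients of F, G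
  and H have cancelled. A further derivative by w' separates the coefficients special to n =
  2.\<close>

lemma Ehat_even:
  assumes n: "even n" "n \<ge> 2"
  shows "(\<forall>x u. (x, u) \<in> U \<longrightarrow> Ehat n C x u = 0) \<longleftrightarrow> C n = 0 \<and> C (n + 4) = 0 \<and> C (n + 5) = 0"
proof
  assume E: "\<forall>x u. (x, u) \<in> U \<longrightarrow> Ehat n C x u = 0"
  let ?b = "cst (2 * C n) + cst (3 * C (n + 5)) * W 0 - (cst (3 * C (n + 4)) + cst (3 * C (n + 5)) * Z) * W 1"
  have t: "trunc (?b * W n) = trunc (cst 0)"
    unfolding trunc_eq_iff
  proof (intro allI impI)
    fix x u assume "(x, u) \<in> U"
    then have "Ehat n C x u = 0" using E by blast
    then show "(?b * W n) x u = cst 0 x u"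
      using n by (simp add: Ehat_def lam_def ev algebra_simps)
  qed
  have b: "?b x u = 0" if q: "(x, u) \<in> U" for x u
  proof -
    \<comment> \<open>As n is at least 2, w^(n) differs from the functions w and w' that occur in
      the factor.\<close>
    have "wd n x u (?b * W n) = ?b x u"
      using n by (simp add: wd_add wd_mult wd_diff wd_cst wd_Z wd_W[OF q] SSV)
    moreover have "wd n x u (?b * W n) = 0" using wd_cong[OF t] wd_cst by simp
    ultimately show ?thesis by simp
  qed
  then have t': "trunc ?b = trunc (cst 0)"
    unfolding trunc_eq_iff by (simp add: cst_apply)
  have "3 * C (n + 4) + 3 * C (n + 5) * Z x u + 0 * (Z x u)\<^sup>2 = 0" if q: "(x, u) \<in> U" for x u
  proof -
    have "wd 1 x u ?b = - (cst (3 * C (n + 4)) + cst (3 * C (n + 5)) * Z) x u"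
      by (simp add: wd_add wd_mult wd_diff wd_cst wd_Z wd_W[OF q] SSV)
    moreover have "wd 1 x u ?b = 0" using wd_cong[OF t'] wd_cst by simp
    ultimately have "(cst (3 * C (n + 4)) + cst (3 * C (n + 5)) * Z) x u = 0" by linarith
    then show ?thesis by (simp add: ev)
  qed
  from quadratic_Z_vanishes[OF this] have z: "C (n + 4) = 0" "C (n + 5) = 0" by simp_all
  obtain x u where "(x, u) \<in> U" using ex_jet by blast
  from b[OF this] z have "C n = 0" by (simp add: ev)
  with z show "C n = 0 \<and> C (n + 4) = 0 \<and> C (n + 5) = 0" by blast
next
  assume "C n = 0 \<and> C (n + 4) = 0 \<and> C (n + 5) = 0"
  with n show "\<forall>x u. (x, u) \<in> U \<longrightarrow> Ehat n C x u = 0"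
    by (simp add: Ehat_def lam_def ev)
qed

end

end

lemma sum_lessThan_add:
  fixes f :: "nat \<Rightarrow> 'a::comm_monoid_add"
  shows "(\<Sum>k<m + l. f k) = (\<Sum>k<m. f k) + (\<Sum>i<l. f (m + i))"
  by (induction l) (simp_all add: add.assoc)

context change_of_vars begin

text \<open>Three derivatives by w^(m) isolate the last two coefficients, the second one then gives
  \<open>C n\<close>, a derivative by w^(m-1) gives \<open>C (n + 3)\<close>, and a polynomial in z
  remains.\<close>

lemma variational_coefficients:
  assumes inf: "infinite (\<zeta> ` \<Omega>)" and n: "n = 2 * m" "m > 0"
  shows "(\<forall>x u. (x, u) \<in> U \<longrightarrow> W m x u * ((\<Sum>k<n. C k * ff k m * Z x u ^ (k - m)) + C n * W m x u
      - C (n + 3) * (real m)\<^sup>2 * W (m - 1) x u + 3 / 2 * C (n + 5) * W 0 x u * W m x u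
      - 1 / 2 * (C (n + 4) + C (n + 5) * Z x u) * (W m x u)\<^sup>2) = 0) \<longleftrightarrow>
    C n = 0 \<and> C (n + 3) = 0 \<and> C (n + 4) = 0 \<and> C (n + 5) = 0 \<and> (\<forall>k. m \<le> k \<and> k < n \<longrightarrow> C k = 0)"
    (is "(\<forall>x u. _ \<longrightarrow> ?E x u = 0) \<longleftrightarrow> ?R")
proof
  assume E: "\<forall>x u. (x, u) \<in> U \<longrightarrow> ?E x u = 0"
  define p where "p = (\<Sum>k<n. cst (C k * ff k m) * Z ^ (k - m))"
  have p: "p \<in> SS" unfolding p_def by (intro SSV)
  have p_at: "p x u = (\<Sum>k<n. C k * ff k m * Z x u ^ (k - m))" for x u
    by (simp add: p_def ev)
  have wd_p: "wd j x u p = 0" for j x u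
    unfolding p_def by (subst wd_sum) (auto intro!: SSV sum.neutral simp: wd_mult wd_cst wd_Z_power SSV)
  let ?a = "cst (C n)" and ?d = "cst (C (n + 3) * (real m)\<^sup>2)" and ?g = "cst (C (n + 5))" and ?b = "cst (C (n + 4))"
  let ?B = "p + ?a * W m - ?d * W (m - 1) + cst (3 / 2) * (?g * (W 0 * W m)) - cst (1 / 2) * ((?b + ?g * Z) * (W m * W m))"
  let ?B2 = "p + cst 2 * (?a * W m) - ?d * W (m - 1) + cst 3 * (?g * (W 0 * W m)) - cst (3 / 2) * ((?b + ?g * Z) * (W m * W m))"
  let ?B3 = "cst 2 * ?a + cst 3 * (?g * W 0) - cst 3 * ((?b + ?g * Z) * W m)"
  let ?B4 = "?b + ?g * Z"
  let ?B5 = "p - ?d * W (m - 1)"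
  have m': "0 \<noteq> m" "m - 1 \<noteq> m" using n(2) by auto
  have "trunc (W m * ?B) = trunc (cst 0)"
    unfolding trunc_eq_iff
  proof (intro allI impI)
    fix x u assume "(x, u) \<in> U"
    then have "?E x u = 0" using E by blast
    then show "(W m * ?B) x u = cst 0 x u"
      by (simp add: p_at ev power2_eq_square algebra_simps)
  qed
  note t1 = this
  have e2: "?B2 x u = 0" if q: "(x, u) \<in> U" for x u
  proof -
    have "wd m x u (W m * ?B) = ?B2 x u"
      using m' by (simp add: wd_add wd_mult wd_diff wd_cst wd_Z wd_W[OF q] wd_p p SSV) (simp add: ev algebra_simps)
    then show ?thesis using wd_cong[OF t1] wd_cst by simp
  qed
  then have t2: "trunc ?B2 = trunc (cst 0)" unfolding trunc_eq_iff by (simp add: cst_apply)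
  have e3: "?B3 x u = 0" if q: "(x, u) \<in> U" for x u
  proof -
    have "wd m x u ?B2 = ?B3 x u"
      using m' by (simp add: wd_add wd_mult wd_diff wd_cst wd_Z wd_W[OF q] wd_p p SSV) (simp add: ev algebra_simps)
    then show ?thesis using wd_cong[OF t2] wd_cst by simp
  qed
  then have t3: "trunc ?B3 = trunc (cst 0)" unfolding trunc_eq_iff by (simp add: cst_apply)
  have "C (n + 4) + C (n + 5) * Z x u + 0 * (Z x u)\<^sup>2 = 0" if q: "(x, u) \<in> U" for x u
  proof -
    have "wd m x u ?B3 = - 3 * ?B4 x u"
      using m' by (simp add: wd_add wd_mult wd_diff wd_cst wd_Z wd_W[OF q] SSV) (simp add: ev algebra_simps)
    then have "?B4 x u = 0" using wd_cong[OF t3] wd_cst by simp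
    then show ?thesis by (simp add: ev)
  qed
  from quadratic_Z_vanishes[OF inf this] have z: "C (n + 4) = 0" "C (n + 5) = 0" by simp_all
  obtain x0 u0 where q0: "(x0, u0) \<in> U" using ex_jet[OF inf] by blast
  from e3[OF q0] z have a: "C n = 0" by (simp add: ev)
  \<comment> \<open>For m = 1 the function w^(m-1) is w itself, which also occurs with
    \<open>C (n + 5)\<close>; that coefficient therefore had to be removed first.\<close>
  have e5: "?B5 x u = 0" if q: "(x, u) \<in> U" for x u
    using e2[OF q] z a by (simp add: ev)
  then have t5: "trunc ?B5 = trunc (cst 0)" unfolding trunc_eq_iff by (simp add: cst_apply)
  have "wd (m - 1) x0 u0 ?B5 = - (C (n + 3) * (real m)\<^sup>2)"
    by (simp add: wd_mult wd_diff wd_cst wd_W[OF q0] wd_p p SSV) (simp add: ev)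
  then have d: "C (n + 3) = 0" using wd_cong[OF t5] wd_cst n(2) by simp
  \<comment> \<open>\<open>ff k m\<close> vanishes for \<open>k < m\<close>: adding z^k to w does
    not change w^(m), so these coefficients stay free.\<close>
  have "(\<Sum>i<m. C (m + i) * ff (m + i) m * Z x u ^ i) = 0" if q: "(x, u) \<in> U" for x u
  proof -
    have "p x u = 0" using e5[OF q] d by (simp add: ev)
    then show ?thesis unfolding p_at n(1) mult_2 sum_lessThan_add by (simp add: ff_eq_0)
  qed
  then have v: "(\<Sum>i<m. C (m + i) * ff (m + i) m * z ^ i) = 0" if "z \<in> \<zeta> ` \<Omega>" for z
    using vanishes_on_base[OF inf, of "\<lambda>z. \<Sum>i<m. C (m + i) * ff (m + i) m * z ^ i"] that by blast
  have "C k = 0" if k: "m \<le> k" "k < n" for k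
  proof -
    have "{..m - 1} = {..<m}" using n(2) by auto
    with v have "(\<Sum>i\<le>m - 1. C (m + i) * ff (m + i) m * z ^ i) = 0" if "z \<in> \<zeta> ` \<Omega>" for z
      using that by simp
    from polynomial_vanishes[OF inf this, of "k - m"] k n have "C k * ff k m = 0" by simp
    then show ?thesis using ff_pos[OF k(1)] by simp
  qed
  with z a d show ?R by blast
next
  assume R: ?R
  have "C k * ff k m * z ^ (k - m) = 0" if "k < n" for k and z :: real
  proof (cases "m \<le> k")
    case True
    with R that show ?thesis by simp
  next
    case False
    then show ?thesis by (simp add: ff_eq_0)
  qed
  then have s: "(\<Sum>k<n. C k * ff k m * z ^ (k - m)) = 0" for z :: real
    by (intro sum.neutral) blast
  show "\<forall>x u. (x, u) \<in> U \<longrightarrow> ?E x u = 0"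
    using R unfolding s by simp
qed

lemma trunc_lagrangian:
  "trunc (transformed_lagrangian n \<zeta> \<phi>) = trunc (D1 * (cst ((- 1) ^ (n div 2) / 2) * (W (n div 2))\<^sup>2))"
  unfolding trunc_eq_iff
  by (simp add: transformed_lagrangian_def change_vars_def trivial_lagrangian_def w_deriv_at D1_at ev)

lemma trunc_trivial: 
  assumes "\<And>x u. (x, u) \<in> U \<Longrightarrow> \<Delta> x u = c * jacobian \<zeta> \<phi> x u * change_vars \<zeta> \<phi> (trivial_eq n) x u"
  shows "trunc \<Delta> = trunc (cst c * (Jc * W n))"
  unfolding trunc_eq_iff using assms
  by (simp add: change_vars_def trivial_eq_def w_deriv_at jacobian_at ev)

text \<open>The Euler expression is J w^(n), which differs from \<open>\<Delta>\<close> only by the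
  nonzero constant \<open>c\<close>.\<close>

lemma lagrangian_of_transformed:
  assumes n: "even n" "n \<ge> 2" and \<Delta>: "trunc \<Delta> = trunc (cst c * (Jc * W n))" and c: "c \<noteq> 0"
  shows "lagrangian_of (n div 2) U \<Delta> (transformed_lagrangian n \<zeta> \<phi>)"
proof -
  let ?m = "n div 2" and ?L = "transformed_lagrangian n \<zeta> \<phi>"
  have m: "2 * ?m = n" "?m > 0" using n by auto
  then obtain l where l: "?m = Suc l" using gr0_implies_Suc by blast
  let ?L' = "D1 * (cst ((- 1) ^ ?m / 2) * (W ?m)\<^sup>2)"
  have "sm ?m ?L'"
    using sm_W[of ?m] unfolding l by (intro sm_mult sm_cst sm_power sm_D1)
  then have sm: "sm ?m ?L"
    using sm_trunc[of ?m ?L] sm_trunc[of ?m ?L'] unfolding trunc_lagrangian by blast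
  have "eul ?L = eul ?L'"
    by (rule eul_cong[OF SS_I[OF sm] trunc_lagrangian])
  also have "\<dots> = Jc * W n" using eul_lagrangian[of ?m] m by simp
  finally have e: "eul ?L = Jc * W n" .
  have "\<Delta> x u = 0 \<longleftrightarrow> euler ?L x u = 0" if q: "(x, u) \<in> U" for x u
  proof -
    have "\<Delta> x u = c * (Jc x u * W n x u)"
      using \<Delta> q unfolding trunc_eq_iff by (simp add: ev)
    moreover have "euler ?L x u = Jc x u * W n x u"
      using e q trunc_at[OF q, of "euler ?L"] by (simp add: eul_def ev)
    ultimately show ?thesis using c by simp
  qed
  then have "is_solution U \<Delta> I f \<longleftrightarrow> is_solution U (euler ?L) I f" for I f
    unfolding is_solution_def by blast
  with sm show ?thesis by (simp add: lagrangian_of_def)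
qed

section \<open>First integrals\<close>

definition VI :: "nat \<Rightarrow> nat \<Rightarrow> dfun"
  where "VI n k = (\<Sum>i<Suc k. cst ((- 1) ^ i * ff k i) * Z ^ (k - i) * W (n - 1 - i))"

lemma sm_VI: "sm (n - 1) (VI n k)"
  unfolding VI_def
  by (intro sm_sum sm_mult sm_cst sm_power sm_Z sm_mono[OF sm_W]) simp

lemma trunc_V_integral: "trunc (change_vars \<zeta> \<phi> (V_integral n k)) = trunc (VI n k)"
  unfolding trunc_eq_iff
proof (intro allI impI)
  fix x u assume q: "(x, u) \<in> U"
  have "change_vars \<zeta> \<phi> (V_integral n k) x u =
      (\<Sum>i\<le>k. (- 1) ^ i * (fact k / fact (k - i)) * Z x u ^ (k - i) * W (n - 1 - i) x u)"
    by (simp add: change_vars_def V_integral_def w_deriv_at[OF q] Z_at[OF q])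
  also have "\<dots> = VI n k x u"
    by (simp add: VI_def ev lessThan_Suc_atMost ff_fact)
  finally show "change_vars \<zeta> \<phi> (V_integral n k) x u = VI n k x u" .
qed

text \<open>The sum telescopes: differentiating a partial sum leaves z^k w^(n) and one boundary
  term, whose coefficient \<open>ff k (Suc k)\<close> is zero for the full sum.\<close>

lemma Dz_VI:
  assumes k: "k < n"
  shows "Dz (VI n k) = Z ^ k * W n"
proof -
  have "Dz (\<Sum>i<j. cst ((- 1) ^ i * ff k i) * Z ^ (k - i) * W (n - 1 - i)) =
      Z ^ k * W n - cst ((- 1) ^ j * ff k j) * Z ^ (k - j) * W (n - j)" if "j \<le> Suc k" for j
    using that
  proof (induction j)
    case 0
    then show ?case by (simp add: dv_0[OF derivation_Dz] cst_simps)
  next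
    case (Suc j)
    let ?c = "cst ((- 1) ^ j * ff k j)"
    have j: "n - j = Suc (n - Suc j)" "n - 1 - j = n - Suc j" using Suc.prems k by auto
    have "Dz (?c * Z ^ (k - j) * W (n - 1 - j)) =
        ?c * (un * (cst (real (k - j)) * Z ^ (k - j - 1))) * W (n - Suc j) + ?c * Z ^ (k - j) * W (n - j)"
      unfolding j by (simp add: Dz_rules dv_power[OF derivation_Dz, OF Z_SS Dz_Z] SSV)
    also have "?c * (un * (cst (real (k - j)) * Z ^ (k - j - 1))) * W (n - Suc j) =
        (?c * cst (real (k - j))) * Z ^ (k - Suc j) * (un * W (n - Suc j))"
      by (simp add: mult_ac)
    also have "?c * cst (real (k - j)) = - cst ((- 1) ^ Suc j * ff k (Suc j))"
      using Suc.prems by (simp add: cst_simps ff_Suc of_nat_diff mult.assoc)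
    finally have s: "Dz (?c * Z ^ (k - j) * W (n - 1 - j)) =
        - cst ((- 1) ^ Suc j * ff k (Suc j)) * Z ^ (k - Suc j) * W (n - Suc j) + ?c * Z ^ (k - j) * W (n - j)"
      by (simp add: un_absorb)
    have "Dz (\<Sum>i<Suc j. cst ((- 1) ^ i * ff k i) * Z ^ (k - i) * W (n - 1 - i)) =
        Dz (\<Sum>i<j. cst ((- 1) ^ i * ff k i) * Z ^ (k - i) * W (n - 1 - i)) + Dz (?c * Z ^ (k - j) * W (n - 1 - j))"
      unfolding sum.lessThan_Suc by (intro dv_add[OF derivation_Dz] SSV)
    then show ?case using Suc unfolding s by simp
  qed
  from this[of "Suc k"] show ?thesis by (simp add: VI_def ff_eq_0 cst_simps)
qed

lemma trunc_integral_sum: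
  "trunc (change_vars \<zeta> \<phi> (\<lambda>z w. \<Sum>k<n. a k * V_integral n k z w)) = trunc (\<Sum>k<n. cst (a k) * VI n k)"
  unfolding trunc_eq_iff
proof (intro allI impI)
  fix x u assume q: "(x, u) \<in> U"
  have "change_vars \<zeta> \<phi> (V_integral n k) x u = VI n k x u" for k
    using trunc_V_integral q unfolding trunc_eq_iff by blast
  then show "change_vars \<zeta> \<phi> (\<lambda>z w. \<Sum>k<n. a k * V_integral n k z w) x u = (\<Sum>k<n. cst (a k) * VI n k) x u"
    by (simp add: change_vars_def ev)
qed

text \<open>By \<open>Dz_VI\<close> the total derivative is D_x zeta times a polynomial in z times
  w^(n). It vanishes along solutions, which live on intervals.\<close>

lemma first_integral_sum:
  assumes \<Delta>: "\<And>x u. (x, u) \<in> U \<Longrightarrow> \<Delta> x u = 0 \<Longrightarrow> W n x u = 0"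
  shows "first_integral n U \<Delta> (change_vars \<zeta> \<phi> (\<lambda>z w. \<Sum>k<n. a k * V_integral n k z w))"
proof -
  let ?P = "change_vars \<zeta> \<phi> (\<lambda>z w. \<Sum>k<n. a k * V_integral n k z w)" and ?S = "\<Sum>k<n. cst (a k) * VI n k"
  have VI: "VI n k \<in> SS" for k by (rule SS_I[OF sm_VI])
  have "sm (n - 1) ?S" by (intro sm_sum sm_mult sm_cst sm_VI)
  then have sm: "sm (n - 1) ?P"
    using sm_trunc[of "n - 1" ?P] sm_trunc[of "n - 1" ?S] unfolding trunc_integral_sum by blast
  have "Dz ?S = (\<Sum>k<n. cst (a k) * (Z ^ k * W n))"
    by (subst dv_sum[OF derivation_Dz]) (auto intro!: SSV VI simp: Dz_rules VI Dz_VI)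
  also have "\<dots> = (\<Sum>k<n. cst (a k) * Z ^ k) * W n"
    by (simp add: sum_distrib_right mult.assoc)
  finally have S: "Dz ?S = (\<Sum>k<n. cst (a k) * Z ^ k) * W n" .
  have "dD ?P = dD ?S" by (rule dD_cong[OF trunc_integral_sum])
  also have "\<dots> = D1 * ((\<Sum>k<n. cst (a k) * Z ^ k) * W n)" unfolding S[symmetric] D1_Dz ..
  finally have "dD ?P = D1 * ((\<Sum>k<n. cst (a k) * Z ^ k) * W n)" .
  then have Dx: "Dx ?P x u = 0" if "(x, u) \<in> U" "\<Delta> x u = 0" for x u
    using \<Delta>[OF that] dD_at[OF that(1), of ?P] by (simp add: times_fun_apply)
  have "?P x (jet_of f x) = ?P x' (jet_of f x')" if f: "is_solution U \<Delta> I f" and x: "x \<in> I" "x' \<in> I" for I f x x'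
  proof -
    have I: "open I" "convex I" "smooth_on I f" and sol: "\<And>t. t \<in> I \<Longrightarrow> (t, jet_of f t) \<in> U \<and> \<Delta> t (jet_of f t) = 0"
      using f unfolding is_solution_def by (auto simp: is_interval_convex)
    have "((\<lambda>t. ?P t (jet_of f t)) has_field_derivative 0) (at t within I)" if "t \<in> I" for t
      using curve_has_deriv[OF sm I(1,3) _ that] sol Dx[of t "jet_of f t"] that
      by (auto intro: has_field_derivative_at_within)
    then have "\<exists>c. \<forall>t\<in>I. ?P t (jet_of f t) = c"
      by (rule has_field_derivative_zero_constant[OF I(2)])
    then show ?thesis using x by auto
  qed
  with sm show ?thesis unfolding first_integral_def by blast
qed

lemma first_integral_V:
  assumes "\<And>x u. (x, u) \<in> U \<Longrightarrow> \<Delta> x u = 0 \<Longrightarrow> W n x u = 0" "k < n"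
  shows "first_integral n U \<Delta> (change_vars \<zeta> \<phi> (V_integral n k))"
proof -
  have "(\<lambda>z w. \<Sum>j<n. (if j = k then 1 else 0) * V_integral n j z w) = V_integral n k"
    using assms(2) by (simp add: fun_eq_iff if_distrib[of "\<lambda>z. z * _"] cong: if_cong)
  then show ?thesis
    using first_integral_sum[where \<Delta> = \<Delta> and n = n and a = "\<lambda>j. if j = k then 1 else 0"] assms(1) by simp
qed

lemma wd_VI:
  assumes q: "(x, u) \<in> U" and i: "i < n" and k: "k < n"
  shows "wd (n - 1 - i) x u (VI n k) = (- 1) ^ i * ff k i * Z x u ^ (k - i)"
proof -
  have "wd (n - 1 - i) x u (VI n k) =
      (\<Sum>l<Suc k. (- 1) ^ l * ff k l * Z x u ^ (k - l) * (if n - 1 - l = n - 1 - i then 1 else 0))"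
    unfolding VI_def
    by (subst wd_sum) (auto intro!: SSV sum.cong simp: wd_mult wd_cst wd_Z_power wd_W[OF q] SSV ev)
  \<comment> \<open>Since \<open>l <= k < n\<close> and \<open>i < n\<close>, the truncated
    difference \<open>n - 1 - l\<close> determines \<open>l\<close>.\<close>
  also have "\<dots> = (\<Sum>l<Suc k. if l = i then (- 1) ^ i * ff k i * Z x u ^ (k - i) else 0)"
    using i k by (intro sum.cong) auto
  also have "\<dots> = (- 1) ^ i * ff k i * Z x u ^ (k - i)"
    by (cases "i < Suc k") (simp_all add: ff_eq_0)
  finally show ?thesis .
qed

text \<open>The matrix of derivatives by w^(n-1-i) is triangular, because \<open>ff k i\<close> is
  zero for \<open>k < i\<close>, with diagonal entries k! up to sign. Induction from the largest
  index downwards solves for the coefficients.\<close>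

lemma VI_independent:
  assumes q: "(x, u) \<in> U" and 0: "\<And>i. dT i (\<Sum>k<n. cst (c k) * VI n k) x u = 0" and k: "k < n"
  shows "c k = 0"
proof -
  have VI: "VI n k \<in> SS" for k by (rule SS_I[OF sm_VI])
  have e: "(\<Sum>k<n. c k * ((- 1) ^ i * ff k i * Z x u ^ (k - i))) = 0" if i: "i < n" for i
  proof -
    have "(\<Sum>k<n. c k * ((- 1) ^ i * ff k i * Z x u ^ (k - i))) = (\<Sum>k<n. c k * wd (n - 1 - i) x u (VI n k))"
      by (intro sum.cong refl) (simp only: wd_VI[OF q i] lessThan_iff)
    also have "\<dots> = wd (n - 1 - i) x u (\<Sum>k<n. cst (c k) * VI n k)"
      by (subst wd_sum) (auto intro!: SSV VI simp: wd_mult wd_cst VI cst_apply)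
    also have "\<dots> = 0" by (rule wd_eq_0[OF _ 0]) (intro SSV VI)
    finally show ?thesis .
  qed
  show ?thesis using k
  proof (induction "n - k" arbitrary: k rule: less_induct)
    case less
    have "c j * ((- 1) ^ k * ff j k * Z x u ^ (j - k)) = (if j = k then c k * (- 1) ^ k * ff k k else 0)" if "j < n" for j
    proof (cases j k rule: linorder_cases)
      case less
      then show ?thesis by (simp add: ff_eq_0)
    next
      case greater
      then have "c j = 0" using less.hyps[of j] that less.prems by simp
      with greater show ?thesis by simp
    qed simp
    with e[OF less.prems] have "(\<Sum>j<n. if j = k then c k * (- 1) ^ k * ff k k else 0) = 0" by simp
    then have "c k * (- 1) ^ k * ff k k = 0" using less.prems by simp
    then show ?case using ff_pos[of k k] by simp
  qed
qed

lemma fundamental_V: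
  assumes \<Delta>: "\<And>x u. (x, u) \<in> U \<Longrightarrow> \<Delta> x u = 0 \<Longrightarrow> W n x u = 0" and ne: "\<Omega> \<noteq> {}"
  shows "fundamental_first_integrals n U \<Delta> (\<lambda>k. change_vars \<zeta> \<phi> (V_integral n k))"
proof -
  let ?P = "\<lambda>k. change_vars \<zeta> \<phi> (V_integral n k)"
  have VI: "VI n k \<in> SS" for k by (rule SS_I[OF sm_VI])
  have P_at: "?P k x u = VI n k x u" if "(x, u) \<in> U" for k x u
    using trunc_V_integral that unfolding trunc_eq_iff by blast
  have dT: "dT i (\<Sum>k<n. cst (c k) * VI n k) x u = (\<Sum>k<n. c k * pd i (?P k) x u)" if "(x, u) \<in> U" for i c x u
  proof -
    have "dT i (\<Sum>k<n. cst (c k) * VI n k) = (\<Sum>k<n. cst (c k) * dT i (?P k))"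
      unfolding dT_cong[OF trunc_V_integral]
      by (subst dT_sum) (auto intro!: SSV VI simp: dT_mult SS_sd VI sd_cst)
    then show ?thesis using dT_at[OF that] by (simp add: ev)
  qed
  have "functionally_independent n U ?P"
    unfolding functionally_independent_def
  proof (clarify)
    fix x u k and c :: "nat \<Rightarrow> real"
    assume q: "(x, u) \<in> U" and 1: "(\<Sum>k<n. c k * pd_x (?P k) x u) = 0"
      and 2: "\<forall>j. (\<Sum>k<n. c k * pd_u j (?P k) x u) = 0" and k: "k < n"
    have "dT i (\<Sum>k<n. cst (c k) * VI n k) x u = 0" for i
      unfolding dT[OF q] using 1 2 by (cases i) simp_all
    then show "c k = 0" by (rule VI_independent[OF q _ k])
  qed
  moreover have "linearly_independent n U ?P"
    unfolding linearly_independent_def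
  proof (intro allI impI)
    fix c k assume 0: "\<forall>(x, u)\<in>U. (\<Sum>k<n. c k * ?P k x u) = 0" and k: "k < n"
    obtain x u where q: "(x, u) \<in> U" using ne ex_regular_jet by blast
    have "trunc (\<Sum>k<n. cst (c k) * VI n k) = trunc (cst 0)"
      unfolding trunc_eq_iff using 0 P_at by (auto simp: ev)
    from dT_cong[OF this] have "dT i (\<Sum>k<n. cst (c k) * VI n k) x u = 0" for i
      by (simp add: zero_fun_apply)
    then show "c k = 0" by (rule VI_independent[OF q _ k])
  qed
  ultimately show ?thesis
    using first_integral_V[OF \<Delta>] unfolding fundamental_first_integrals_def by blast
qed

end

section \<open>Vector fields on the plane\<close>

lemma second_derivatives_commute:
  fixes g :: "real \<times> real \<Rightarrow> real"
  assumes "open \<Omega>" "smooth_on \<Omega> g" "p \<in> \<Omega>"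
  shows "d1 (\<lambda>p. d2 g p) p = d2 (\<lambda>p. d1 g p) p"
proof -
  note s = smooth_on_frechet_derivative[OF assms(2)]
  have p: "p = (fst p, snd p)" by simp
  have "d2 (\<lambda>p. d1 g p) (fst p, snd p) = d1 (\<lambda>p. d2 g p) (fst p, snd p)"
  proof (rule mixed_partials_eq[OF assms(1), where f = "\<lambda>s t. g (s, t)" and fx = "\<lambda>s t. d1 g (s, t)"
        and fy = "\<lambda>s t. d2 g (s, t)" and fxy = "\<lambda>s t. d2 (\<lambda>p. d1 g p) (s, t)" and fyx = "\<lambda>s t. d1 (\<lambda>p. d2 g p) (s, t)"])
    show "continuous_on \<Omega> (\<lambda>(s, t). d2 (\<lambda>p. d1 g p) (s, t))" "continuous_on \<Omega> (\<lambda>(s, t). d1 (\<lambda>p. d2 g p) (s, t))"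
      using smooth_on_continuous_on[OF smooth_on_frechet_derivative[OF s]] by (simp_all add: case_prod_unfold)
    show "(fst p, snd p) \<in> \<Omega>" using assms(3) by simp
    fix s t assume q: "(s, t) \<in> \<Omega>"
    note d = smooth_on_differentiable[OF assms(2) q] and d' = smooth_on_differentiable[OF s q]
    show "((\<lambda>s. g (s, t)) has_field_derivative d1 g (s, t)) (at s)" by (rule slice_derivatives(1)[OF d])
    show "((\<lambda>t. g (s, t)) has_field_derivative d2 g (s, t)) (at t)" by (rule slice_derivatives(2)[OF d])
    show "((\<lambda>t. d1 g (s, t)) has_field_derivative d2 (\<lambda>p. d1 g p) (s, t)) (at t)" by (rule slice_derivatives(2)[OF d'])
    show "((\<lambda>s. d2 g (s, t)) has_field_derivative d1 (\<lambda>p. d2 g p) (s, t)) (at s)" by (rule slice_derivatives(1)[OF d'])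
  qed
  then show ?thesis by simp
qed

lemma smooth_on_Pair:
  fixes f g :: "real \<times> real \<Rightarrow> real"
  assumes "open S" "smooth_on S f" "smooth_on S g"
  shows "smooth_on S (\<lambda>p. (f p, g p))"
proof -
  have L: "bounded_linear (\<lambda>t :: real. (t, 0 :: real))" "bounded_linear (\<lambda>t :: real. (0 :: real, t))"
    by (auto intro!: bounded_linear_Pair bounded_linear_ident bounded_linear_zero)
  from smooth_on_add[OF assms(1) smooth_on_linear_compose[OF assms(1) L(1) assms(2)]
      smooth_on_linear_compose[OF assms(1) L(2) assms(3)]]
  show ?thesis by simp
qed

lemma smooth_on_diff:
  fixes f g :: "'a::real_normed_vector \<Rightarrow> real"
  assumes "open S" "smooth_on S f" "smooth_on S g"
  shows "smooth_on S (\<lambda>p. f p - g p)"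
  using smooth_on_add[OF assms(1,2) smooth_on_mult[OF assms(1) smooth_on_const[of S "- 1"] assms(3)]] by simp

lemma smooth_on_sum:
  fixes f :: "'i \<Rightarrow> 'a::real_normed_vector \<Rightarrow> real"
  assumes "open S" "\<And>i. i \<in> A \<Longrightarrow> smooth_on S (f i)"
  shows "smooth_on S (\<lambda>p. \<Sum>i\<in>A. f i p)"
  using assms(2) by (induction A rule: infinite_finite_induct) (simp_all add: smooth_on_add[OF assms(1)])

lemma smooth_on_power:
  fixes f :: "'a::real_normed_vector \<Rightarrow> real"
  assumes "open S" "smooth_on S f"
  shows "smooth_on S (\<lambda>p. f p ^ k)"
  by (induction k) (simp_all add: smooth_on_mult[OF assms(1) assms(2)])

lemma smooth_gf_comp:
  fixes f g :: "real \<times> real \<Rightarrow> real"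
  assumes S: "open S" and f: "smooth_on S f" and g: "smooth_on S g"
  shows "smooth_on S (\<lambda>p. fst (gf n C (f p, g p)))" "smooth_on S (\<lambda>p. snd (gf n C (f p, g p)))"
  unfolding gf_def split_conv fst_conv snd_conv
  by (rule smooth_on_add[OF S] smooth_on_diff[OF S] smooth_on_mult[OF S] smooth_on_sum[OF S] smooth_on_power[OF S]
      smooth_on_const f g)+

lemma smooth_gf: "open S \<Longrightarrow> smooth_on S (gf n C)"
proof -
  assume S: "open S"
  have "smooth_on S (\<lambda>p. (fst (gf n C (fst p, snd p)), snd (gf n C (fst p, snd p))))"
    by (intro smooth_on_Pair[OF S] smooth_gf_comp[OF S] smooth_on_bounded_linear bounded_linear_fst bounded_linear_snd)
  then show ?thesis by simp
qed

lemma scale_vf_apply: "scale_vf c v p = c *\<^sub>R v p"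
  by (simp add: scale_vf_def)

lemma sum_vf_apply: "sum f A p = (\<Sum>i\<in>A. f i p)" for f :: "'i \<Rightarrow> vfield"
  by (induction A rule: infinite_finite_induct) (simp_all add: zero_fun_apply plus_fun_apply)

section \<open>Spans and Lie algebras of vector fields\<close>

lemma restrict_in_vfields:
  assumes "open \<Omega>" "smooth_on \<Omega> v"
  shows "restrict_vf \<Omega> v \<in> vfields \<Omega>"
  using smooth_on_cong[OF assms(1), of "restrict_vf \<Omega> v" v] assms(2)
  by (simp add: vfields_def restrict_vf_def)

lemma restrict_vfields: "v \<in> vfields \<Omega> \<Longrightarrow> restrict_vf \<Omega> v = v"
  by (auto simp: vfields_def restrict_vf_def fun_eq_iff)

lemma restrict_add: "restrict_vf \<Omega> (u + v) = restrict_vf \<Omega> u + restrict_vf \<Omega> v"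
  and restrict_scale: "restrict_vf \<Omega> (scale_vf c v) = scale_vf c (restrict_vf \<Omega> v)"
  and restrict_0: "restrict_vf \<Omega> 0 = 0"
  by (auto simp: restrict_vf_def fun_eq_iff plus_fun_apply zero_fun_apply scale_vf_apply)

lemma vfields_differentiable: "v \<in> vfields \<Omega> \<Longrightarrow> p \<in> \<Omega> \<Longrightarrow> v differentiable at p"
  unfolding vfields_def using smooth_on_differentiable by blast

lemma vf_subspace_vfields:
  assumes "open \<Omega>"
  shows "vf.subspace (vfields \<Omega>)"
  unfolding vf.subspace_def
proof (intro conjI ballI allI)
  show "0 \<in> vfields \<Omega>" using smooth_on_const[of \<Omega> "0 :: real \<times> real"] by (simp add: vfields_def zero_fun_def)
  show "u + v \<in> vfields \<Omega>" if "u \<in> vfields \<Omega>" "v \<in> vfields \<Omega>" for u v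
    using that by (auto simp: vfields_def plus_fun_def intro!: smooth_on_add[OF assms])
  show "scale_vf c v \<in> vfields \<Omega>" if "v \<in> vfields \<Omega>" for c v
    using that by (auto simp: vfields_def scale_vf_def intro!: smooth_on_linear_compose[OF assms bounded_linear_scaleR_right])
qed

lemma lie_bracket_add:
  assumes "u \<in> vfields \<Omega>" "u' \<in> vfields \<Omega>" "v \<in> vfields \<Omega>"
  shows "lie_bracket \<Omega> (u + u') v = lie_bracket \<Omega> u v + lie_bracket \<Omega> u' v"
proof
  fix p
  show "lie_bracket \<Omega> (u + u') v p = (lie_bracket \<Omega> u v + lie_bracket \<Omega> u' v) p"
  proof (cases "p \<in> \<Omega>")
    case True
    note d = assms[THEN vfields_differentiable, OF True]
    have "frechet_derivative (u + u') (at p) = (\<lambda>h. frechet_derivative u (at p) h + frechet_derivative u' (at p) h)"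
      unfolding plus_fun_def using d
      by (intro frechet_derivative_eqI has_derivative_add) (simp_all add: frechet_derivative_works[symmetric])
    moreover have "frechet_derivative v (at p) (u p + u' p) = frechet_derivative v (at p) (u p) + frechet_derivative v (at p) (u' p)"
      using linear_frechet_derivative[OF d(3)] by (rule linear_add)
    ultimately show ?thesis using True by (simp add: lie_bracket_def restrict_vf_def plus_fun_apply)
  qed (simp add: lie_bracket_def restrict_vf_def plus_fun_apply)
qed

lemma lie_bracket_scale:
  assumes "u \<in> vfields \<Omega>" "v \<in> vfields \<Omega>"
  shows "lie_bracket \<Omega> (scale_vf c u) v = scale_vf c (lie_bracket \<Omega> u v)"
proof
  fix p
  show "lie_bracket \<Omega> (scale_vf c u) v p = scale_vf c (lie_bracket \<Omega> u v) p"
  proof (cases "p \<in> \<Omega>")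
    case True
    note d = assms[THEN vfields_differentiable, OF True]
    have "frechet_derivative (scale_vf c u) (at p) = (\<lambda>h. c *\<^sub>R frechet_derivative u (at p) h)"
      unfolding scale_vf_def using d
      by (intro frechet_derivative_eqI has_derivative_scaleR_right) (simp_all add: frechet_derivative_works[symmetric])
    moreover have "frechet_derivative v (at p) (c *\<^sub>R u p) = c *\<^sub>R frechet_derivative v (at p) (u p)"
      using linear_frechet_derivative[OF d(2)] by (rule linear_scale)
    ultimately show ?thesis using True
      by (simp add: lie_bracket_def restrict_vf_def scale_vf_apply scaleR_diff_right)
  qed (simp add: lie_bracket_def restrict_vf_def scale_vf_apply)
qed

lemma lie_bracket_swap: "lie_bracket \<Omega> v u = scale_vf (- 1) (lie_bracket \<Omega> u v)"
  by (auto simp: lie_bracket_def restrict_vf_def scale_vf_def fun_eq_iff)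

lemma lie_bracket_restrict:
  assumes \<Omega>: "open \<Omega>" and u: "\<And>p. (u has_derivative Du p) (at p)" and v: "\<And>p. (v has_derivative Dv p) (at p)"
  shows "lie_bracket \<Omega> (restrict_vf \<Omega> u) (restrict_vf \<Omega> v) = restrict_vf \<Omega> (\<lambda>p. Dv p (u p) - Du p (v p))"
proof
  fix p
  show "lie_bracket \<Omega> (restrict_vf \<Omega> u) (restrict_vf \<Omega> v) p = restrict_vf \<Omega> (\<lambda>p. Dv p (u p) - Du p (v p)) p"
  proof (cases "p \<in> \<Omega>")
    case True
    have "frechet_derivative (restrict_vf \<Omega> w) (at p) = frechet_derivative w (at p)" for w :: vfield
      by (rule frechet_derivative_cong_open(1)[OF \<Omega> True]) (simp add: restrict_vf_def)
    then show ?thesis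
      using True frechet_derivative_eqI[OF u] frechet_derivative_eqI[OF v]
      by (simp add: lie_bracket_def restrict_vf_def)
  qed (simp add: lie_bracket_def restrict_vf_def)
qed

text \<open>Linearity extends closure from the generators to their span one argument at a time, and
  antisymmetry exchanges the arguments.\<close>

lemma lie_subalgebra_span:
  assumes \<Omega>: "open \<Omega>" and B: "B \<subseteq> vfields \<Omega>"
    and br: "\<And>u v. u \<in> B \<Longrightarrow> v \<in> B \<Longrightarrow> lie_bracket \<Omega> u v \<in> vf.span B"
  shows "lie_subalgebra \<Omega> (vf.span B)"
proof -
  have sub: "vf.span B \<subseteq> vfields \<Omega>"
    by (rule vf.span_minimal[OF B vf_subspace_vfields[OF \<Omega>]])
  have left: "lie_bracket \<Omega> u v \<in> vf.span B"
    if v: "v \<in> vfields \<Omega>" and vB: "\<And>u. u \<in> B \<Longrightarrow> lie_bracket \<Omega> u v \<in> vf.span B" and u: "u \<in> vf.span B" for u v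
  proof -
    let ?K = "{u \<in> vf.span B. lie_bracket \<Omega> u v \<in> vf.span B}"
    have "vf.subspace ?K"
      unfolding vf.subspace_def
    proof (intro conjI ballI allI)
      have "lie_bracket \<Omega> 0 v = 0"
        using lie_bracket_scale[OF vf.subspace_0[OF vf_subspace_vfields[OF \<Omega>]] v, of 0]
        by (simp add: vf.scale_zero_left)
      then show "0 \<in> ?K" using vf.span_zero by simp
      show "x + y \<in> ?K" if "x \<in> ?K" "y \<in> ?K" for x y
      proof -
        have "x \<in> vfields \<Omega>" "y \<in> vfields \<Omega>" using that sub by auto
        then show ?thesis using that by (simp add: lie_bracket_add v vf.span_add)
      qed
      show "scale_vf c x \<in> ?K" if "x \<in> ?K" for c x
      proof -
        have "x \<in> vfields \<Omega>" using that sub by auto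
        then show ?thesis using that by (simp add: lie_bracket_scale v vf.span_scale)
      qed
    qed
    moreover have "B \<subseteq> ?K" using vB vf.span_base by blast
    ultimately have "vf.span B \<subseteq> ?K" by (rule vf.span_minimal[rotated])
    with u show ?thesis by blast
  qed
  have swap: "lie_bracket \<Omega> v u \<in> vf.span B" if "lie_bracket \<Omega> u v \<in> vf.span B" for u v
    unfolding lie_bracket_swap[of \<Omega> v u] using that by (rule vf.span_scale)
  have 2: "lie_bracket \<Omega> u v \<in> vf.span B" if u: "u \<in> vf.span B" and v: "v \<in> vf.span B" for u v
  proof (rule left[OF _ _ u])
    show "v \<in> vfields \<Omega>" using v sub by blast
    fix b assume b: "b \<in> B"
    then have "lie_bracket \<Omega> v b \<in> vf.span B"
      using B br by (intro left[OF _ _ v]) auto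
    then show "lie_bracket \<Omega> b v \<in> vf.span B" by (rule swap)
  qed
  show ?thesis
    unfolding lie_subalgebra_def using sub 2 vf.subspace_span by blast
qed

lemma lie_generated_span:
  assumes "open \<Omega>" "B \<subseteq> vfields \<Omega>"
    and "\<And>u v. u \<in> B \<Longrightarrow> v \<in> B \<Longrightarrow> lie_bracket \<Omega> u v \<in> vf.span B"
  shows "lie_generated \<Omega> B = vf.span B"
  unfolding lie_generated_def
proof (rule hull_unique)
  show "B \<subseteq> vf.span B" by (rule vf.span_superset)
  show "lie_subalgebra \<Omega> (vf.span B)" by (rule lie_subalgebra_span[OF assms])
  show "vf.span B \<subseteq> S" if "B \<subseteq> S" "lie_subalgebra \<Omega> S" for S
    using that by (intro vf.span_minimal) (simp_all add: lie_subalgebra_def)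
qed

text \<open>Ordered like the coefficients of \<open>gf\<close>, so that every algebra in question is
  the span over a set of indices.\<close>

definition bf :: "nat \<Rightarrow> nat \<Rightarrow> vfield"
  where "bf n i = (if i < n then V_field i else if i = n then W_field else if i = n + 1 then F_field
    else if i = n + 2 then G_field n else if i = n + 3 then H_field n
    else if i = n + 4 then (\<lambda>(z, w). (w, 0)) else (\<lambda>(z, w). (z * w, w\<^sup>2)))"

lemma bf_simps [simp]: "i < n \<Longrightarrow> bf n i = V_field i" "bf n n = W_field" "bf n (n + 1) = F_field" "bf n (Suc n) = F_field"
  "bf n (n + 2) = G_field n" "bf n (Suc (Suc n)) = G_field n" "bf n (n + 3) = H_field n"
  "bf n (n + 4) = (\<lambda>(z, w). (w, 0))" "bf n (n + 5) = (\<lambda>(z, w). (z * w, w\<^sup>2))"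
  by (simp_all add: bf_def)

lemma gf_sum: "gf n C = (\<Sum>i<n + 6. scale_vf (C i) (bf n i))"
proof
  fix p :: "real \<times> real"
  obtain z w where p: "p = (z, w)" by (cases p)
  have "(\<Sum>i<n. C i *\<^sub>R bf n i p) = (\<Sum>i<n. (0, C i * z ^ i))"
    by (intro sum.cong) (auto simp: p V_field_def)
  also have "\<dots> = (0, \<Sum>i<n. C i * z ^ i)"
    by (simp add: prod_eq_iff fst_sum snd_sum)
  finally have V: "(\<Sum>i<n. C i *\<^sub>R bf n i p) = (0, \<Sum>i<n. C i * z ^ i)" .
  have "(\<Sum>i<n + 6. C i *\<^sub>R bf n i p) = (\<Sum>i<n. C i *\<^sub>R bf n i p) + (\<Sum>i<6. C (n + i) *\<^sub>R bf n (n + i) p)"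
    by (rule sum_lessThan_add)
  also have "(\<Sum>i<6. C (n + i) *\<^sub>R bf n (n + i) p) = C n *\<^sub>R W_field p + C (n + 1) *\<^sub>R F_field p + C (n + 2) *\<^sub>R G_field n p +
      C (n + 3) *\<^sub>R H_field n p + C (n + 4) *\<^sub>R (w, 0) + C (n + 5) *\<^sub>R (z * w, w\<^sup>2)"
  proof -
    have 6: "{..<6 :: nat} = {0, 1, 2, 3, 4, 5}" by auto
    show ?thesis unfolding 6 by (simp add: p)
  qed
  finally show "gf n C p = (\<Sum>i<n + 6. scale_vf (C i) (bf n i)) p"
    unfolding V sum_vf_apply scale_vf_apply
    by (simp add: p gf_def W_field_def F_field_def G_field_def H_field_def algebra_simps)
qed

lemma gf_linear: "gf n (\<lambda>i. a * C i + b * C' i) = scale_vf a (gf n C) + scale_vf b (gf n C')"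
proof -
  have "gf n (\<lambda>i. a * C i + b * C' i) p = a *\<^sub>R gf n C p + b *\<^sub>R gf n C' p" for p
    by (cases p) (simp add: gf_def algebra_simps sum.distrib sum_distrib_left)
  then show ?thesis by (simp add: fun_eq_iff plus_fun_apply scale_vf_apply)
qed

lemma gf_unit:
  assumes "i < n + 6"
  shows "gf n (\<lambda>j. if j = i then 1 else 0) = bf n i"
proof -
  have "gf n (\<lambda>j. if j = i then 1 else 0) = (\<Sum>j<n + 6. if j = i then bf n i else 0)"
    unfolding gf_sum by (intro sum.cong) (auto simp: scale_vf_def fun_eq_iff zero_fun_apply)
  then show ?thesis using assms by simp
qed

lemma infinite_open_real:
  assumes "open (A :: real set)" "x \<in> A"
  shows "infinite A"
proof -
  obtain r where r: "r > 0" "ball x r \<subseteq> A" using assms openE by blast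
  moreover have "infinite (ball x r)" using r(1) by (simp add: ball_eq_greaterThanLessThan infinite_Ioo)
  ultimately show ?thesis using finite_subset by blast
qed

lemma open_contains_infinite_box:
  assumes "open (S :: (real \<times> real) set)" "S \<noteq> {}"
  obtains A B where "infinite A" "infinite B" "A \<times> B \<subseteq> S"
proof -
  obtain p where "p \<in> S" using assms(2) by blast
  then obtain A B where "open A" "open B" "p \<in> A \<times> B" "A \<times> B \<subseteq> S"
    using assms(1) open_prod_elim by metis
  then show ?thesis using infinite_open_real that by (metis mem_Times_iff)
qed

text \<open>On a box inside \<open>S\<close>, the components are polynomials in z for fixed w whose
  coefficients are polynomials in w; both variables take infinitely many values.\<close>

lemma gf_zero:
  assumes S: "open S" "S \<noteq> {}" and n: "n > 0" and 0: "\<And>p. p \<in> S \<Longrightarrow> gf n C p = 0" and i: "i < n + 6"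
  shows "C i = 0"
proof -
  obtain A B where AB: "infinite A" "infinite B" "A \<times> B \<subseteq> S"
    using open_contains_infinite_box[OF S] .
  have fst0: "C (n + 1) + 2 * C (n + 2) * z - C (n + 3) * z\<^sup>2 + C (n + 4) * w + C (n + 5) * (z * w) = 0"
    and snd0: "(\<Sum>k<n. C k * z ^ k) + C n * w + (real n - 1) * (C (n + 2) * w - C (n + 3) * (z * w)) + C (n + 5) * w\<^sup>2 = 0"
    if "z \<in> A" "w \<in> B" for z w
    using 0[of "(z, w)"] that AB(3) by (auto simp: gf_def zero_prod_def)
  have w: "C (n + 1) + C (n + 4) * w = 0" "2 * C (n + 2) + C (n + 5) * w = 0" "- C (n + 3) = 0" if "w \<in> B" for w
    using quadratic_vanishes[OF AB(1), of "C (n + 1) + C (n + 4) * w" "2 * C (n + 2) + C (n + 5) * w" "- C (n + 3)"]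
      fst0 that by (auto simp: algebra_simps)
  have b: "C (n + 1) = 0" "C (n + 4) = 0"
    using quadratic_vanishes[OF AB(2), of "C (n + 1)" "C (n + 4)" 0] w(1) by auto
  have c: "2 * C (n + 2) = 0" "C (n + 5) = 0"
    using quadratic_vanishes[OF AB(2), of "2 * C (n + 2)" "C (n + 5)" 0] w(2) by auto
  obtain z0 where z0: "z0 \<in> A" using infinite_imp_nonempty[OF AB(1)] by auto
  obtain w0 where w0: "w0 \<in> B" using infinite_imp_nonempty[OF AB(2)] by auto
  have d: "C (n + 3) = 0" using w(3)[OF w0] by simp
  have p: "(\<Sum>k<n. C k * z ^ k) = 0" "C n = 0" if "z \<in> A" for z
    using quadratic_vanishes[OF AB(2), of "\<Sum>k<n. C k * z ^ k" "C n" 0] snd0[OF that] c d by auto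
  have "C k = 0" if "k < n" for k
  proof (rule polynomial_vanishes[OF AB(1)])
    show "k \<le> n - 1" using that by simp
    have "{..n - 1} = {..<n}" using n by auto
    then show "(\<Sum>i\<le>n - 1. C i * z ^ i) = 0" if "z \<in> A" for z using p(1)[OF that] by simp
  qed
  moreover have "i < n \<or> i = n \<or> i = n + 1 \<or> i = n + 2 \<or> i = n + 3 \<or> i = n + 4 \<or> i = n + 5"
    using i by arith
  ultimately show ?thesis using b c d p(2)[OF z0] by auto
qed

text \<open>\<open>L\<close> will be the restriction to \<open>\<Omega>'\<close> or the pull-back.\<close>

lemma span_bf:
  fixes L :: "vfield \<Rightarrow> vfield"
  assumes add: "\<And>u v. L (u + v) = L u + L v" and scale: "\<And>c v. L (scale_vf c v) = scale_vf c (L v)"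
    and I: "I \<subseteq> {..<n + 6}"
  shows "vf.span ((\<lambda>i. L (bf n i)) ` I) = {L (gf n C) | C. \<forall>i. i \<notin> I \<longrightarrow> C i = 0}" (is "?S = ?T")
proof
  have L0: "L 0 = 0" using scale[of 0 0] by (simp add: vf.scale_zero_left)
  have Lsum: "L (sum f A) = (\<Sum>i\<in>A. L (f i))" for f and A :: "nat set"
    by (induction A rule: infinite_finite_induct) (simp_all add: add L0)
  show "?S \<subseteq> ?T"
  proof (rule vf.span_minimal)
    show "(\<lambda>i. L (bf n i)) ` I \<subseteq> ?T"
    proof
      fix x assume "x \<in> (\<lambda>i. L (bf n i)) ` I"
      then obtain i where i: "i \<in> I" "x = L (bf n i)" by blast
      then have "x = L (gf n (\<lambda>j. if j = i then 1 else 0))" using I gf_unit[of i n] by auto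
      with i show "x \<in> ?T" by (auto intro!: exI[of _ "\<lambda>j. if j = i then 1 else 0"])
    qed
    show "vf.subspace ?T"
      unfolding vf.subspace_def
    proof (intro conjI ballI allI)
      have "gf n (\<lambda>i. 0) = 0" using gf_linear[of n 0 "\<lambda>_. 0" 0 "\<lambda>_. 0"] by (simp add: vf.scale_zero_left)
      then have "L (gf n (\<lambda>i. 0)) = 0" using L0 by simp
      then show "0 \<in> ?T" by (auto intro!: exI[of _ "\<lambda>_. 0"])
      show "x + y \<in> ?T" if x: "x \<in> ?T" and y: "y \<in> ?T" for x y
      proof -
        obtain C C' where C: "x = L (gf n C)" "\<forall>i. i \<notin> I \<longrightarrow> C i = 0" "y = L (gf n C')" "\<forall>i. i \<notin> I \<longrightarrow> C' i = 0"
          using x y by blast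
        have "x + y = L (gf n (\<lambda>i. 1 * C i + 1 * C' i))" unfolding gf_linear using C by (simp add: add)
        moreover have "\<forall>i. i \<notin> I \<longrightarrow> 1 * C i + 1 * C' i = 0" using C by simp
        ultimately show ?thesis by (intro CollectI exI[of _ "\<lambda>i. 1 * C i + 1 * C' i"]) (rule conjI)
      qed
      show "scale_vf c x \<in> ?T" if x: "x \<in> ?T" for c x
      proof -
        obtain C where C: "x = L (gf n C)" "\<forall>i. i \<notin> I \<longrightarrow> C i = 0" using x by blast
        have "scale_vf c x = L (gf n (\<lambda>i. c * C i + 0 * C i))"
          unfolding gf_linear using C by (simp add: add scale vf.scale_zero_left)
        moreover have "\<forall>i. i \<notin> I \<longrightarrow> c * C i + 0 * C i = 0" using C by simp
        ultimately show ?thesis by (intro CollectI exI[of _ "\<lambda>i. c * C i + 0 * C i"]) (rule conjI)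
      qed
    qed
  qed
  show "?T \<subseteq> ?S"
  proof
    fix x assume "x \<in> ?T"
    then obtain C where C: "x = L (gf n C)" "\<forall>i. i \<notin> I \<longrightarrow> C i = 0" by blast
    have "x = (\<Sum>i<n + 6. scale_vf (C i) (L (bf n i)))"
      unfolding C(1) gf_sum Lsum scale ..
    also have "\<dots> \<in> ?S"
    proof (rule vf.span_sum)
      fix i
      show "scale_vf (C i) (L (bf n i)) \<in> ?S"
      proof (cases "i \<in> I")
        case True
        then show ?thesis by (intro vf.span_scale vf.span_base) blast
      next
        case False
        then show ?thesis using C(2) vf.span_zero by (simp add: vf.scale_zero_left)
      qed
    qed
    finally show "x \<in> ?S" .
  qed
qed

lemma independent_bf:
  fixes L :: "vfield \<Rightarrow> vfield"
  assumes add: "\<And>u v. L (u + v) = L u + L v" and scale: "\<And>c v. L (scale_vf c v) = scale_vf c (L v)"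
    and ker: "\<And>C. L (gf n C) = 0 \<Longrightarrow> \<forall>i<n + 6. C i = 0" and I: "I \<subseteq> {..<n + 6}"
  shows "inj_on (\<lambda>i. L (bf n i)) I" "vf.independent ((\<lambda>i. L (bf n i)) ` I)"
proof -
  have L0: "L 0 = 0" using scale[of 0 0] by (simp add: vf.scale_zero_left)
  have Lsum: "L (sum f A) = (\<Sum>i\<in>A. L (f i))" for f and A :: "nat set"
    by (induction A rule: infinite_finite_induct) (simp_all add: add L0)
  show inj: "inj_on (\<lambda>i. L (bf n i)) I"
  proof (rule inj_onI, rule ccontr)
    fix i j assume ij: "i \<in> I" "j \<in> I" "L (bf n i) = L (bf n j)" "i \<noteq> j"
    let ?C = "\<lambda>k. 1 * (if k = i then 1 else 0) + (- 1) * (if k = j then 1 else 0 :: real)"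
    have "i < n + 6" "j < n + 6" using ij I by auto
    then have "L (gf n ?C) = scale_vf 1 (L (bf n i)) + scale_vf (- 1) (L (bf n j))"
      unfolding gf_linear by (simp only: gf_unit add scale)
    also have "\<dots> = 0" unfolding ij(3) scale_vf_def by (simp add: fun_eq_iff plus_fun_apply zero_fun_apply)
    finally have "?C i = 0" using ker[of ?C] ij(1) I by blast
    with ij(4) show False by simp
  qed
  show "vf.independent ((\<lambda>i. L (bf n i)) ` I)"
  proof (rule vf.independent_if_scalars_zero)
    show "finite ((\<lambda>i. L (bf n i)) ` I)" using I finite_subset by blast
    fix f x assume 0: "(\<Sum>x\<in>(\<lambda>i. L (bf n i)) ` I. scale_vf (f x) x) = 0" and x: "x \<in> (\<lambda>i. L (bf n i)) ` I"
    obtain i where i: "i \<in> I" "x = L (bf n i)" using x by blast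
    let ?C = "\<lambda>i. if i \<in> I then f (L (bf n i)) else 0"
    have "L (gf n ?C) = (\<Sum>i<n + 6. scale_vf (?C i) (L (bf n i)))"
      unfolding gf_sum Lsum scale ..
    also have "\<dots> = (\<Sum>i\<in>I. scale_vf (f (L (bf n i))) (L (bf n i)))"
      using I by (intro sum.mono_neutral_cong_right) (auto simp: vf.scale_zero_left)
    also have "\<dots> = 0" using 0 by (simp add: sum.reindex[OF inj])
    finally have "?C i = 0" using ker[of ?C] i(1) I by blast
    with i show "f x = 0" by simp
  qed
qed

lemma basis_has_derivative:
  "(V_field k has_derivative (\<lambda>h. (0, real k * fst p ^ (k - 1) * fst h))) (at p)"
  "(W_field has_derivative (\<lambda>h. (0, snd h))) (at p)"
  "(F_field has_derivative (\<lambda>h. (0, 0))) (at p)"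
  "(G_field n has_derivative (\<lambda>h. (2 * fst h, (real n - 1) * snd h))) (at p)"
  "(H_field n has_derivative (\<lambda>h. (- (2 * fst p * fst h), - ((real n - 1) * (fst h * snd p + fst p * snd h))))) (at p)"
  unfolding V_field_def W_field_def F_field_def G_field_def H_field_def case_prod_unfold
  by (auto intro!: derivative_eq_intros simp: algebra_simps fun_eq_iff zero_prod_def)

lemma basis_brackets:
  assumes "open \<Omega>"
  defines "r \<equiv> restrict_vf \<Omega>"
  shows "lie_bracket \<Omega> (r (V_field j)) (r (V_field k)) = 0"
    "lie_bracket \<Omega> (r W_field) (r W_field) = 0"
    "lie_bracket \<Omega> (r (V_field k)) (r W_field) = r (V_field k)"
    "lie_bracket \<Omega> (r F_field) (r (V_field k)) = scale_vf (real k) (r (V_field (k - 1)))"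
    "lie_bracket \<Omega> (r (G_field n)) (r (V_field k)) = scale_vf (2 * real k - (real n - 1)) (r (V_field k))"
    "lie_bracket \<Omega> (r (H_field n)) (r (V_field k)) = scale_vf (real n - 1 - real k) (r (V_field (Suc k)))"
    "lie_bracket \<Omega> (r F_field) (r F_field) = 0"
    "lie_bracket \<Omega> (r (G_field n)) (r (G_field n)) = 0"
    "lie_bracket \<Omega> (r (H_field n)) (r (H_field n)) = 0"
    "lie_bracket \<Omega> (r F_field) (r (G_field n)) = scale_vf 2 (r F_field)"
    "lie_bracket \<Omega> (r F_field) (r (H_field n)) = scale_vf (- 1) (r (G_field n))"
    "lie_bracket \<Omega> (r (G_field n)) (r (H_field n)) = scale_vf 2 (r (H_field n))"
proof -
  note br = lie_bracket_restrict[OF assms(1)]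
  note B = basis_has_derivative
  note defs = V_field_def W_field_def F_field_def G_field_def H_field_def restrict_vf_def fun_eq_iff zero_fun_apply
  show "lie_bracket \<Omega> (r (V_field j)) (r (V_field k)) = 0"
    unfolding r_def scale_vf_def br[OF B(1) B(1)] by (auto simp: defs zero_prod_def)
  show "lie_bracket \<Omega> (r W_field) (r W_field) = 0"
    unfolding r_def scale_vf_def br[OF B(2) B(2)] by (auto simp: defs zero_prod_def)
  show "lie_bracket \<Omega> (r (V_field k)) (r W_field) = r (V_field k)"
    unfolding r_def scale_vf_def br[OF B(1) B(2)] by (auto simp: defs)
  show "lie_bracket \<Omega> (r F_field) (r (V_field k)) = scale_vf (real k) (r (V_field (k - 1)))"
    unfolding r_def scale_vf_def br[OF B(3) B(1)] by (auto simp: defs)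
  show "lie_bracket \<Omega> (r (G_field n)) (r (V_field k)) = scale_vf (2 * real k - (real n - 1)) (r (V_field k))"
    unfolding r_def scale_vf_def br[OF B(4) B(1)] by (cases k) (auto simp: defs algebra_simps)
  show "lie_bracket \<Omega> (r (H_field n)) (r (V_field k)) = scale_vf (real n - 1 - real k) (r (V_field (Suc k)))"
    unfolding r_def scale_vf_def br[OF B(5) B(1)] by (cases k) (auto simp: defs algebra_simps power2_eq_square)
  show "lie_bracket \<Omega> (r F_field) (r F_field) = 0"
    unfolding r_def scale_vf_def br[OF B(3) B(3)] by (auto simp: defs zero_prod_def)
  show "lie_bracket \<Omega> (r (G_field n)) (r (G_field n)) = 0"
    unfolding r_def scale_vf_def br[OF B(4) B(4)] by (auto simp: defs zero_prod_def)
  show "lie_bracket \<Omega> (r (H_field n)) (r (H_field n)) = 0"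
    unfolding r_def scale_vf_def br[OF B(5) B(5)] by (auto simp: defs zero_prod_def)
  show "lie_bracket \<Omega> (r F_field) (r (G_field n)) = scale_vf 2 (r F_field)"
    unfolding r_def scale_vf_def br[OF B(3) B(4)] by (auto simp: defs)
  show "lie_bracket \<Omega> (r F_field) (r (H_field n)) = scale_vf (- 1) (r (G_field n))"
    unfolding r_def scale_vf_def br[OF B(3) B(5)] by (auto simp: defs)
  show "lie_bracket \<Omega> (r (G_field n)) (r (H_field n)) = scale_vf 2 (r (H_field n))"
    unfolding r_def scale_vf_def br[OF B(4) B(5)] by (auto simp: defs algebra_simps power2_eq_square)
qed

lemma bracket_bf_in_span:
  fixes n :: nat
  assumes \<Omega>: "open \<Omega>" and I: "I \<subseteq> {..<n + 4}"
    and F: "n + 1 \<in> I \<Longrightarrow> \<forall>k. k \<in> I \<and> k < n \<longrightarrow> k - 1 \<in> I"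
    and H: "n + 3 \<in> I \<Longrightarrow> \<forall>k. k \<in> I \<and> Suc k < n \<longrightarrow> Suc k \<in> I"
    and FH: "n + 1 \<in> I \<Longrightarrow> n + 3 \<in> I \<Longrightarrow> n + 2 \<in> I"
    and W: "n \<in> I \<Longrightarrow> n + 1 \<notin> I \<and> n + 2 \<notin> I \<and> n + 3 \<notin> I"
  defines "f \<equiv> \<lambda>i. restrict_vf \<Omega> (bf n i)"
  assumes ij: "i \<in> I" "j \<in> I"
  shows "lie_bracket \<Omega> (f i) (f j) \<in> vf.span (f ` I)"
proof -
  let ?S = "vf.span (f ` I)"
  note br = basis_brackets[OF \<Omega>]
  have base: "scale_vf c (f k) \<in> ?S" if "k \<in> I" for c k
    using that by (intro vf.span_scale vf.span_base) blast
  have base1: "f k \<in> ?S" if "k \<in> I" for k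
    using that by (intro vf.span_base) blast
  have fs: "f k = restrict_vf \<Omega> (V_field k)" if "k < n" for k using that by (simp add: f_def)
  have fn: "f n = restrict_vf \<Omega> W_field" "f (n + 1) = restrict_vf \<Omega> F_field" "f (n + 2) = restrict_vf \<Omega> (G_field n)"
    "f (n + 3) = restrict_vf \<Omega> (H_field n)" unfolding f_def bf_simps by (rule refl)+
  have swap: "lie_bracket \<Omega> u v \<in> ?S \<Longrightarrow> lie_bracket \<Omega> v u \<in> ?S" for u v
    unfolding lie_bracket_swap[of \<Omega> v u] by (rule vf.span_scale)
  have VV: "lie_bracket \<Omega> (f k) (f l) \<in> ?S" if "k < n" "l < n" for k l
    using that by (simp add: fs br vf.span_zero)
  have VW: "lie_bracket \<Omega> (f k) (f n) \<in> ?S" if "k < n" "k \<in> I" for k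
    using that base1[of k] by (simp add: fs fn br)
  have WW: "lie_bracket \<Omega> (f n) (f n) \<in> ?S" by (simp add: fn br vf.span_zero)
  have FV: "lie_bracket \<Omega> (f (n + 1)) (f k) \<in> ?S" if k: "k < n" "k \<in> I" "n + 1 \<in> I" for k
  proof -
    have "k - 1 \<in> I" "k - 1 < n" using F k by auto
    then show ?thesis using base[of "k - 1"] k by (simp only: fs fn br)
  qed
  have GV: "lie_bracket \<Omega> (f (n + 2)) (f k) \<in> ?S" if k: "k < n" "k \<in> I" for k
    using base[of k] k by (simp only: fs fn br)
  have HV: "lie_bracket \<Omega> (f (n + 3)) (f k) \<in> ?S" if k: "k < n" "k \<in> I" "n + 3 \<in> I" for k
  proof (cases "Suc k < n")
    case True
    then have "Suc k \<in> I" using H k by auto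
    then show ?thesis using base[of "Suc k"] True k by (simp only: fs fn br)
  next
    case False
    \<comment> \<open>Raising stops at \<open>k = n - 1\<close>, where the structure constant is
      zero.\<close>
    then have "real n - 1 - real k = 0" using k by simp
    then show ?thesis using k by (simp only: fs fn br vf.scale_zero_left vf.span_zero)
  qed
  have D: "lie_bracket \<Omega> (f (n + 1)) (f (n + 1)) \<in> ?S" "lie_bracket \<Omega> (f (n + 2)) (f (n + 2)) \<in> ?S"
    "lie_bracket \<Omega> (f (n + 3)) (f (n + 3)) \<in> ?S"
    by (simp_all only: fn br vf.span_zero)
  have FG: "lie_bracket \<Omega> (f (n + 1)) (f (n + 2)) \<in> ?S" if "n + 1 \<in> I"
    using base[OF that] by (simp only: fn br)
  have FH': "lie_bracket \<Omega> (f (n + 1)) (f (n + 3)) \<in> ?S" if "n + 1 \<in> I" "n + 3 \<in> I"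
    using base[OF FH[OF that]] by (simp only: fn br)
  have GH: "lie_bracket \<Omega> (f (n + 2)) (f (n + 3)) \<in> ?S" if "n + 3 \<in> I"
    using base[OF that] by (simp only: fn br)
  have c: "k < n \<or> k = n \<or> k = n + 1 \<or> k = n + 2 \<or> k = n + 3" if "k \<in> I" for k
    using I that by (auto simp: subset_eq)
  consider "i < n" | "i = n" | "i = n + 1" | "i = n + 2" | "i = n + 3" using c[OF ij(1)] by blast
  then show ?thesis
  proof cases
    case 1
    consider "j < n" | "j = n" | "j = n + 1" | "j = n + 2" | "j = n + 3" using c[OF ij(2)] by blast
    then show ?thesis
    proof cases
      case 1 with \<open>i < n\<close> show ?thesis by (intro VV)
    next
      case 2 with \<open>i < n\<close> ij show ?thesis by (simp add: VW)
    next
      case 3 with \<open>i < n\<close> ij FV[of i] show ?thesis by (intro swap[of "f j"]) simp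
    next
      case 4 with \<open>i < n\<close> ij GV[of i] show ?thesis by (intro swap[of "f j"]) simp
    next
      case 5 with \<open>i < n\<close> ij HV[of i] show ?thesis by (intro swap[of "f j"]) simp
    qed
  next
    case 2
    then have "j < n \<or> j = n" using W ij c[OF ij(2)] by auto
    with 2 ij VW[of j] WW show ?thesis using swap[of "f j" "f i"] by auto
  next
    case 3
    then have "j \<noteq> n" using W ij by auto
    with 3 ij c[OF ij(2)] FV[of j] D FG FH' show ?thesis by auto
  next
    case 4
    then have "j \<noteq> n" using W ij by auto
    with 4 ij c[OF ij(2)] GV[of j] D FG GH swap[of "f j" "f i"] show ?thesis by auto
  next
    case 5
    then have "j \<noteq> n" using W ij by auto
    with 5 ij c[OF ij(2)] HV[of j] D FH' GH swap[of "f j" "f i"] show ?thesis by auto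
  qed
qed

section \<open>Pulling back vector fields\<close>

locale point_change =
  fixes \<Omega> \<Omega>' :: "(real \<times> real) set" and \<zeta> \<phi> :: "real \<times> real \<Rightarrow> real"
  assumes pt: "point_transformation \<Omega> \<Omega>' (\<lambda>p. (\<zeta> p, \<phi> p))"
begin

definition \<sigma> where "\<sigma> = (\<lambda>p. (\<zeta> p, \<phi> p))"

lemma open_domains: "open \<Omega>" "open \<Omega>'"
  and bij: "bij_betw \<sigma> \<Omega> \<Omega>'"
  and smooth_\<sigma>: "smooth_on \<Omega> \<sigma>"
  and smooth_inverse: "smooth_on \<Omega>' (inv_into \<Omega> \<sigma>)"
  using pt by (simp_all add: point_transformation_def \<sigma>_def)

lemma smooth_coordinates: "smooth_on \<Omega> \<zeta>" "smooth_on \<Omega> \<phi>"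
  using smooth_on_linear_compose[OF open_domains(1) bounded_linear_fst smooth_\<sigma>]
    smooth_on_linear_compose[OF open_domains(1) bounded_linear_snd smooth_\<sigma>]
  by (simp_all add: \<sigma>_def)

lemma \<sigma>_derivative:
  assumes "p \<in> \<Omega>"
  shows "(\<sigma> has_derivative (\<lambda>h. (fst h * d1 \<zeta> p + snd h * d2 \<zeta> p, fst h * d1 \<phi> p + snd h * d2 \<phi> p))) (at p)"
proof -
  note d = smooth_coordinates[THEN smooth_on_differentiable, OF assms]
  have "(\<sigma> has_derivative (\<lambda>h. (frechet_derivative \<zeta> (at p) h, frechet_derivative \<phi> (at p) h))) (at p)"
    unfolding \<sigma>_def using d by (intro has_derivative_Pair) (simp_all add: frechet_derivative_works[symmetric])
  moreover have "(\<lambda>h. (frechet_derivative \<zeta> (at p) h, frechet_derivative \<phi> (at p) h)) =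
      (\<lambda>h. (fst h * d1 \<zeta> p + snd h * d2 \<zeta> p, fst h * d1 \<phi> p + snd h * d2 \<phi> p))"
    by (rule ext) (rule arg_cong2[where f = Pair, OF frechet_derivative_coordinates[OF d(1)] frechet_derivative_coordinates[OF d(2)]])
  ultimately show ?thesis by (rule subst[rotated])
qed

lemma \<sigma>_in: "p \<in> \<Omega> \<Longrightarrow> \<sigma> p \<in> \<Omega>'"
  using bij by (auto simp: bij_betw_def)

text \<open>The derivative of the inverse map makes the derivative of \<open>\<sigma>\<close>
  injective. If the determinant vanished, (zeta_y, -zeta_x) and (phi_y, -phi_x) would be in the
  kernel, so all four partial derivatives would be zero.\<close>

lemma jacobian_nonzero:
  assumes p: "p \<in> \<Omega>"
  shows "d1 \<zeta> p * d2 \<phi> p - d2 \<zeta> p * d1 \<phi> p \<noteq> 0"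
proof
  assume J: "d1 \<zeta> p * d2 \<phi> p - d2 \<zeta> p * d1 \<phi> p = 0"
  let ?D = "\<lambda>h. (fst h * d1 \<zeta> p + snd h * d2 \<zeta> p, fst h * d1 \<phi> p + snd h * d2 \<phi> p)"
  let ?\<tau> = "inv_into \<Omega> \<sigma>"
  define E where "E = frechet_derivative ?\<tau> (at (\<sigma> p))"
  have E: "(?\<tau> has_derivative E) (at (\<sigma> p))"
    using smooth_on_differentiable[OF smooth_inverse \<sigma>_in[OF p]]
    by (simp add: E_def frechet_derivative_works[symmetric])
  have "((\<lambda>x. ?\<tau> (\<sigma> x)) has_derivative (\<lambda>h. E (?D h))) (at p)"
    by (rule has_derivative_compose[OF \<sigma>_derivative[OF p] E])
  then have "((\<lambda>x. x) has_derivative (\<lambda>h. E (?D h))) (at p)"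
    by (rule has_derivative_transform_within_open[OF _ open_domains(1) p])
      (use bij in \<open>simp add: bij_betw_def inv_into_f_f\<close>)
  then have id: "(\<lambda>h. E (?D h)) = (\<lambda>h. h)"
    using has_derivative_unique has_derivative_ident by blast
  interpret E: bounded_linear E by (rule has_derivative_bounded_linear[OF E])
  have z: "h = 0" if "?D h = 0" for h
    using fun_cong[OF id, of h] that E.zero by simp
  have "(d2 \<zeta> p, - d1 \<zeta> p) = 0" by (rule z) (use J in \<open>simp add: zero_prod_def algebra_simps\<close>)
  moreover have "(d2 \<phi> p, - d1 \<phi> p) = 0" by (rule z) (use J in \<open>simp add: zero_prod_def algebra_simps\<close>)
  ultimately have "?D (1, 0) = 0" by (simp add: zero_prod_def)
  from z[OF this] show False by (simp add: zero_prod_def)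
qed

sublocale change_of_vars \<Omega> \<zeta> \<phi>
  using open_domains smooth_coordinates jacobian_nonzero by unfold_locales

text \<open>Cramer's rule for the linear system in \<open>related\<close>, extended by zero outside
  the domain.\<close>

definition pull :: "vfield \<Rightarrow> vfield"
  where "pull t = restrict_vf \<Omega> (\<lambda>p. ((d2 \<phi> p * fst (t (\<sigma> p)) - d2 \<zeta> p * snd (t (\<sigma> p))) * inverse (jac p),
    (d1 \<zeta> p * snd (t (\<sigma> p)) - d1 \<phi> p * fst (t (\<sigma> p))) * inverse (jac p)))"

lemma pull_add: "pull (s + t) = pull s + pull t"
  by (auto simp: pull_def restrict_vf_def fun_eq_iff plus_fun_apply algebra_simps)

lemma pull_scale: "pull (scale_vf c t) = scale_vf c (pull t)"
  by (auto simp: pull_def restrict_vf_def fun_eq_iff scale_vf_def algebra_simps)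

lemma pull_restrict: "pull (restrict_vf \<Omega>' t) = pull t"
  using \<sigma>_in by (auto simp: pull_def restrict_vf_def fun_eq_iff)

lemma related_iff: "related v t \<longleftrightarrow> (\<forall>p\<in>\<Omega>. fst (v p) * d1 \<zeta> p + snd (v p) * d2 \<zeta> p = fst (t (\<sigma> p)) \<and>
    fst (v p) * d1 \<phi> p + snd (v p) * d2 \<phi> p = snd (t (\<sigma> p)))"
  by (simp add: related_def \<sigma>_def)

lemma related_pull: "related (pull t) t"
  unfolding related_iff
proof
  fix p assume p: "p \<in> \<Omega>"
  let ?a = "fst (t (\<sigma> p))" and ?b = "snd (t (\<sigma> p))"
  have J: "jac p \<noteq> 0" using jacobian_nonzero[OF p] by (simp add: jac_def)
  have "(d2 \<phi> p * ?a - d2 \<zeta> p * ?b) * d1 \<zeta> p + (d1 \<zeta> p * ?b - d1 \<phi> p * ?a) * d2 \<zeta> p = ?a * jac p"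
    "(d2 \<phi> p * ?a - d2 \<zeta> p * ?b) * d1 \<phi> p + (d1 \<zeta> p * ?b - d1 \<phi> p * ?a) * d2 \<phi> p = ?b * jac p"
    by (simp_all add: jac_def algebra_simps)
  with J show "fst (pull t p) * d1 \<zeta> p + snd (pull t p) * d2 \<zeta> p = ?a \<and>
      fst (pull t p) * d1 \<phi> p + snd (pull t p) * d2 \<phi> p = ?b"
    using p by (simp add: pull_def restrict_vf_def field_simps)
qed

lemma related_unique:
  assumes "related v t" "\<And>p. p \<notin> \<Omega> \<Longrightarrow> v p = 0"
  shows "v = pull t"
proof
  fix p
  show "v p = pull t p"
  proof (cases "p \<in> \<Omega>")
    case p: True
    have J: "jac p \<noteq> 0" using jacobian_nonzero[OF p] by (simp add: jac_def)
    have t: "fst (t (\<sigma> p)) = fst (v p) * d1 \<zeta> p + snd (v p) * d2 \<zeta> p"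
      "snd (t (\<sigma> p)) = fst (v p) * d1 \<phi> p + snd (v p) * d2 \<phi> p"
      using assms(1) p by (auto simp: related_iff)
    have "d2 \<phi> p * fst (t (\<sigma> p)) - d2 \<zeta> p * snd (t (\<sigma> p)) = fst (v p) * jac p"
      "d1 \<zeta> p * snd (t (\<sigma> p)) - d1 \<phi> p * fst (t (\<sigma> p)) = snd (v p) * jac p"
      unfolding t by (simp_all add: jac_def algebra_simps)
    with J p show ?thesis by (simp add: pull_def restrict_vf_def prod_eq_iff)
  next
    case False
    then show ?thesis using assms(2) by (simp add: pull_def restrict_vf_def)
  qed
qed

lemma pushforward_related:
  assumes "related v t"
  shows "pushforward \<Omega> \<Omega>' \<sigma> v = restrict_vf \<Omega>' t"
proof
  fix q
  show "pushforward \<Omega> \<Omega>' \<sigma> v q = restrict_vf \<Omega>' t q"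
  proof (cases "q \<in> \<Omega>'")
    case True
    define p where "p = inv_into \<Omega> \<sigma> q"
    have im: "q \<in> \<sigma> ` \<Omega>" using bij True by (simp add: bij_betw_def)
    have p: "p \<in> \<Omega>" "\<sigma> p = q"
      unfolding p_def using im by (rule inv_into_into, intro f_inv_into_f)
    have "frechet_derivative \<sigma> (at p) (v p) = t (\<sigma> p)"
      using assms p(1) unfolding frechet_derivative_eqI[OF \<sigma>_derivative[OF p(1)]] related_iff
      by (simp add: prod_eq_iff)
    with p(2) True show ?thesis by (simp add: pushforward_def restrict_vf_def Let_def p_def)
  qed (simp add: pushforward_def restrict_vf_def)
qed

lemma smooth_pull_gf: "pull (gf n C) \<in> vfields \<Omega>"
  unfolding pull_def
proof (rule restrict_in_vfields[OF open_domains(1)])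
  note O = open_domains(1)
  have iJ: "smooth_on \<Omega> (\<lambda>p. inverse (jac p))"
    using smooth_on_inverse[OF O smooth_jac] jacobian_nonzero by (simp add: jac_def)
  show "smooth_on \<Omega> (\<lambda>p. ((d2 \<phi> p * fst (gf n C (\<sigma> p)) - d2 \<zeta> p * snd (gf n C (\<sigma> p))) * inverse (jac p),
     (d1 \<zeta> p * snd (gf n C (\<sigma> p)) - d1 \<phi> p * fst (gf n C (\<sigma> p))) * inverse (jac p)))"
    unfolding \<sigma>_def
    by (intro smooth_on_Pair[OF O] smooth_on_mult[OF O] smooth_on_diff[OF O] iJ smooth_on_frechet_derivative
        smooth_coordinates smooth_gf_comp[OF O])
qed

section \<open>Brackets of related fields\<close>

definition Lv :: "vfield \<Rightarrow> (real \<times> real \<Rightarrow> real) \<Rightarrow> real \<times> real \<Rightarrow> real"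
  where "Lv v g p = fst (v p) * d1 g p + snd (v p) * d2 g p"

lemma vfield_components:
  assumes "v \<in> vfields \<Omega>"
  shows "smooth_on \<Omega> (\<lambda>p. fst (v p))" "smooth_on \<Omega> (\<lambda>p. snd (v p))"
  using smooth_on_linear_compose[OF open_domains(1) bounded_linear_fst, of v]
    smooth_on_linear_compose[OF open_domains(1) bounded_linear_snd, of v] assms
  by (simp_all add: vfields_def)

lemma Lv_deriv:
  assumes v: "v \<in> vfields \<Omega>" and g: "smooth_on \<Omega> g" and p: "p \<in> \<Omega>"
  shows "frechet_derivative (Lv v g) (at p) h =
    (fst (v p) * frechet_derivative (\<lambda>p. d1 g p) (at p) h + frechet_derivative (\<lambda>p. fst (v p)) (at p) h * d1 g p) +
    (snd (v p) * frechet_derivative (\<lambda>p. d2 g p) (at p) h + frechet_derivative (\<lambda>p. snd (v p)) (at p) h * d2 g p)"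
proof -
  have d: "(\<lambda>p. fst (v p)) differentiable at p" "(\<lambda>p. snd (v p)) differentiable at p"
    "(\<lambda>p. d1 g p) differentiable at p" "(\<lambda>p. d2 g p) differentiable at p"
    using smooth_on_differentiable[OF vfield_components(1)[OF v] p] smooth_on_differentiable[OF vfield_components(2)[OF v] p]
      smooth_on_differentiable[OF smooth_on_frechet_derivative[OF g] p] by auto
  have "(Lv v g has_derivative (\<lambda>h. (fst (v p) * frechet_derivative (\<lambda>p. d1 g p) (at p) h + frechet_derivative (\<lambda>p. fst (v p)) (at p) h * d1 g p) +
    (snd (v p) * frechet_derivative (\<lambda>p. d2 g p) (at p) h + frechet_derivative (\<lambda>p. snd (v p)) (at p) h * d2 g p))) (at p)"
    unfolding Lv_def[abs_def] using d
    by (intro has_derivative_add has_derivative_mult) (simp_all add: frechet_derivative_works[symmetric])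
  then show ?thesis by (simp add: frechet_derivative_eqI)
qed

text \<open>The second derivatives of \<open>g\<close> enter symmetrically and cancel; the
  derivatives of the components form the bracket.\<close>

lemma Lv_commutator:
  assumes u: "u \<in> vfields \<Omega>" and v: "v \<in> vfields \<Omega>" and g: "smooth_on \<Omega> g" and p: "p \<in> \<Omega>"
  shows "frechet_derivative (Lv v g) (at p) (u p) - frechet_derivative (Lv u g) (at p) (v p) = Lv (lie_bracket \<Omega> u v) g p"
proof -
  have c: "frechet_derivative (\<lambda>p. fst (w p)) (at p) h = fst (frechet_derivative w (at p) h)"
    "frechet_derivative (\<lambda>p. snd (w p)) (at p) h = snd (frechet_derivative w (at p) h)" if "w \<in> vfields \<Omega>" for w h
  proof -
    have "(w has_derivative frechet_derivative w (at p)) (at p)"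
      using vfields_differentiable[OF that p] by (simp add: frechet_derivative_works[symmetric])
    from has_derivative_fst[OF this] has_derivative_snd[OF this]
    show "frechet_derivative (\<lambda>p. fst (w p)) (at p) h = fst (frechet_derivative w (at p) h)"
      "frechet_derivative (\<lambda>p. snd (w p)) (at p) h = snd (frechet_derivative w (at p) h)"
      by (simp_all add: frechet_derivative_eqI)
  qed
  have s: "frechet_derivative (\<lambda>p. frechet_derivative g (at p) e) (at p) h =
      fst h * d1 (\<lambda>p. frechet_derivative g (at p) e) p + snd h * d2 (\<lambda>p. frechet_derivative g (at p) e) p" for e h
    by (rule frechet_derivative_coordinates[OF smooth_on_differentiable[OF smooth_on_frechet_derivative[OF g] p]])
  note m = second_derivatives_commute[OF open_domains(1) g p]
  show ?thesis
    unfolding Lv_deriv[OF u g p] Lv_deriv[OF v g p] c[OF u] c[OF v] s[of _ "u p"] s[of _ "v p"] m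
    using p by (simp add: Lv_def lie_bracket_def restrict_vf_def algebra_simps)
qed

text \<open>The components of \<open>b\<close> along the map are the derivatives of zeta and phi
  along \<open>v\<close>. By the chain rule, differentiating \<open>b\<close> in the direction
  \<open>a\<close> is differentiating these along \<open>u\<close>, and the commutator formula
  applies.\<close>

lemma related_bracket:
  assumes uv: "u \<in> vfields \<Omega>" "v \<in> vfields \<Omega>" and ab: "a \<in> vfields \<Omega>'" "b \<in> vfields \<Omega>'"
    and rel: "related u a" "related v b"
  shows "related (lie_bracket \<Omega> u v) (lie_bracket \<Omega>' a b)"
proof -
  have chain: "fst (frechet_derivative b (at (\<sigma> p)) (a (\<sigma> p))) = frechet_derivative (Lv v \<zeta>) (at p) (u p)"
    "snd (frechet_derivative b (at (\<sigma> p)) (a (\<sigma> p))) = frechet_derivative (Lv v \<phi>) (at p) (u p)"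
    if p: "p \<in> \<Omega>" and b: "b \<in> vfields \<Omega>'" and r: "related u a" "related v b" for p u v a b
  proof -
    have "(b has_derivative frechet_derivative b (at (\<sigma> p))) (at (\<sigma> p))"
      using vfields_differentiable[OF b \<sigma>_in[OF p]] by (simp add: frechet_derivative_works[symmetric])
    note B = has_derivative_compose[OF \<sigma>_derivative[OF p] this]
    have a: "(fst (u p) * d1 \<zeta> p + snd (u p) * d2 \<zeta> p, fst (u p) * d1 \<phi> p + snd (u p) * d2 \<phi> p) = a (\<sigma> p)"
      using r(1) p by (auto simp: related_iff prod_eq_iff)
    have "frechet_derivative (Lv v \<zeta>) (at p) = frechet_derivative (\<lambda>p. fst (b (\<sigma> p))) (at p)"
      "frechet_derivative (Lv v \<phi>) (at p) = frechet_derivative (\<lambda>p. snd (b (\<sigma> p))) (at p)"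
      by (rule frechet_derivative_cong_open(1)[OF open_domains(1) p]; use r(2) in \<open>simp add: Lv_def related_iff\<close>)+
    then show "fst (frechet_derivative b (at (\<sigma> p)) (a (\<sigma> p))) = frechet_derivative (Lv v \<zeta>) (at p) (u p)"
      "snd (frechet_derivative b (at (\<sigma> p)) (a (\<sigma> p))) = frechet_derivative (Lv v \<phi>) (at p) (u p)"
      using frechet_derivative_eqI[OF has_derivative_fst[OF B]] frechet_derivative_eqI[OF has_derivative_snd[OF B]] a
      by simp_all
  qed
  show ?thesis
    unfolding related_iff
  proof
    fix p assume p: "p \<in> \<Omega>"
    have "lie_bracket \<Omega>' a b (\<sigma> p) = frechet_derivative b (at (\<sigma> p)) (a (\<sigma> p)) - frechet_derivative a (at (\<sigma> p)) (b (\<sigma> p))"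
      using \<sigma>_in[OF p] by (simp add: lie_bracket_def restrict_vf_def)
    then show "fst (lie_bracket \<Omega> u v p) * d1 \<zeta> p + snd (lie_bracket \<Omega> u v p) * d2 \<zeta> p = fst (lie_bracket \<Omega>' a b (\<sigma> p)) \<and>
      fst (lie_bracket \<Omega> u v p) * d1 \<phi> p + snd (lie_bracket \<Omega> u v p) * d2 \<phi> p = snd (lie_bracket \<Omega>' a b (\<sigma> p))"
      using chain[OF p ab(2) rel] chain[OF p ab(1) rel(2,1)]
        Lv_commutator[OF uv smooth_coordinates(1) p] Lv_commutator[OF uv smooth_coordinates(2) p]
      by (simp add: Lv_def)
  qed
qed

lemma isomorphic_pull:
  assumes T: "lie_subalgebra \<Omega>' T" and P: "\<And>t. t \<in> T \<Longrightarrow> pull t \<in> vfields \<Omega>"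
  shows "isomorphic_under_pushforward \<Omega> \<Omega>' \<sigma> (pull ` T) T"
proof -
  have TV: "T \<subseteq> vfields \<Omega>'" and sub: "vf.subspace T"
    and br: "\<And>s t. s \<in> T \<Longrightarrow> t \<in> T \<Longrightarrow> lie_bracket \<Omega>' s t \<in> T"
    using T by (auto simp: lie_subalgebra_def)
  have push: "pushforward \<Omega> \<Omega>' \<sigma> (pull t) = t" if "t \<in> T" for t
    using pushforward_related[OF related_pull] restrict_vfields TV that by auto
  have bracket: "lie_bracket \<Omega> (pull s) (pull t) = pull (lie_bracket \<Omega>' s t)" if "s \<in> T" "t \<in> T" for s t
    by (rule related_unique[OF related_bracket[OF P[OF that(1)] P[OF that(2)] _ _ related_pull related_pull]])
      (use that TV in \<open>auto simp: lie_bracket_def restrict_vf_def\<close>)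
  have S: "lie_subalgebra \<Omega> (pull ` T)"
    unfolding lie_subalgebra_def
  proof (intro conjI ballI)
    show "pull ` T \<subseteq> vfields \<Omega>" using P by blast
    have "pull 0 = 0" using pull_scale[of 0 0] by (simp add: vf.scale_zero_left)
    then show "vf.subspace (pull ` T)"
      unfolding vf.subspace_def
      using vf.subspace_0[OF sub] vf.subspace_add[OF sub] vf.subspace_scale[OF sub]
      by (auto simp: pull_add[symmetric] pull_scale[symmetric] image_iff)
    show "lie_bracket \<Omega> u v \<in> pull ` T" if "u \<in> pull ` T" "v \<in> pull ` T" for u v
      using that br by (auto simp: bracket)
  qed
  have "bij_betw (pushforward \<Omega> \<Omega>' \<sigma>) (pull ` T) T"
    by (rule bij_betw_byWitness[where f' = pull]) (auto simp: push)
  then show ?thesis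
    unfolding isomorphic_under_pushforward_def Let_def
    using S T vf.subspace_add[OF sub] vf.subspace_scale[OF sub] br
    by (auto simp: push bracket pull_add[symmetric] pull_scale[symmetric])
qed

end

section \<open>The symmetry algebras\<close>

text \<open>The general result for the identity coordinates: there D_x zeta is 1, all jets over the
  base are regular, and w^(k) is y^(k).\<close>

lemma first_integral_trivial:
  assumes \<Omega>: "open \<Omega>"
  shows "first_integral n (jets_over \<Omega>) (trivial_eq n) (\<lambda>z w. \<Sum>k<n. a k * V_integral n k z w)"
proof -
  have d: "frechet_derivative fst (at p) = fst" "frechet_derivative snd (at p) = snd" for p :: "real \<times> real"
    by (auto intro!: frechet_derivative_eqI bounded_linear_imp_has_derivative bounded_linear_fst bounded_linear_snd)
  interpret I: change_of_vars \<Omega> fst snd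
    by unfold_locales (simp_all add: \<Omega> smooth_on_bounded_linear bounded_linear_fst bounded_linear_snd d)
  have lift: "lift fst = cx" "lift snd = cu 0"
    by (simp_all add: lift_def cx_def cu_def)
  have "Dx cx x u = 1" for x u
    by (simp add: Dx_def pd_x_def pd_u_def cx_apply)
  then have U: "regular_jets \<Omega> fst = jets_over \<Omega>"
    by (auto simp: regular_jets_def lift)
  have D1: "I.D1 = I.un" by (simp add: I.D1_def I.Z_def lift I.dD_coordinates)
  have W: "I.W k = I.trunc (cu k)" for k
  proof (induction k)
    case 0
    then show ?case by (simp add: I.W_def lift)
  next
    case (Suc k)
    have "I.Dz (I.W k) = I.iv * (I.un * cu (Suc k))"
      unfolding Suc I.Dz_def by (simp add: I.dD_coordinates)
    also have "\<dots> = (I.D1 * I.iv) * cu (Suc k)" unfolding D1 by (simp only: mult_ac)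
    finally show ?case by (simp add: I.W_Suc I.inverses I.trunc_un)
  qed
  let ?P = "\<lambda>z w. \<Sum>k<n. a k * V_integral n k z w"
  have w: "w_deriv fst snd k x u = u k" if "(x, u) \<in> jets_over \<Omega>" for k x u
  proof -
    have q: "(x, u) \<in> regular_jets \<Omega> fst" using that U by simp
    show ?thesis unfolding I.w_deriv_at[OF q] W I.trunc_at[OF q] by (rule cu_apply)
  qed
  have cv: "change_vars fst snd ?P x u = ?P x u" if "(x, u) \<in> jets_over \<Omega>" for x u
    using w[OF that] by (simp add: change_vars_def)
  have fi: "first_integral n (jets_over \<Omega>) (trivial_eq n) (change_vars fst snd ?P)"
    unfolding U[symmetric]
    by (rule I.first_integral_sum) (simp add: W I.trunc_at trivial_eq_def cu_apply)
  have "I.sm (n - 1) (change_vars fst snd ?P) \<longleftrightarrow> I.sm (n - 1) ?P"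
    by (rule I.sm_cong) (simp only: U cv)
  then have "diff_function (n - 1) (jets_over \<Omega>) ?P"
    using fi unfolding first_integral_def U by blast
  moreover have "?P x (jet_of f x) = ?P x' (jet_of f x')"
    if s: "is_solution (jets_over \<Omega>) (trivial_eq n) I f" "x \<in> I" "x' \<in> I" for I f x x'
  proof -
    have "(x, jet_of f x) \<in> jets_over \<Omega>" "(x', jet_of f x') \<in> jets_over \<Omega>"
      using s by (auto simp: is_solution_def)
    moreover have "change_vars fst snd ?P x (jet_of f x) = change_vars fst snd ?P x' (jet_of f x')"
      using fi s unfolding first_integral_def by blast
    ultimately show ?thesis by (simp only: cv)
  qed
  ultimately show ?thesis unfolding first_integral_def by blast
qed

text \<open>The closure conditions of \<open>bracket_bf_in_span\<close>. They admit the lower half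
  of the V_k together with F and G, because F only lowers the degree.\<close>

definition closed_index :: "nat \<Rightarrow> nat set \<Rightarrow> bool"
  where "closed_index n I \<longleftrightarrow> (n + 1 \<in> I \<longrightarrow> (\<forall>k. k \<in> I \<and> k < n \<longrightarrow> k - 1 \<in> I)) \<and>
    (n + 3 \<in> I \<longrightarrow> (\<forall>k. k \<in> I \<and> Suc k < n \<longrightarrow> Suc k \<in> I)) \<and> (n + 1 \<in> I \<and> n + 3 \<in> I \<longrightarrow> n + 2 \<in> I) \<and>
    (n \<in> I \<longrightarrow> n + 1 \<notin> I \<and> n + 2 \<notin> I \<and> n + 3 \<notin> I)"

context point_change begin

abbreviation "f n \<equiv> \<lambda>i. restrict_vf \<Omega>' (bf n i)"

lemma f_vfields: "f n ` I \<subseteq> vfields \<Omega>'" if "I \<subseteq> {..<n + 6}"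
proof -
  have "smooth_on \<Omega>' (bf n i)" if "i < n + 6" for i
    using smooth_gf[OF open_domains(2), of n "\<lambda>j. if j = i then 1 else 0"] gf_unit[OF that] by simp
  then show ?thesis using that restrict_in_vfields[OF open_domains(2)] by blast
qed

lemma lie_generated_f:
  assumes "I \<subseteq> {..<n + 4}" "closed_index n I"
  shows "lie_generated \<Omega>' (f n ` I) = vf.span (f n ` I)" "lie_subalgebra \<Omega>' (vf.span (f n ` I))"
proof -
  have V: "f n ` I \<subseteq> vfields \<Omega>'" using assms(1) by (intro f_vfields) auto
  have br: "lie_bracket \<Omega>' u v \<in> vf.span (f n ` I)" if uv: "u \<in> f n ` I" "v \<in> f n ` I" for u v
  proof -
    obtain i j where "i \<in> I" "u = f n i" "j \<in> I" "v = f n j" using uv by blast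
    then show ?thesis
      using bracket_bf_in_span[OF open_domains(2) assms(1), of i j] assms(2) unfolding closed_index_def by blast
  qed
  show "lie_generated \<Omega>' (f n ` I) = vf.span (f n ` I)"
    by (rule lie_generated_span[OF open_domains(2) V br])
  show "lie_subalgebra \<Omega>' (vf.span (f n ` I))"
    by (rule lie_subalgebra_span[OF open_domains(2) V br])
qed

lemma span_f: "I \<subseteq> {..<n + 6} \<Longrightarrow>
    vf.span (f n ` I) = {restrict_vf \<Omega>' (gf n C) | C. \<forall>i. i \<notin> I \<longrightarrow> C i = 0}"
  by (rule span_bf) (simp_all add: restrict_add restrict_scale)

lemma restrict_gf_zero:
  assumes "restrict_vf \<Omega>' (gf n C) = 0" "\<Omega>' \<noteq> {}" "n > 0" "i < n + 6"
  shows "C i = 0"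
proof (rule gf_zero[OF open_domains(2) assms(2,3) _ assms(4)])
  show "gf n C p = 0" if "p \<in> \<Omega>'" for p
    using fun_cong[OF assms(1), of p] that by (simp add: restrict_vf_def zero_fun_apply)
qed

text \<open>Coefficients are unique on a nonempty open set, so spans over disjoint index sets meet
  in zero only.\<close>

lemma direct_sum_f:
  assumes ne: "\<Omega>' \<noteq> {}" "n > 0" and I: "I \<subseteq> {..<n + 6}" "J \<subseteq> {..<n + 6}" "I \<inter> J = {}"
  shows "is_direct_sum (vf.span (f n ` (I \<union> J))) (vf.span (f n ` I)) (vf.span (f n ` J))"
proof -
  have "x = 0" if "x \<in> vf.span (f n ` I)" "x \<in> vf.span (f n ` J)" for x
  proof -
    obtain C D where C: "x = restrict_vf \<Omega>' (gf n C)" "\<forall>i. i \<notin> I \<longrightarrow> C i = 0"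
      and D: "x = restrict_vf \<Omega>' (gf n D)" "\<forall>i. i \<notin> J \<longrightarrow> D i = 0"
      using \<open>x \<in> vf.span (f n ` I)\<close> \<open>x \<in> vf.span (f n ` J)\<close> unfolding span_f[OF I(1)] span_f[OF I(2)] by blast
    have "restrict_vf \<Omega>' (gf n (\<lambda>i. 1 * C i + (- 1) * D i)) = scale_vf 1 x + scale_vf (- 1) x"
      unfolding gf_linear restrict_add restrict_scale C(1)[symmetric] D(1)[symmetric] ..
    also have "\<dots> = 0" by (simp add: scale_vf_def fun_eq_iff plus_fun_apply zero_fun_apply)
    finally have eq: "1 * C i + (- 1) * D i = 0" if "i < n + 6" for i
      by (rule restrict_gf_zero[OF _ ne that])
    have "C i = 0" for i
    proof (cases "i \<in> I")
      case True
      then have "D i = 0" "i < n + 6" using D(2) I by auto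
      then show ?thesis using eq[of i] by simp
    next
      case False
      then show ?thesis using C(2) by blast
    qed
    then have "C = (\<lambda>i. 0 * C i + 0 * C i)" by auto
    then have "gf n C = scale_vf 0 (gf n C) + scale_vf 0 (gf n C)" using gf_linear[of n 0 C 0 C] by simp
    then have "gf n C = 0" by (simp add: vf.scale_zero_left)
    then show "x = 0" using C(1) restrict_0 by simp
  qed
  then have "vf.span (f n ` I) \<inter> vf.span (f n ` J) = {0}"
    using vf.span_zero by blast
  then show ?thesis
    unfolding is_direct_sum_def image_Un vf.span_Un using vf.subspace_span by blast
qed

lemma symmetry_algebra_structure:
  assumes ne: "\<Omega>' \<noteq> {}" "n > 0" and I: "I \<subseteq> {..<n + 4}" "J \<subseteq> {..<n + 4}" "I \<inter> J = {}"
    and closed: "closed_index n I" "closed_index n J" "closed_index n (I \<union> J)"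
    and S: "S = pull ` vf.span (f n ` (I \<union> J))"
  shows "\<exists>T. is_direct_sum T (lie_generated \<Omega>' (f n ` I)) (lie_generated \<Omega>' (f n ` J)) \<and>
    isomorphic_under_pushforward \<Omega> \<Omega>' \<sigma> S T"
proof (intro exI conjI)
  let ?T = "vf.span (f n ` (I \<union> J))"
  have IJ: "I \<union> J \<subseteq> {..<n + 4}" "I \<union> J \<subseteq> {..<n + 6}" "I \<subseteq> {..<n + 6}" "J \<subseteq> {..<n + 6}"
    using I by auto
  show "is_direct_sum ?T (lie_generated \<Omega>' (f n ` I)) (lie_generated \<Omega>' (f n ` J))"
    unfolding lie_generated_f(1)[OF I(1) closed(1)] lie_generated_f(1)[OF I(2) closed(2)]
    by (rule direct_sum_f[OF ne IJ(3,4) I(3)])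
  show "isomorphic_under_pushforward \<Omega> \<Omega>' \<sigma> S ?T"
    unfolding S
  proof (rule isomorphic_pull[OF lie_generated_f(2)[OF IJ(1) closed(3)]])
    fix t assume "t \<in> ?T"
    then obtain C where "t = restrict_vf \<Omega>' (gf n C)" unfolding span_f[OF IJ(2)] by blast
    then show "pull t \<in> vfields \<Omega>" using smooth_pull_gf by (simp add: pull_restrict)
  qed
qed

lemma f_images:
  "f n ` {..<m} = {restrict_vf \<Omega>' (V_field k) | k. k < m}" if "m \<le> n" for m
  using that by (auto simp: image_iff)

lemma f_images':
  "f n ` {n} = {restrict_vf \<Omega>' W_field}"
  "f n ` {n + 1, n + 2, n + 3} = {restrict_vf \<Omega>' F_field, restrict_vf \<Omega>' (G_field n), restrict_vf \<Omega>' (H_field n)}"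
  "f n ` {n + 1, n + 2} = {restrict_vf \<Omega>' F_field, restrict_vf \<Omega>' (G_field n)}"
  by simp_all

section \<open>Symmetries of an equation with maximal symmetry\<close>

context
  fixes n :: nat and \<Delta> :: dfun and c :: real
  assumes n2: "n \<ge> 2" and \<Delta>: "trunc \<Delta> = trunc (cst c * (Jc * W n))" and c: "c \<noteq> 0"
    and max_sym: "maximal_symmetry n \<Omega> U \<Delta>"
begin

text \<open>The value n + 6 for n = 2 is the maximal dimension 8.\<close>

definition N where "N = (if n = 2 then n + 6 else n + 4)"

lemma dim_symmetries: "vf.dim (lie_symmetries \<Omega> U \<Delta>) = N"
  using max_sym by (simp add: maximal_symmetry_def N_def)

text \<open>An empty domain carries the zero field only, while the symmetry algebra has positive
  dimension.\<close>

lemma domains_nonempty: "\<Omega> \<noteq> {}" "\<Omega>' \<noteq> {}"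
proof -
  obtain B where B: "B \<subseteq> lie_symmetries \<Omega> U \<Delta>" "vf.independent B" "card B = N"
    using vf.basis_exists[of "lie_symmetries \<Omega> U \<Delta>"] dim_symmetries by metis
  then have "B \<noteq> {}" using n2 by (auto simp: N_def split: if_splits)
  then obtain b where b: "b \<in> B" by blast
  have "b \<noteq> 0" using b B(2) vf.dependent_zero by blast
  moreover have "b \<in> vfields \<Omega>" using b B(1) by (auto simp: lie_symmetries_def)
  ultimately show "\<Omega> \<noteq> {}" by (auto simp: vfields_def fun_eq_iff zero_fun_apply)
  then show "\<Omega>' \<noteq> {}" using \<sigma>_in by blast
qed

text \<open>The target contains a box, and along a horizontal line of that box z takes infinitely
  many values.\<close>

lemma infinite_\<zeta>: "infinite (\<zeta> ` \<Omega>)"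
proof -
  obtain A B where AB: "infinite A" "infinite B" "A \<times> B \<subseteq> \<Omega>'"
    using open_contains_infinite_box[OF open_domains(2) domains_nonempty(2)] .
  obtain b where b: "b \<in> B" using infinite_imp_nonempty[OF AB(2)] by auto
  have "A \<subseteq> \<zeta> ` \<Omega>"
  proof
    fix z assume "z \<in> A"
    then have "(z, b) \<in> \<sigma> ` \<Omega>" using AB(3) b bij by (auto simp: bij_betw_def)
    then show "z \<in> \<zeta> ` \<Omega>" by (auto simp: \<sigma>_def)
  qed
  then show ?thesis using AB(1) finite_subset by blast
qed

lemma pull_gf_zero:
  assumes "pull (gf n C) = 0"
  shows "\<forall>i<n + 6. C i = 0"
proof (intro allI impI)
  fix i assume i: "i < n + 6"
  show "C i = 0"
  proof (rule gf_zero[OF open_domains(2) domains_nonempty(2) _ _ i])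
    show "n > 0" using n2 by simp
    fix q assume "q \<in> \<Omega>'"
    then obtain p where p: "p \<in> \<Omega>" "q = \<sigma> p" using bij by (auto simp: bij_betw_def)
    have "fst (gf n C q) = 0" "snd (gf n C q) = 0"
      using related_pull[of "gf n C"] p unfolding related_iff assms by (auto simp: zero_fun_apply)
    then show "gf n C q = 0" by (simp add: prod_eq_iff)
  qed
qed

lemma admissible: "\<forall>i. i \<notin> {..<N} \<longrightarrow> C i = 0 \<Longrightarrow> n = 2 \<or> C (n + 4) = 0 \<and> C (n + 5) = 0"
  by (auto simp: N_def)

lemma N_le: "{..<N} \<subseteq> {..<n + 6}" and N_ge: "n + 4 \<le> N"
  by (auto simp: N_def)

lemma smooth_pull: "smooth_on \<Omega> (pull (gf n C))"
  using smooth_pull_gf by (simp add: vfields_def)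

lemma pull_gf_symmetry:
  assumes C: "\<forall>i. i \<notin> {..<N} \<longrightarrow> C i = 0"
  shows "pull (gf n C) \<in> lie_symmetries \<Omega> U \<Delta>"
  unfolding lie_symmetries_def
  using smooth_pull_gf[of n C] prolong_Delta[OF smooth_pull related_pull admissible[OF C] \<Delta> c] by blast

text \<open>The known symmetries are independent and as many as the symmetry algebra has dimensions,
  so they span it.\<close>

lemma lie_symmetries_eq:
  "lie_symmetries \<Omega> U \<Delta> = {pull (gf n C) | C. \<forall>i. i \<notin> {..<N} \<longrightarrow> C i = 0}"
proof
  let ?B = "(\<lambda>i. pull (bf n i)) ` {..<N}"
  note span = span_bf[of pull, OF pull_add pull_scale N_le]
  note ind = independent_bf[of pull n, OF pull_add pull_scale pull_gf_zero N_le]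
  have "card ?B = N" using ind(1) by (simp add: card_image)
  obtain B where B: "lie_symmetries \<Omega> U \<Delta> \<subseteq> vf.span B" "card B = N"
    using vf.basis_exists[of "lie_symmetries \<Omega> U \<Delta>"] dim_symmetries by metis
  \<comment> \<open>An infinite basis would have cardinality \<open>0\<close>, but N is
    positive.\<close>
  have finB: "finite B" using B(2) N_ge by (intro card_ge_0_finite) simp
  have BS: "?B \<subseteq> lie_symmetries \<Omega> U \<Delta>"
  proof
    fix v assume "v \<in> ?B"
    then have "v \<in> vf.span ?B" by (rule vf.span_base)
    then obtain C where "v = pull (gf n C)" "\<forall>i. i \<notin> {..<N} \<longrightarrow> C i = 0" unfolding span by blast
    then show "v \<in> lie_symmetries \<Omega> U \<Delta>" using pull_gf_symmetry by blast
  qed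
  have "v \<in> vf.span ?B" if v: "v \<in> lie_symmetries \<Omega> U \<Delta>" for v
  proof (rule ccontr)
    assume nv: "v \<notin> vf.span ?B"
    then have "vf.independent (insert v ?B)" using ind(2) by (rule vf.independent_insertI)
    moreover have "insert v ?B \<subseteq> vf.span B" using v BS B(1) by blast
    ultimately have "card (insert v ?B) \<le> N" using vf.independent_span_bound[OF finB] B(2) by metis
    moreover have "card (insert v ?B) = Suc (card ?B)"
    proof (rule card_insert_disjoint)
      show "finite ?B" by (rule finite_imageI) (rule finite_lessThan)
      show "v \<notin> ?B" using nv by (rule contrapos_nn) (rule vf.span_base)
    qed
    ultimately show False using \<open>card ?B = N\<close> by linarith
  qed
  then show "lie_symmetries \<Omega> U \<Delta> \<subseteq> {pull (gf n C) | C. \<forall>i. i \<notin> {..<N} \<longrightarrow> C i = 0}"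
    unfolding span by blast
  show "{pull (gf n C) | C. \<forall>i. i \<notin> {..<N} \<longrightarrow> C i = 0} \<subseteq> lie_symmetries \<Omega> U \<Delta>"
    using pull_gf_symmetry by blast
qed

text \<open>Reduces the determination of a subalgebra of symmetries to the question which
  coefficients have to vanish.\<close>

lemma symmetries_with_property:
  assumes I: "I \<subseteq> {..<N}"
    and P: "\<And>C. \<forall>i. i \<notin> {..<N} \<longrightarrow> C i = 0 \<Longrightarrow> P (pull (gf n C)) \<longleftrightarrow> (\<forall>i. i \<notin> I \<longrightarrow> C i = 0)"
  shows "{v \<in> lie_symmetries \<Omega> U \<Delta>. P v} = pull ` vf.span (f n ` I)"
proof -
  have "{v \<in> lie_symmetries \<Omega> U \<Delta>. P v} = {pull (gf n C) | C. \<forall>i. i \<notin> I \<longrightarrow> C i = 0}"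
    unfolding lie_symmetries_eq using P I by blast
  also have "\<dots> = pull ` {restrict_vf \<Omega>' (gf n C) | C. \<forall>i. i \<notin> I \<longrightarrow> C i = 0}"
    using pull_restrict[of "gf n _"] by (auto simp: image_iff) metis+
  also have "{restrict_vf \<Omega>' (gf n C) | C. \<forall>i. i \<notin> I \<longrightarrow> C i = 0} = vf.span (f n ` I)"
    by (rule span_f[OF order_trans[OF I N_le], symmetric])
  finally show ?thesis .
qed

lemma divergence_condition:
  assumes C: "\<forall>i. i \<notin> {..<N} \<longrightarrow> C i = 0"
  shows "(\<forall>(x, u)\<in>U. frechet_adjoint \<Delta> (characteristic (pull (gf n C))) x u +
      frechet_adjoint (characteristic (pull (gf n C))) \<Delta> x u = 0) \<longleftrightarrow> (\<forall>x u. (x, u) \<in> U \<longrightarrow> Ehat n C x u = 0)"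
  using adjoint_sum[OF smooth_pull related_pull admissible[OF C] \<Delta>] c Jc_nonzero by auto

lemma S_div_odd:
  assumes "odd n"
  shows "S_div \<Omega> U \<Delta> = pull ` vf.span (f n ` ({..<n} \<union> {n}))"
  unfolding S_div_def
proof (rule symmetries_with_property)
  show "{..<n} \<union> {n} \<subseteq> {..<N}" using N_ge by auto
  fix C :: "nat \<Rightarrow> real" assume C: "\<forall>i. i \<notin> {..<N} \<longrightarrow> C i = 0"
  have N: "N = n + 4" using assms by (auto simp: N_def)
  have e: "i \<notin> {..<n} \<union> {n} \<longleftrightarrow> i = n + 1 \<or> i = n + 2 \<or> i = n + 3 \<or> i \<notin> {..<N}" for i
    unfolding N by auto
  have "C (n + 4) = 0" "C (n + 5) = 0" using C by (auto simp: N)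
  from Ehat_odd[where C = C, OF infinite_\<zeta> assms this]
  show "(\<forall>(x, u)\<in>U. frechet_adjoint \<Delta> (characteristic (pull (gf n C))) x u +
      frechet_adjoint (characteristic (pull (gf n C))) \<Delta> x u = 0) \<longleftrightarrow> (\<forall>i. i \<notin> {..<n} \<union> {n} \<longrightarrow> C i = 0)"
    unfolding divergence_condition[OF C] e using C by blast
qed

lemma S_div_even:
  assumes "even n"
  shows "S_div \<Omega> U \<Delta> = pull ` vf.span (f n ` ({..<n} \<union> {n + 1, n + 2, n + 3}))"
  unfolding S_div_def
proof (rule symmetries_with_property)
  show "{..<n} \<union> {n + 1, n + 2, n + 3} \<subseteq> {..<N}" using N_ge by auto
  fix C :: "nat \<Rightarrow> real" assume C: "\<forall>i. i \<notin> {..<N} \<longrightarrow> C i = 0"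
  \<comment> \<open>The bound \<open>n + 6\<close> serves n = 2 and n > 2 alike, as the two last
    coefficients are among those that \<open>Ehat_even\<close> forces to vanish.\<close>
  have e: "i \<notin> {..<n} \<union> {n + 1, n + 2, n + 3} \<longleftrightarrow> i = n \<or> i = n + 4 \<or> i = n + 5 \<or> i \<notin> {..<n + 6}" for i
    by auto
  have C': "C i = 0" if "i \<notin> {..<n + 6}" for i
    by (rule C[rule_format, OF contra_subsetD[OF N_le that]])
  show "(\<forall>(x, u)\<in>U. frechet_adjoint \<Delta> (characteristic (pull (gf n C))) x u +
      frechet_adjoint (characteristic (pull (gf n C))) \<Delta> x u = 0) \<longleftrightarrow>
      (\<forall>i. i \<notin> {..<n} \<union> {n + 1, n + 2, n + 3} \<longrightarrow> C i = 0)"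
    unfolding divergence_condition[OF C] Ehat_even[OF infinite_\<zeta> assms n2] e using C' by blast
qed

lemma S_var_even:
  assumes "even n"
  shows "S_var \<Omega> U \<Delta> (transformed_lagrangian n \<zeta> \<phi>) = pull ` vf.span (f n ` ({..<n div 2} \<union> {n + 1, n + 2}))"
  unfolding S_var_def
proof (rule symmetries_with_property)
  define m where "m = n div 2"
  have m: "n = 2 * m" "m > 0" using assms n2 by (auto simp: m_def)
  show "{..<n div 2} \<union> {n + 1, n + 2} \<subseteq> {..<N}" using N_ge by auto
  fix C :: "nat \<Rightarrow> real" assume C: "\<forall>i. i \<notin> {..<N} \<longrightarrow> C i = 0"
  let ?L = "transformed_lagrangian n \<zeta> \<phi>" and ?v = "pull (gf n C)"
  let ?b = "\<lambda>x u. (\<Sum>k<n. C k * ff k m * Z x u ^ (k - m)) + C n * W m x u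
      - C (n + 3) * (real m)\<^sup>2 * W (m - 1) x u + 3 / 2 * C (n + 5) * W 0 x u * W m x u
      - 1 / 2 * (C (n + 4) + C (n + 5) * Z x u) * (W m x u)\<^sup>2"
  have "prolong ?v ?L x u + ?L x u * Dx (lift (\<lambda>p. fst (?v p))) x u = 2 * ((- 1) ^ m / 2) * D1 x u * (W m x u * ?b x u)"
    if q: "(x, u) \<in> U" for x u
    using prolong_lagrangian[OF smooth_pull related_pull admissible[OF C] trunc_lagrangian[of n, folded m_def] q]
      variational_bracket[OF smooth_pull related_pull admissible[OF C] m q] by simp
  then have "(\<forall>(x, u)\<in>U. prolong ?v ?L x u + ?L x u * Dx (lift (\<lambda>p. fst (?v p))) x u = 0) \<longleftrightarrow>
      (\<forall>x u. (x, u) \<in> U \<longrightarrow> W m x u * ?b x u = 0)"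
    using D1_nonzero by auto
  also have "\<dots> \<longleftrightarrow> C n = 0 \<and> C (n + 3) = 0 \<and> C (n + 4) = 0 \<and> C (n + 5) = 0 \<and> (\<forall>k. m \<le> k \<and> k < n \<longrightarrow> C k = 0)"
    by (rule variational_coefficients[OF infinite_\<zeta> m])
  also have "\<dots> \<longleftrightarrow> (\<forall>i. i \<notin> {..<n div 2} \<union> {n + 1, n + 2} \<longrightarrow> C i = 0)"
  proof -
    have e: "i \<notin> {..<n div 2} \<union> {n + 1, n + 2} \<longleftrightarrow>
        i = n \<or> i = n + 3 \<or> i = n + 4 \<or> i = n + 5 \<or> m \<le> i \<and> i < n \<or> i \<notin> {..<n + 6}" for i
      using m by (auto simp: m_def[symmetric])
    have C': "C i = 0" if "i \<notin> {..<n + 6}" for i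
    by (rule C[rule_format, OF contra_subsetD[OF N_le that]])
    show ?thesis unfolding e using C' by blast
  qed
  finally show "(\<forall>(x, u)\<in>U. prolong ?v ?L x u + ?L x u * Dx (lift (\<lambda>p. fst (?v p))) x u = 0) \<longleftrightarrow>
      (\<forall>i. i \<notin> {..<n div 2} \<union> {n + 1, n + 2} \<longrightarrow> C i = 0)" .
qed

lemma algebras:
  "odd n \<Longrightarrow> \<exists>T. is_direct_sum T (lie_generated \<Omega>' (f n ` {..<n})) (lie_generated \<Omega>' (f n ` {n})) \<and>
      isomorphic_under_pushforward \<Omega> \<Omega>' \<sigma> (S_div \<Omega> U \<Delta>) T"
  "even n \<Longrightarrow> \<exists>T. is_direct_sum T (lie_generated \<Omega>' (f n ` {..<n})) (lie_generated \<Omega>' (f n ` {n + 1, n + 2, n + 3})) \<and>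
      isomorphic_under_pushforward \<Omega> \<Omega>' \<sigma> (S_div \<Omega> U \<Delta>) T"
  "even n \<Longrightarrow> \<exists>T. is_direct_sum T (lie_generated \<Omega>' (f n ` {..<n div 2})) (lie_generated \<Omega>' (f n ` {n + 1, n + 2})) \<and>
      isomorphic_under_pushforward \<Omega> \<Omega>' \<sigma> (S_var \<Omega> U \<Delta> (transformed_lagrangian n \<zeta> \<phi>)) T"
proof -
  have n: "n > 0" using n2 by simp
  note str = symmetry_algebra_structure[OF domains_nonempty(2) n]
  assume "odd n"
  show "\<exists>T. is_direct_sum T (lie_generated \<Omega>' (f n ` {..<n})) (lie_generated \<Omega>' (f n ` {n})) \<and>
      isomorphic_under_pushforward \<Omega> \<Omega>' \<sigma> (S_div \<Omega> U \<Delta>) T"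
    by (rule str[OF _ _ _ _ _ _ S_div_odd[OF \<open>odd n\<close>]]) (auto simp: closed_index_def)
next
  have n: "n > 0" using n2 by simp
  note str = symmetry_algebra_structure[OF domains_nonempty(2) n]
  assume even: "even n"
  show "\<exists>T. is_direct_sum T (lie_generated \<Omega>' (f n ` {..<n})) (lie_generated \<Omega>' (f n ` {n + 1, n + 2, n + 3})) \<and>
      isomorphic_under_pushforward \<Omega> \<Omega>' \<sigma> (S_div \<Omega> U \<Delta>) T"
    by (rule str[OF _ _ _ _ _ _ S_div_even[OF even]]) (auto simp: closed_index_def)
  show "\<exists>T. is_direct_sum T (lie_generated \<Omega>' (f n ` {..<n div 2})) (lie_generated \<Omega>' (f n ` {n + 1, n + 2})) \<and>
      isomorphic_under_pushforward \<Omega> \<Omega>' \<sigma> (S_var \<Omega> U \<Delta> (transformed_lagrangian n \<zeta> \<phi>)) T"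
    by (rule str[OF _ _ _ _ _ _ S_var_even[OF even]]; force simp: closed_index_def)
qed

end

end

theorem corollary2:
  fixes n :: nat
    and \<Omega> \<Omega>' :: "(real \<times> real) set"
    and \<zeta> \<phi> :: "real \<times> real \<Rightarrow> real"
    and \<sigma> :: "real \<times> real \<Rightarrow> real \<times> real"
    and \<Delta> :: dfun
    and U :: "(real \<times> (nat \<Rightarrow> real)) set"
  assumes "n \<ge> 2"
    and "\<sigma> = (\<lambda>p. (\<zeta> p, \<phi> p))"
    and "point_transformation \<Omega> \<Omega>' \<sigma>"
    and "U = regular_jets \<Omega> \<zeta>"
    and "obtained_from_trivial n \<Omega> \<zeta> \<phi> \<Delta>"
    and "\<not> linear_ode n U \<Delta>"
    and "maximal_symmetry n \<Omega> U \<Delta>"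
  shows
    "(odd n \<longrightarrow>
        (\<exists>T. is_direct_sum T
               (lie_generated \<Omega>' {restrict_vf \<Omega>' (V_field k) | k. k < n})
               (lie_generated \<Omega>' {restrict_vf \<Omega>' W_field}) \<and>
             isomorphic_under_pushforward \<Omega> \<Omega>' \<sigma> (S_div \<Omega> U \<Delta>) T)) \<and>
     (even n \<longrightarrow>
        (\<exists>T. is_direct_sum T
               (lie_generated \<Omega>' {restrict_vf \<Omega>' (V_field k) | k. k < n})
               (lie_generated \<Omega>' {restrict_vf \<Omega>' F_field, restrict_vf \<Omega>' (G_field n),
                                  restrict_vf \<Omega>' (H_field n)}) \<and>
             isomorphic_under_pushforward \<Omega> \<Omega>' \<sigma> (S_div \<Omega> U \<Delta>) T)) \<and>
     (even n \<and> lagrangian_ode U \<Delta> \<longrightarrow>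
        lagrangian_of (n div 2) U \<Delta> (transformed_lagrangian n \<zeta> \<phi>) \<and>
        (\<exists>T. is_direct_sum T
               (lie_generated \<Omega>' {restrict_vf \<Omega>' (V_field k) | k. k \<le> (n - 2) div 2})
               (lie_generated \<Omega>' {restrict_vf \<Omega>' F_field, restrict_vf \<Omega>' (G_field n)}) \<and>
             isomorphic_under_pushforward \<Omega> \<Omega>' \<sigma>
               (S_var \<Omega> U \<Delta> (transformed_lagrangian n \<zeta> \<phi>)) T)) \<and>
     (\<forall>a :: nat \<Rightarrow> real.
        first_integral n (jets_over \<Omega>') (trivial_eq n) (\<lambda>z w. \<Sum>k<n. a k * V_integral n k z w) \<and>
        first_integral n U \<Delta> (change_vars \<zeta> \<phi> (\<lambda>z w. \<Sum>k<n. a k * V_integral n k z w))) \<and>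
     fundamental_first_integrals n U \<Delta> (\<lambda>k. change_vars \<zeta> \<phi> (V_integral n k))"
proof -
  interpret S: point_change \<Omega> \<Omega>' \<zeta> \<phi>
    using assms(2,3) by unfold_locales simp
  have \<sigma>: "\<sigma> = S.\<sigma>" by (simp add: assms(2) S.\<sigma>_def)
  obtain c where c: "c \<noteq> 0"
    and "\<And>x u. (x, u) \<in> regular_jets \<Omega> \<zeta> \<Longrightarrow> \<Delta> x u = c * jacobian \<zeta> \<phi> x u * change_vars \<zeta> \<phi> (trivial_eq n) x u"
    using assms(5) unfolding obtained_from_trivial_def by blast
  then have \<Delta>: "S.trunc \<Delta> = S.trunc (cst c * (S.Jc * S.W n))"
    by (intro S.trunc_trivial)
  note max_sym = assms(7)[unfolded assms(4)]
  have W: "S.W n x u = 0" if "(x, u) \<in> regular_jets \<Omega> \<zeta>" "\<Delta> x u = 0" for x u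
    using \<Delta> that c S.Jc_nonzero[OF that(1)] unfolding S.trunc_eq_iff by (auto simp: ev)
  \<comment> \<open>For n at least 2 the truncated subtraction is exact, and the last index becomes
    a strict bound.\<close>
  have "k \<le> (n - 2) div 2 \<longleftrightarrow> k < n div 2" for k using assms(1) by auto
  then have V: "{restrict_vf \<Omega>' (V_field k) | k. k < n} = S.f n ` {..<n}"
    "{restrict_vf \<Omega>' (V_field k) | k. k \<le> (n - 2) div 2} = S.f n ` {..<n div 2}"
    using S.f_images[of n n] S.f_images[of "n div 2" n] by simp_all
  show ?thesis
    unfolding \<sigma> assms(4) V S.f_images'[of n, symmetric]
    using S.algebras[OF assms(1) \<Delta> c max_sym] S.lagrangian_of_transformed[OF _ assms(1) \<Delta> c]
      first_integral_trivial[OF S.open_domains(2)] S.first_integral_sum[OF W]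
      S.fundamental_V[OF W S.domains_nonempty(1)[OF assms(1) \<Delta> c max_sym]]
    by blast
qed

end
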